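(* The 2-category $\mathcal{C}$ of small categories admits weighted pseudo colimits: for every small 2-category $\mathcal{D}$ and all pseudo functors $J:\mathcal{D}^{op}\to Cat$ and $F:\mathcal{D}\to\mathcal{C}$, there exists a $J$-weighted pseudo colimit of $F$ in $\mathcal{C}$.
   Context: $\mathcal{C}=Cat$ has small categories as objects, functors as morphisms and natural transformations as 2-cells. Pseudo functors and pseudo natural transformations have invertible coherence 2-cells. $Hom[\mathcal{D}^{op},Cat]$ is the 2-category of pseudo functors $\mathcal{D}^{op}\to Cat$, pseudo natural transformations and modifications. An object $W$ of $\mathcal{C}$ is a $J$-weighted pseudo colimit of $F$ if the strict 2-functors $\mathcal{C}\to Cat$, $C\mapsto\mathcal{C}(W,C)$ and $C\mapsto Hom[\mathcal{D}^{op},Cat](J,\mathcal{C}(F-,C))$, are 2-naturally isomorphic. *)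

theory Defs
  imports Main "HOL-Library.FuncSet"
begin

unbundle cardinal_syntax

section \<open>Categories, functors, natural transformations\<close>

text \<open>\<open>Cmp C g f\<close> is the composite \<open>g\<close> after \<open>f\<close>; only the values of the
  operations on the carriers are constrained.\<close>

record ('o, 'm) cat =
  Obj :: "'o set"
  Arr :: "'m set"
  Dom :: "'m \<Rightarrow> 'o"
  Cod :: "'m \<Rightarrow> 'o"
  Idn :: "'o \<Rightarrow> 'm"
  Cmp :: "'m \<Rightarrow> 'm \<Rightarrow> 'm"

locale category =
  fixes C :: "('o, 'm) cat"
  assumes Dom_in: "f \<in> Arr C \<Longrightarrow> Dom C f \<in> Obj C"
    and Cod_in: "f \<in> Arr C \<Longrightarrow> Cod C f \<in> Obj C"
    and Idn_in: "x \<in> Obj C \<Longrightarrow> Idn C x \<in> Arr C"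
    and Dom_Idn: "x \<in> Obj C \<Longrightarrow> Dom C (Idn C x) = x"
    and Cod_Idn: "x \<in> Obj C \<Longrightarrow> Cod C (Idn C x) = x"
    and Cmp_in: "\<lbrakk>f \<in> Arr C; g \<in> Arr C; Dom C g = Cod C f\<rbrakk> \<Longrightarrow> Cmp C g f \<in> Arr C"
    and Dom_Cmp: "\<lbrakk>f \<in> Arr C; g \<in> Arr C; Dom C g = Cod C f\<rbrakk> \<Longrightarrow> Dom C (Cmp C g f) = Dom C f"
    and Cod_Cmp: "\<lbrakk>f \<in> Arr C; g \<in> Arr C; Dom C g = Cod C f\<rbrakk> \<Longrightarrow> Cod C (Cmp C g f) = Cod C g"
    and Cmp_Idn_right: "f \<in> Arr C \<Longrightarrow> Cmp C f (Idn C (Dom C f)) = f"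
    and Cmp_Idn_left: "f \<in> Arr C \<Longrightarrow> Cmp C (Idn C (Cod C f)) f = f"
    and Cmp_assoc: "\<lbrakk>f \<in> Arr C; g \<in> Arr C; h \<in> Arr C; Dom C g = Cod C f; Dom C h = Cod C g\<rbrakk>
      \<Longrightarrow> Cmp C (Cmp C h g) f = Cmp C h (Cmp C g f)"

definition invertible :: "('o, 'm) cat \<Rightarrow> 'm \<Rightarrow> bool" where
  "invertible C f \<longleftrightarrow> f \<in> Arr C \<and>
     (\<exists>g\<in>Arr C. Dom C g = Cod C f \<and> Cod C g = Dom C f \<and>
        Cmp C g f = Idn C (Dom C f) \<and> Cmp C f g = Idn C (Cod C f))"

text \<open>Functors and natural transformations carry their source and target, and their
  underlying functions are extensional. Hence equality of records is equality of
  functors and of transformations.\<close>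

record ('o1, 'm1, 'o2, 'm2) func =
  FDom :: "('o1, 'm1) cat"
  FCod :: "('o2, 'm2) cat"
  FOb :: "'o1 \<Rightarrow> 'o2"
  FAr :: "'m1 \<Rightarrow> 'm2"

locale cat_functor =
  fixes F :: "('o1, 'm1, 'o2, 'm2) func"
  assumes FDom_category: "category (FDom F)"
    and FCod_category: "category (FCod F)"
    and FOb_in: "FOb F \<in> Obj (FDom F) \<rightarrow>\<^sub>E Obj (FCod F)"
    and FAr_in: "FAr F \<in> Arr (FDom F) \<rightarrow>\<^sub>E Arr (FCod F)"
    and FAr_Dom: "f \<in> Arr (FDom F) \<Longrightarrow> Dom (FCod F) (FAr F f) = FOb F (Dom (FDom F) f)"
    and FAr_Cod: "f \<in> Arr (FDom F) \<Longrightarrow> Cod (FCod F) (FAr F f) = FOb F (Cod (FDom F) f)"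
    and FAr_Idn: "x \<in> Obj (FDom F) \<Longrightarrow> FAr F (Idn (FDom F) x) = Idn (FCod F) (FOb F x)"
    and FAr_Cmp: "\<lbrakk>f \<in> Arr (FDom F); g \<in> Arr (FDom F); Dom (FDom F) g = Cod (FDom F) f\<rbrakk>
      \<Longrightarrow> FAr F (Cmp (FDom F) g f) = Cmp (FCod F) (FAr F g) (FAr F f)"

definition functors :: "('o1, 'm1) cat \<Rightarrow> ('o2, 'm2) cat \<Rightarrow> ('o1, 'm1, 'o2, 'm2) func set" where
  "functors A B = {F. cat_functor F \<and> FDom F = A \<and> FCod F = B}"

definition id_func :: "('o, 'm) cat \<Rightarrow> ('o, 'm, 'o, 'm) func" where
  "id_func A = \<lparr>FDom = A, FCod = A, FOb = (\<lambda>x\<in>Obj A. x), FAr = (\<lambda>f\<in>Arr A. f)\<rparr>"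

definition comp_func ::
  "('o2, 'm2, 'o3, 'm3) func \<Rightarrow> ('o1, 'm1, 'o2, 'm2) func \<Rightarrow> ('o1, 'm1, 'o3, 'm3) func" where
  "comp_func G F = \<lparr>FDom = FDom F, FCod = FCod G,
     FOb = (\<lambda>x\<in>Obj (FDom F). FOb G (FOb F x)),
     FAr = (\<lambda>f\<in>Arr (FDom F). FAr G (FAr F f))\<rparr>"

definition isomorphism_of_categories :: "('o1, 'm1, 'o2, 'm2) func \<Rightarrow> bool" where
  "isomorphism_of_categories F \<longleftrightarrow> cat_functor F \<and>
     (\<exists>G\<in>functors (FCod F) (FDom F).
        comp_func G F = id_func (FDom F) \<and> comp_func F G = id_func (FCod F))"

record ('o1, 'm1, 'o2, 'm2) natt =
  NDom :: "('o1, 'm1, 'o2, 'm2) func"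
  NCod :: "('o1, 'm1, 'o2, 'm2) func"
  NT :: "'o1 \<Rightarrow> 'm2"

locale nat_trans =
  fixes \<alpha> :: "('o1, 'm1, 'o2, 'm2) natt"
  assumes NDom_functor: "cat_functor (NDom \<alpha>)"
    and NCod_functor: "cat_functor (NCod \<alpha>)"
    and FDom_eq: "FDom (NCod \<alpha>) = FDom (NDom \<alpha>)"
    and FCod_eq: "FCod (NCod \<alpha>) = FCod (NDom \<alpha>)"
    and NT_in: "NT \<alpha> \<in> Obj (FDom (NDom \<alpha>)) \<rightarrow>\<^sub>E Arr (FCod (NDom \<alpha>))"
    and NT_Dom: "x \<in> Obj (FDom (NDom \<alpha>)) \<Longrightarrow> Dom (FCod (NDom \<alpha>)) (NT \<alpha> x) = FOb (NDom \<alpha>) x"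
    and NT_Cod: "x \<in> Obj (FDom (NDom \<alpha>)) \<Longrightarrow> Cod (FCod (NDom \<alpha>)) (NT \<alpha> x) = FOb (NCod \<alpha>) x"
    and naturality: "f \<in> Arr (FDom (NDom \<alpha>)) \<Longrightarrow>
      Cmp (FCod (NDom \<alpha>)) (NT \<alpha> (Cod (FDom (NDom \<alpha>)) f)) (FAr (NDom \<alpha>) f) =
      Cmp (FCod (NDom \<alpha>)) (FAr (NCod \<alpha>) f) (NT \<alpha> (Dom (FDom (NDom \<alpha>)) f))"

definition id_nat :: "('o1, 'm1, 'o2, 'm2) func \<Rightarrow> ('o1, 'm1, 'o2, 'm2) natt" where
  "id_nat F = \<lparr>NDom = F, NCod = F, NT = (\<lambda>x\<in>Obj (FDom F). Idn (FCod F) (FOb F x))\<rparr>"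

definition vcomp_nat ::
  "('o1, 'm1, 'o2, 'm2) natt \<Rightarrow> ('o1, 'm1, 'o2, 'm2) natt \<Rightarrow> ('o1, 'm1, 'o2, 'm2) natt"
  (infixr "\<bullet>\<^sub>v" 70) where
  "\<beta> \<bullet>\<^sub>v \<alpha> = \<lparr>NDom = NDom \<alpha>, NCod = NCod \<beta>,
     NT = (\<lambda>x\<in>Obj (FDom (NDom \<alpha>)). Cmp (FCod (NDom \<alpha>)) (NT \<beta> x) (NT \<alpha> x))\<rparr>"

text \<open>Horizontal (Godement) composition of \<open>\<alpha> : F \<Rightarrow> G : A \<rightarrow> B\<close> and
  \<open>\<beta> : H \<Rightarrow> K : B \<rightarrow> C\<close>.\<close>

definition hcomp_nat ::
  "('o2, 'm2, 'o3, 'm3) natt \<Rightarrow> ('o1, 'm1, 'o2, 'm2) natt \<Rightarrow> ('o1, 'm1, 'o3, 'm3) natt"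
  (infixr "\<star>" 75) where
  "\<beta> \<star> \<alpha> = \<lparr>NDom = comp_func (NDom \<beta>) (NDom \<alpha>), NCod = comp_func (NCod \<beta>) (NCod \<alpha>),
     NT = (\<lambda>x\<in>Obj (FDom (NDom \<alpha>)).
       Cmp (FCod (NDom \<beta>)) (NT \<beta> (FOb (NCod \<alpha>) x)) (FAr (NDom \<beta>) (NT \<alpha> x)))\<rparr>"

definition functor_cat ::
  "('o1, 'm1) cat \<Rightarrow> ('o2, 'm2) cat \<Rightarrow>
   (('o1, 'm1, 'o2, 'm2) func, ('o1, 'm1, 'o2, 'm2) natt) cat" where
  "functor_cat A B = \<lparr>Obj = functors A B,
     Arr = {\<alpha>. nat_trans \<alpha> \<and> NDom \<alpha> \<in> functors A B \<and> NCod \<alpha> \<in> functors A B},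
     Dom = NDom, Cod = NCod, Idn = id_nat, Cmp = vcomp_nat\<rparr>"


section \<open>Strict 2-categories\<close>

record ('o, 'm, 'n) twocat =
  Cell0 :: "'o set"
  Cell1 :: "'m set"
  Cell2 :: "'n set"
  dom1 :: "'m \<Rightarrow> 'o"
  cod1 :: "'m \<Rightarrow> 'o"
  id1 :: "'o \<Rightarrow> 'm"
  cmp1 :: "'m \<Rightarrow> 'm \<Rightarrow> 'm"
  src2 :: "'n \<Rightarrow> 'm"
  trg2 :: "'n \<Rightarrow> 'm"
  id2 :: "'m \<Rightarrow> 'n"
  vcmp :: "'n \<Rightarrow> 'n \<Rightarrow> 'n"
  hcmp :: "'n \<Rightarrow> 'n \<Rightarrow> 'n"

definition under_cat :: "('o, 'm, 'n) twocat \<Rightarrow> ('o, 'm) cat" where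
  "under_cat D = \<lparr>Obj = Cell0 D, Arr = Cell1 D, Dom = dom1 D, Cod = cod1 D,
     Idn = id1 D, Cmp = cmp1 D\<rparr>"

definition vert_cat :: "('o, 'm, 'n) twocat \<Rightarrow> ('m, 'n) cat" where
  "vert_cat D = \<lparr>Obj = Cell1 D, Arr = Cell2 D, Dom = src2 D, Cod = trg2 D,
     Idn = id2 D, Cmp = vcmp D\<rparr>"

definition horiz_cat :: "('o, 'm, 'n) twocat \<Rightarrow> ('o, 'n) cat" where
  "horiz_cat D = \<lparr>Obj = Cell0 D, Arr = Cell2 D, Dom = (\<lambda>\<alpha>. dom1 D (src2 D \<alpha>)),
     Cod = (\<lambda>\<alpha>. cod1 D (src2 D \<alpha>)), Idn = (\<lambda>a. id2 D (id1 D a)), Cmp = hcmp D\<rparr>"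

locale two_category =
  fixes D :: "('o, 'm, 'n) twocat"
  assumes under_category: "category (under_cat D)"
    and vert_category: "category (vert_cat D)"
    and horiz_category: "category (horiz_cat D)"
    and dom1_trg2: "\<alpha> \<in> Cell2 D \<Longrightarrow> dom1 D (trg2 D \<alpha>) = dom1 D (src2 D \<alpha>)"
    and cod1_trg2: "\<alpha> \<in> Cell2 D \<Longrightarrow> cod1 D (trg2 D \<alpha>) = cod1 D (src2 D \<alpha>)"
    and src2_hcmp: "\<lbrakk>\<alpha> \<in> Cell2 D; \<beta> \<in> Cell2 D; dom1 D (src2 D \<beta>) = cod1 D (src2 D \<alpha>)\<rbrakk>
      \<Longrightarrow> src2 D (hcmp D \<beta> \<alpha>) = cmp1 D (src2 D \<beta>) (src2 D \<alpha>)"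
    and trg2_hcmp: "\<lbrakk>\<alpha> \<in> Cell2 D; \<beta> \<in> Cell2 D; dom1 D (src2 D \<beta>) = cod1 D (src2 D \<alpha>)\<rbrakk>
      \<Longrightarrow> trg2 D (hcmp D \<beta> \<alpha>) = cmp1 D (trg2 D \<beta>) (trg2 D \<alpha>)"
    and hcmp_id2: "\<lbrakk>f \<in> Cell1 D; g \<in> Cell1 D; dom1 D g = cod1 D f\<rbrakk>
      \<Longrightarrow> hcmp D (id2 D g) (id2 D f) = id2 D (cmp1 D g f)"
    and interchange: "\<lbrakk>\<alpha> \<in> Cell2 D; \<alpha>' \<in> Cell2 D; \<beta> \<in> Cell2 D; \<beta>' \<in> Cell2 D;
        src2 D \<alpha>' = trg2 D \<alpha>; src2 D \<beta>' = trg2 D \<beta>; dom1 D (src2 D \<beta>) = cod1 D (src2 D \<alpha>)\<rbrakk>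
      \<Longrightarrow> hcmp D (vcmp D \<beta>' \<beta>) (vcmp D \<alpha>' \<alpha>) = vcmp D (hcmp D \<beta>' \<alpha>') (hcmp D \<beta> \<alpha>)"

text \<open>\<open>op2\<close> reverses the 1-cells but not the 2-cells.\<close>

definition op2 :: "('o, 'm, 'n) twocat \<Rightarrow> ('o, 'm, 'n) twocat" where
  "op2 D = D\<lparr>dom1 := cod1 D, cod1 := dom1 D, cmp1 := (\<lambda>g f. cmp1 D f g),
     hcmp := (\<lambda>\<beta> \<alpha>. hcmp D \<alpha> \<beta>)\<rparr>"

text \<open>The full sub-2-category on the categories in \<open>S\<close> of the 2-category of categories,
  functors and natural transformations.\<close>

definition full_cat2 :: "('o, 'm) cat set \<Rightarrow>
    (('o, 'm) cat, ('o, 'm, 'o, 'm) func, ('o, 'm, 'o, 'm) natt) twocat" where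
  "full_cat2 S = \<lparr>Cell0 = {C\<in>S. category C},
     Cell1 = {F. cat_functor F \<and> FDom F \<in> S \<and> FCod F \<in> S},
     Cell2 = {\<alpha>. nat_trans \<alpha> \<and> FDom (NDom \<alpha>) \<in> S \<and> FCod (NDom \<alpha>) \<in> S},
     dom1 = FDom, cod1 = FCod, id1 = id_func, cmp1 = comp_func,
     src2 = NDom, trg2 = NCod, id2 = id_nat, vcmp = vcomp_nat, hcmp = hcomp_nat\<rparr>"

text \<open>Smallness is relative to a cardinal \<open>\<kappa>\<close> on the type \<open>'u\<close>, which plays the role of the
  universe: a set is small if it has fewer than \<open>\<kappa>\<close> elements. If \<open>\<kappa>\<close> is the cardinality of a
  Grothendieck universe with an infinite element (that is, \<open>\<kappa>\<close> is strongly inaccessible), this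
  is the usual notion of smallness up to bijection. Only uncountability and regularity of \<open>\<kappa>\<close>
  are required: they are implied by strong inaccessibility, and unlike the latter they can be
  satisfied in HOL.\<close>

definition uncountable_regular :: "'u rel \<Rightarrow> bool" where
  "uncountable_regular \<kappa> \<longleftrightarrow> Card_order \<kappa> \<and> natLeq <o \<kappa> \<and> regularCard \<kappa>"

definition small_cat :: "'u rel \<Rightarrow> ('o, 'm) cat \<Rightarrow> bool" where
  "small_cat \<kappa> C \<longleftrightarrow> category C \<and> |Obj C| <o \<kappa> \<and> |Arr C| <o \<kappa>"

definition small_two_category :: "'u rel \<Rightarrow> ('o, 'm, 'n) twocat \<Rightarrow> bool" where
  "small_two_category \<kappa> D \<longleftrightarrow>
     two_category D \<and> |Cell0 D| <o \<kappa> \<and> |Cell1 D| <o \<kappa> \<and> |Cell2 D| <o \<kappa>"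

text \<open>Every small category is isomorphic to one whose objects and arrows belong to
  the type \<open>'u\<close>.\<close>

definition Cat :: "'u rel \<Rightarrow>
    (('u, 'u) cat, ('u, 'u, 'u, 'u) func, ('u, 'u, 'u, 'u) natt) twocat" where
  "Cat \<kappa> = full_cat2 {C. small_cat \<kappa> C}"

text \<open>Categories of functors, of transformations and of modifications live on other
  types than \<open>'u\<close>, and need not be small unless \<open>\<kappa>\<close> is a strong limit. They are
  objects of the following 2-category, without a bound on the size.\<close>

definition CAT :: "(('o, 'm) cat, ('o, 'm, 'o, 'm) func, ('o, 'm, 'o, 'm) natt) twocat" where
  "CAT = full_cat2 UNIV"


section \<open>Strict 2-functors and 2-natural isomorphisms\<close>

record ('o, 'm, 'n, 'o2, 'm2, 'n2) twofun =
  T0 :: "'o \<Rightarrow> 'o2"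
  T1 :: "'m \<Rightarrow> 'm2"
  T2 :: "'n \<Rightarrow> 'n2"

locale two_functor =
  fixes D :: "('o, 'm, 'n) twocat" and E :: "('o2, 'm2, 'n2) twocat"
    and T :: "('o, 'm, 'n, 'o2, 'm2, 'n2) twofun"
  assumes T0_in: "a \<in> Cell0 D \<Longrightarrow> T0 T a \<in> Cell0 E"
    and T1_in: "f \<in> Cell1 D \<Longrightarrow> T1 T f \<in> Cell1 E"
    and T2_in: "\<alpha> \<in> Cell2 D \<Longrightarrow> T2 T \<alpha> \<in> Cell2 E"
    and T1_dom: "f \<in> Cell1 D \<Longrightarrow> dom1 E (T1 T f) = T0 T (dom1 D f)"
    and T1_cod: "f \<in> Cell1 D \<Longrightarrow> cod1 E (T1 T f) = T0 T (cod1 D f)"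
    and T2_src: "\<alpha> \<in> Cell2 D \<Longrightarrow> src2 E (T2 T \<alpha>) = T1 T (src2 D \<alpha>)"
    and T2_trg: "\<alpha> \<in> Cell2 D \<Longrightarrow> trg2 E (T2 T \<alpha>) = T1 T (trg2 D \<alpha>)"
    and T1_id: "a \<in> Cell0 D \<Longrightarrow> T1 T (id1 D a) = id1 E (T0 T a)"
    and T1_cmp: "\<lbrakk>f \<in> Cell1 D; g \<in> Cell1 D; dom1 D g = cod1 D f\<rbrakk>
      \<Longrightarrow> T1 T (cmp1 D g f) = cmp1 E (T1 T g) (T1 T f)"
    and T2_id: "f \<in> Cell1 D \<Longrightarrow> T2 T (id2 D f) = id2 E (T1 T f)"
    and T2_vcmp: "\<lbrakk>\<alpha> \<in> Cell2 D; \<beta> \<in> Cell2 D; src2 D \<beta> = trg2 D \<alpha>\<rbrakk>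
      \<Longrightarrow> T2 T (vcmp D \<beta> \<alpha>) = vcmp E (T2 T \<beta>) (T2 T \<alpha>)"
    and T2_hcmp: "\<lbrakk>\<alpha> \<in> Cell2 D; \<beta> \<in> Cell2 D; dom1 D (src2 D \<beta>) = cod1 D (src2 D \<alpha>)\<rbrakk>
      \<Longrightarrow> T2 T (hcmp D \<beta> \<alpha>) = hcmp E (T2 T \<beta>) (T2 T \<alpha>)"

text \<open>The two 2-functors may have values in categories over different types.\<close>

definition two_naturally_isomorphic :: "('o, 'm, 'n) twocat \<Rightarrow>
    ('o, 'm, 'n, ('p, 'q) cat, ('p, 'q, 'p, 'q) func, ('p, 'q, 'p, 'q) natt) twofun \<Rightarrow>
    ('o, 'm, 'n, ('r, 's) cat, ('r, 's, 'r, 's) func, ('r, 's, 'r, 's) natt) twofun \<Rightarrow> bool" where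
  "two_naturally_isomorphic D S T \<longleftrightarrow>
     two_functor D CAT S \<and> two_functor D CAT T \<and>
     (\<exists>\<Phi> :: 'o \<Rightarrow> ('p, 'q, 'r, 's) func.
        (\<forall>a\<in>Cell0 D. \<Phi> a \<in> functors (T0 S a) (T0 T a) \<and> isomorphism_of_categories (\<Phi> a)) \<and>
        (\<forall>f\<in>Cell1 D. comp_func (T1 T f) (\<Phi> (dom1 D f)) = comp_func (\<Phi> (cod1 D f)) (T1 S f)) \<and>
        (\<forall>\<alpha>\<in>Cell2 D. T2 T \<alpha> \<star> id_nat (\<Phi> (dom1 D (src2 D \<alpha>)))
                     = id_nat (\<Phi> (cod1 D (src2 D \<alpha>))) \<star> T2 S \<alpha>))"


section \<open>Pseudo functors, pseudo natural transformations, modifications\<close>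

text \<open>The coherence 2-cells are \<open>PCmp P g f : P g \<circ> P f \<Rightarrow> P (g \<circ> f)\<close> and
  \<open>PIdn P a : 1 \<Rightarrow> P 1\<close>.\<close>

record ('o, 'm, 'n, 'o2, 'm2, 'n2) psfun =
  P0 :: "'o \<Rightarrow> 'o2"
  P1 :: "'m \<Rightarrow> 'm2"
  P2 :: "'n \<Rightarrow> 'n2"
  PCmp :: "'m \<Rightarrow> 'm \<Rightarrow> 'n2"
  PIdn :: "'o \<Rightarrow> 'n2"

locale pseudo_functor =
  fixes D :: "('o, 'm, 'n) twocat" and E :: "('o2, 'm2, 'n2) twocat"
    and P :: "('o, 'm, 'n, 'o2, 'm2, 'n2) psfun"
  assumes P0_in: "a \<in> Cell0 D \<Longrightarrow> P0 P a \<in> Cell0 E"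
    and P1_in: "f \<in> Cell1 D \<Longrightarrow> P1 P f \<in> Cell1 E"
    and P1_dom: "f \<in> Cell1 D \<Longrightarrow> dom1 E (P1 P f) = P0 P (dom1 D f)"
    and P1_cod: "f \<in> Cell1 D \<Longrightarrow> cod1 E (P1 P f) = P0 P (cod1 D f)"
    and P2_in: "\<alpha> \<in> Cell2 D \<Longrightarrow> P2 P \<alpha> \<in> Cell2 E"
    and P2_src: "\<alpha> \<in> Cell2 D \<Longrightarrow> src2 E (P2 P \<alpha>) = P1 P (src2 D \<alpha>)"
    and P2_trg: "\<alpha> \<in> Cell2 D \<Longrightarrow> trg2 E (P2 P \<alpha>) = P1 P (trg2 D \<alpha>)"
    and P2_id: "f \<in> Cell1 D \<Longrightarrow> P2 P (id2 D f) = id2 E (P1 P f)"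
    and P2_vcmp: "\<lbrakk>\<alpha> \<in> Cell2 D; \<beta> \<in> Cell2 D; src2 D \<beta> = trg2 D \<alpha>\<rbrakk>
      \<Longrightarrow> P2 P (vcmp D \<beta> \<alpha>) = vcmp E (P2 P \<beta>) (P2 P \<alpha>)"
    and PCmp_invertible: "\<lbrakk>f \<in> Cell1 D; g \<in> Cell1 D; dom1 D g = cod1 D f\<rbrakk>
      \<Longrightarrow> invertible (vert_cat E) (PCmp P g f)"
    and PCmp_src: "\<lbrakk>f \<in> Cell1 D; g \<in> Cell1 D; dom1 D g = cod1 D f\<rbrakk>
      \<Longrightarrow> src2 E (PCmp P g f) = cmp1 E (P1 P g) (P1 P f)"
    and PCmp_trg: "\<lbrakk>f \<in> Cell1 D; g \<in> Cell1 D; dom1 D g = cod1 D f\<rbrakk>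
      \<Longrightarrow> trg2 E (PCmp P g f) = P1 P (cmp1 D g f)"
    and PIdn_invertible: "a \<in> Cell0 D \<Longrightarrow> invertible (vert_cat E) (PIdn P a)"
    and PIdn_src: "a \<in> Cell0 D \<Longrightarrow> src2 E (PIdn P a) = id1 E (P0 P a)"
    and PIdn_trg: "a \<in> Cell0 D \<Longrightarrow> trg2 E (PIdn P a) = P1 P (id1 D a)"
    and PCmp_natural: "\<lbrakk>\<alpha> \<in> Cell2 D; \<beta> \<in> Cell2 D; dom1 D (src2 D \<beta>) = cod1 D (src2 D \<alpha>)\<rbrakk>
      \<Longrightarrow> vcmp E (P2 P (hcmp D \<beta> \<alpha>)) (PCmp P (src2 D \<beta>) (src2 D \<alpha>))
        = vcmp E (PCmp P (trg2 D \<beta>) (trg2 D \<alpha>)) (hcmp E (P2 P \<beta>) (P2 P \<alpha>))"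
    and PCmp_assoc: "\<lbrakk>f \<in> Cell1 D; g \<in> Cell1 D; h \<in> Cell1 D; dom1 D g = cod1 D f; dom1 D h = cod1 D g\<rbrakk>
      \<Longrightarrow> vcmp E (PCmp P h (cmp1 D g f)) (hcmp E (id2 E (P1 P h)) (PCmp P g f))
        = vcmp E (PCmp P (cmp1 D h g) f) (hcmp E (PCmp P h g) (id2 E (P1 P f)))"
    and PCmp_unit_right: "f \<in> Cell1 D
      \<Longrightarrow> vcmp E (PCmp P f (id1 D (dom1 D f))) (hcmp E (id2 E (P1 P f)) (PIdn P (dom1 D f)))
        = id2 E (P1 P f)"
    and PCmp_unit_left: "f \<in> Cell1 D
      \<Longrightarrow> vcmp E (PCmp P (id1 D (cod1 D f)) f) (hcmp E (PIdn P (cod1 D f)) (id2 E (P1 P f)))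
        = id2 E (P1 P f)"

type_synonym ('o, 'm, 'n, 'p, 'q) psfun_cat =
  "('o, 'm, 'n, ('p, 'q) cat, ('p, 'q, 'p, 'q) func, ('p, 'q, 'p, 'q) natt) psfun"

text \<open>Pseudo natural transformations \<open>\<sigma> : P \<Rightarrow> Q\<close> between pseudo functors to categories; the
  categories in the values of \<open>P\<close> and of \<open>Q\<close> may be over different types. For \<open>u : a \<rightarrow> b\<close> in \<open>D\<close>
  the coherence 2-cell is \<open>S1 \<sigma> u : Q u \<circ> \<sigma>\<^sub>a \<Rightarrow> \<sigma>\<^sub>b \<circ> P u\<close>.\<close>

record ('o, 'm, 'p, 'q, 'r, 's) psnat =
  S0 :: "'o \<Rightarrow> ('p, 'q, 'r, 's) func"
  S1 :: "'m \<Rightarrow> ('p, 'q, 'r, 's) natt"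

locale pseudo_nat =
  fixes D :: "('o, 'm, 'n) twocat"
    and P :: "('o, 'm, 'n, 'p, 'q) psfun_cat" and Q :: "('o, 'm, 'n, 'r, 's) psfun_cat"
    and \<sigma> :: "('o, 'm, 'p, 'q, 'r, 's) psnat"
  assumes S0_ext: "S0 \<sigma> \<in> extensional (Cell0 D)"
    and S1_ext: "S1 \<sigma> \<in> extensional (Cell1 D)"
    and S0_in: "a \<in> Cell0 D \<Longrightarrow> S0 \<sigma> a \<in> functors (P0 P a) (P0 Q a)"
    and S1_invertible: "u \<in> Cell1 D
      \<Longrightarrow> invertible (functor_cat (P0 P (dom1 D u)) (P0 Q (cod1 D u))) (S1 \<sigma> u)"
    and S1_NDom: "u \<in> Cell1 D \<Longrightarrow> NDom (S1 \<sigma> u) = comp_func (P1 Q u) (S0 \<sigma> (dom1 D u))"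
    and S1_NCod: "u \<in> Cell1 D \<Longrightarrow> NCod (S1 \<sigma> u) = comp_func (S0 \<sigma> (cod1 D u)) (P1 P u)"
    and S1_natural: "\<alpha> \<in> Cell2 D
      \<Longrightarrow> S1 \<sigma> (trg2 D \<alpha>) \<bullet>\<^sub>v (P2 Q \<alpha> \<star> id_nat (S0 \<sigma> (dom1 D (src2 D \<alpha>))))
        = (id_nat (S0 \<sigma> (cod1 D (src2 D \<alpha>))) \<star> P2 P \<alpha>) \<bullet>\<^sub>v S1 \<sigma> (src2 D \<alpha>)"
    and S1_cmp: "\<lbrakk>u \<in> Cell1 D; v \<in> Cell1 D; dom1 D v = cod1 D u\<rbrakk>
      \<Longrightarrow> S1 \<sigma> (cmp1 D v u) \<bullet>\<^sub>v (PCmp Q v u \<star> id_nat (S0 \<sigma> (dom1 D u)))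
        = (id_nat (S0 \<sigma> (cod1 D v)) \<star> PCmp P v u) \<bullet>\<^sub>v
          (S1 \<sigma> v \<star> id_nat (P1 P u)) \<bullet>\<^sub>v (id_nat (P1 Q v) \<star> S1 \<sigma> u)"
    and S1_id: "a \<in> Cell0 D
      \<Longrightarrow> S1 \<sigma> (id1 D a) \<bullet>\<^sub>v (PIdn Q a \<star> id_nat (S0 \<sigma> a)) = id_nat (S0 \<sigma> a) \<star> PIdn P a"

definition psnat_comp :: "('o, 'm, 'n) twocat \<Rightarrow> ('o, 'm, 'r, 's, 't, 'v) psnat \<Rightarrow>
    ('o, 'm, 'p, 'q, 'r, 's) psnat \<Rightarrow> ('o, 'm, 'p, 'q, 't, 'v) psnat" where
  "psnat_comp D \<tau> \<sigma> = \<lparr>S0 = (\<lambda>a\<in>Cell0 D. comp_func (S0 \<tau> a) (S0 \<sigma> a)),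
     S1 = (\<lambda>u\<in>Cell1 D. (id_nat (S0 \<tau> (cod1 D u)) \<star> S1 \<sigma> u) \<bullet>\<^sub>v
                         (S1 \<tau> u \<star> id_nat (S0 \<sigma> (dom1 D u))))\<rparr>"

record ('o, 'm, 'p, 'q, 'r, 's) modif =
  MDom :: "('o, 'm, 'p, 'q, 'r, 's) psnat"
  MCod :: "('o, 'm, 'p, 'q, 'r, 's) psnat"
  M0 :: "'o \<Rightarrow> ('p, 'q, 'r, 's) natt"

locale modification =
  fixes D :: "('o, 'm, 'n) twocat"
    and P :: "('o, 'm, 'n, 'p, 'q) psfun_cat" and Q :: "('o, 'm, 'n, 'r, 's) psfun_cat"
    and \<Gamma> :: "('o, 'm, 'p, 'q, 'r, 's) modif"
  assumes MDom_pseudo_nat: "pseudo_nat D P Q (MDom \<Gamma>)"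
    and MCod_pseudo_nat: "pseudo_nat D P Q (MCod \<Gamma>)"
    and M0_ext: "M0 \<Gamma> \<in> extensional (Cell0 D)"
    and M0_nat_trans: "a \<in> Cell0 D \<Longrightarrow> nat_trans (M0 \<Gamma> a)"
    and M0_NDom: "a \<in> Cell0 D \<Longrightarrow> NDom (M0 \<Gamma> a) = S0 (MDom \<Gamma>) a"
    and M0_NCod: "a \<in> Cell0 D \<Longrightarrow> NCod (M0 \<Gamma> a) = S0 (MCod \<Gamma>) a"
    and M0_square: "u \<in> Cell1 D
      \<Longrightarrow> S1 (MCod \<Gamma>) u \<bullet>\<^sub>v (id_nat (P1 Q u) \<star> M0 \<Gamma> (dom1 D u))
        = (M0 \<Gamma> (cod1 D u) \<star> id_nat (P1 P u)) \<bullet>\<^sub>v S1 (MDom \<Gamma>) u"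

definition id_modif :: "('o, 'm, 'n) twocat \<Rightarrow> ('o, 'm, 'p, 'q, 'r, 's) psnat \<Rightarrow>
    ('o, 'm, 'p, 'q, 'r, 's) modif" where
  "id_modif D \<sigma> = \<lparr>MDom = \<sigma>, MCod = \<sigma>, M0 = (\<lambda>a\<in>Cell0 D. id_nat (S0 \<sigma> a))\<rparr>"

definition modif_vcomp :: "('o, 'm, 'n) twocat \<Rightarrow> ('o, 'm, 'p, 'q, 'r, 's) modif \<Rightarrow>
    ('o, 'm, 'p, 'q, 'r, 's) modif \<Rightarrow> ('o, 'm, 'p, 'q, 'r, 's) modif" where
  "modif_vcomp D \<Delta> \<Gamma> = \<lparr>MDom = MDom \<Gamma>, MCod = MCod \<Delta>,
     M0 = (\<lambda>a\<in>Cell0 D. M0 \<Delta> a \<bullet>\<^sub>v M0 \<Gamma> a)\<rparr>"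

definition modif_hcomp :: "('o, 'm, 'n) twocat \<Rightarrow> ('o, 'm, 'r, 's, 't, 'v) modif \<Rightarrow>
    ('o, 'm, 'p, 'q, 'r, 's) modif \<Rightarrow> ('o, 'm, 'p, 'q, 't, 'v) modif" where
  "modif_hcomp D \<Delta> \<Gamma> = \<lparr>MDom = psnat_comp D (MDom \<Delta>) (MDom \<Gamma>),
     MCod = psnat_comp D (MCod \<Delta>) (MCod \<Gamma>), M0 = (\<lambda>a\<in>Cell0 D. M0 \<Delta> a \<star> M0 \<Gamma> a)\<rparr>"

text \<open>The hom category from \<open>P\<close> to \<open>Q\<close> in the 2-category \<open>Hom[D,Cat]\<close>.\<close>

definition Hom_cat :: "('o, 'm, 'n) twocat \<Rightarrow>
    ('o, 'm, 'n, 'p, 'q) psfun_cat \<Rightarrow> ('o, 'm, 'n, 'r, 's) psfun_cat \<Rightarrow>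
    (('o, 'm, 'p, 'q, 'r, 's) psnat, ('o, 'm, 'p, 'q, 'r, 's) modif) cat" where
  "Hom_cat D P Q = \<lparr>Obj = {\<sigma>. pseudo_nat D P Q \<sigma>}, Arr = {\<Gamma>. modification D P Q \<Gamma>},
     Dom = MDom, Cod = MCod, Idn = id_modif D, Cmp = modif_vcomp D\<rparr>"


section \<open>Weighted pseudo colimits\<close>

text \<open>\<open>postcomp_func A H\<close> and \<open>postcomp_nat A \<alpha>\<close> are \<open>Cat(A,H)\<close> and \<open>Cat(A,\<alpha>)\<close>, for a functor
  \<open>H : B \<rightarrow> C\<close> and a transformation \<open>\<alpha>\<close> of such functors; \<open>precomp_func U C\<close> and
  \<open>precomp_nat \<alpha> C\<close> are \<open>Cat(U,C)\<close> and \<open>Cat(\<alpha>,C)\<close>, for \<open>U : A \<rightarrow> B\<close> and a transformation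
  \<open>\<alpha>\<close> of such functors.\<close>

definition postcomp_func :: "('a, 'b) cat \<Rightarrow> ('p, 'q, 'r, 's) func \<Rightarrow>
    (('a, 'b, 'p, 'q) func, ('a, 'b, 'p, 'q) natt, ('a, 'b, 'r, 's) func, ('a, 'b, 'r, 's) natt) func" where
  "postcomp_func A H = \<lparr>FDom = functor_cat A (FDom H), FCod = functor_cat A (FCod H),
     FOb = (\<lambda>G\<in>Obj (functor_cat A (FDom H)). comp_func H G),
     FAr = (\<lambda>\<gamma>\<in>Arr (functor_cat A (FDom H)). id_nat H \<star> \<gamma>)\<rparr>"

definition postcomp_nat :: "('a, 'b) cat \<Rightarrow> ('p, 'q, 'r, 's) natt \<Rightarrow>
    (('a, 'b, 'p, 'q) func, ('a, 'b, 'p, 'q) natt, ('a, 'b, 'r, 's) func, ('a, 'b, 'r, 's) natt) natt" where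
  "postcomp_nat A \<alpha> = \<lparr>NDom = postcomp_func A (NDom \<alpha>), NCod = postcomp_func A (NCod \<alpha>),
     NT = (\<lambda>G\<in>Obj (functor_cat A (FDom (NDom \<alpha>))). \<alpha> \<star> id_nat G)\<rparr>"

definition precomp_func :: "('p, 'q, 'r, 's) func \<Rightarrow> ('a, 'b) cat \<Rightarrow>
    (('r, 's, 'a, 'b) func, ('r, 's, 'a, 'b) natt, ('p, 'q, 'a, 'b) func, ('p, 'q, 'a, 'b) natt) func" where
  "precomp_func U C = \<lparr>FDom = functor_cat (FCod U) C, FCod = functor_cat (FDom U) C,
     FOb = (\<lambda>G\<in>Obj (functor_cat (FCod U) C). comp_func G U),
     FAr = (\<lambda>\<gamma>\<in>Arr (functor_cat (FCod U) C). \<gamma> \<star> id_nat U)\<rparr>"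

definition precomp_nat :: "('p, 'q, 'r, 's) natt \<Rightarrow> ('a, 'b) cat \<Rightarrow>
    (('r, 's, 'a, 'b) func, ('r, 's, 'a, 'b) natt, ('p, 'q, 'a, 'b) func, ('p, 'q, 'a, 'b) natt) natt" where
  "precomp_nat \<alpha> C = \<lparr>NDom = precomp_func (NDom \<alpha>) C, NCod = precomp_func (NCod \<alpha>) C,
     NT = (\<lambda>G\<in>Obj (functor_cat (FCod (NDom \<alpha>)) C). id_nat G \<star> \<alpha>)\<rparr>"

text \<open>The 2-functor \<open>C \<mapsto> Cat(W,C)\<close>.\<close>

definition representable :: "('a, 'b) cat \<Rightarrow>
    (('p, 'q) cat, ('p, 'q, 'p, 'q) func, ('p, 'q, 'p, 'q) natt,
     (('a, 'b, 'p, 'q) func, ('a, 'b, 'p, 'q) natt) cat,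
     (('a, 'b, 'p, 'q) func, ('a, 'b, 'p, 'q) natt, ('a, 'b, 'p, 'q) func, ('a, 'b, 'p, 'q) natt) func,
     (('a, 'b, 'p, 'q) func, ('a, 'b, 'p, 'q) natt, ('a, 'b, 'p, 'q) func, ('a, 'b, 'p, 'q) natt) natt) twofun" where
  "representable W = \<lparr>T0 = functor_cat W, T1 = postcomp_func W, T2 = postcomp_nat W\<rparr>"

text \<open>The pseudo functor \<open>Cat(F-,C)\<close> on \<open>op2 D\<close>, the composite of \<open>F\<close> with the 2-functor
  \<open>Cat(-,C)\<close>. The order of the arguments of \<open>PCmp F\<close> is that of composition in \<open>D\<close>.\<close>

definition hom_into :: "('o, 'm, 'n, 'a, 'b) psfun_cat \<Rightarrow> ('p, 'q) cat \<Rightarrow>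
    ('o, 'm, 'n, ('a, 'b, 'p, 'q) func, ('a, 'b, 'p, 'q) natt) psfun_cat" where
  "hom_into F C = \<lparr>P0 = (\<lambda>d. functor_cat (P0 F d) C), P1 = (\<lambda>u. precomp_func (P1 F u) C),
     P2 = (\<lambda>\<alpha>. precomp_nat (P2 F \<alpha>) C), PCmp = (\<lambda>g f. precomp_nat (PCmp F f g) C),
     PIdn = (\<lambda>d. precomp_nat (PIdn F d) C)\<rparr>"

text \<open>For \<open>H : C \<rightarrow> C'\<close>, the transformation \<open>Cat(F-,H)\<close> is strictly natural, so its coherence
  2-cells are identities. A 1-cell \<open>u : a \<rightarrow> b\<close> of \<open>D\<close> goes from \<open>b\<close> to \<open>a\<close> in \<open>op2 D\<close>.\<close>

definition hom_into_func :: "('o, 'm, 'n) twocat \<Rightarrow> ('o, 'm, 'n, 'a, 'b) psfun_cat \<Rightarrow>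
    ('p, 'q, 'r, 's) func \<Rightarrow>
    ('o, 'm, ('a, 'b, 'p, 'q) func, ('a, 'b, 'p, 'q) natt,
     ('a, 'b, 'r, 's) func, ('a, 'b, 'r, 's) natt) psnat" where
  "hom_into_func D F H = \<lparr>S0 = (\<lambda>d\<in>Cell0 D. postcomp_func (P0 F d) H),
     S1 = (\<lambda>u\<in>Cell1 D. id_nat (comp_func (precomp_func (P1 F u) (FCod H))
                                           (postcomp_func (P0 F (cod1 D u)) H)))\<rparr>"

definition hom_into_nat :: "('o, 'm, 'n) twocat \<Rightarrow> ('o, 'm, 'n, 'a, 'b) psfun_cat \<Rightarrow>
    ('p, 'q, 'r, 's) natt \<Rightarrow>
    ('o, 'm, ('a, 'b, 'p, 'q) func, ('a, 'b, 'p, 'q) natt,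
     ('a, 'b, 'r, 's) func, ('a, 'b, 'r, 's) natt) modif" where
  "hom_into_nat D F \<alpha> = \<lparr>MDom = hom_into_func D F (NDom \<alpha>), MCod = hom_into_func D F (NCod \<alpha>),
     M0 = (\<lambda>d\<in>Cell0 D. postcomp_nat (P0 F d) \<alpha>)\<rparr>"

text \<open>The 2-functor \<open>C \<mapsto> Hom[D\<^sup>o\<^sup>p,Cat](J,Cat(F-,C))\<close>: it acts on 1-cells and 2-cells by
  composition in \<open>Hom[D\<^sup>o\<^sup>p,Cat]\<close> with \<open>Cat(F-,H)\<close> and \<open>Cat(F-,\<alpha>)\<close>.\<close>

definition weighted_func :: "('o, 'm, 'n) twocat \<Rightarrow> ('o, 'm, 'n, 'c, 'd) psfun_cat \<Rightarrow>
    ('o, 'm, 'n, 'a, 'b) psfun_cat \<Rightarrow> ('p, 'q, 'p, 'q) func \<Rightarrow>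
    (('o, 'm, 'c, 'd, ('a, 'b, 'p, 'q) func, ('a, 'b, 'p, 'q) natt) psnat,
     ('o, 'm, 'c, 'd, ('a, 'b, 'p, 'q) func, ('a, 'b, 'p, 'q) natt) modif,
     ('o, 'm, 'c, 'd, ('a, 'b, 'p, 'q) func, ('a, 'b, 'p, 'q) natt) psnat,
     ('o, 'm, 'c, 'd, ('a, 'b, 'p, 'q) func, ('a, 'b, 'p, 'q) natt) modif) func" where
  "weighted_func D J F H =
     \<lparr>FDom = Hom_cat (op2 D) J (hom_into F (FDom H)),
      FCod = Hom_cat (op2 D) J (hom_into F (FCod H)),
      FOb = (\<lambda>\<sigma>\<in>Obj (Hom_cat (op2 D) J (hom_into F (FDom H))).
        psnat_comp (op2 D) (hom_into_func D F H) \<sigma>),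
      FAr = (\<lambda>\<Gamma>\<in>Arr (Hom_cat (op2 D) J (hom_into F (FDom H))).
        modif_hcomp (op2 D) (id_modif (op2 D) (hom_into_func D F H)) \<Gamma>)\<rparr>"

definition weighted :: "('o, 'm, 'n) twocat \<Rightarrow> ('o, 'm, 'n, 'c, 'd) psfun_cat \<Rightarrow>
    ('o, 'm, 'n, 'a, 'b) psfun_cat \<Rightarrow>
    (('p, 'q) cat, ('p, 'q, 'p, 'q) func, ('p, 'q, 'p, 'q) natt,
     (('o, 'm, 'c, 'd, ('a, 'b, 'p, 'q) func, ('a, 'b, 'p, 'q) natt) psnat,
      ('o, 'm, 'c, 'd, ('a, 'b, 'p, 'q) func, ('a, 'b, 'p, 'q) natt) modif) cat,
     (('o, 'm, 'c, 'd, ('a, 'b, 'p, 'q) func, ('a, 'b, 'p, 'q) natt) psnat,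
      ('o, 'm, 'c, 'd, ('a, 'b, 'p, 'q) func, ('a, 'b, 'p, 'q) natt) modif,
      ('o, 'm, 'c, 'd, ('a, 'b, 'p, 'q) func, ('a, 'b, 'p, 'q) natt) psnat,
      ('o, 'm, 'c, 'd, ('a, 'b, 'p, 'q) func, ('a, 'b, 'p, 'q) natt) modif) func,
     (('o, 'm, 'c, 'd, ('a, 'b, 'p, 'q) func, ('a, 'b, 'p, 'q) natt) psnat,
      ('o, 'm, 'c, 'd, ('a, 'b, 'p, 'q) func, ('a, 'b, 'p, 'q) natt) modif,
      ('o, 'm, 'c, 'd, ('a, 'b, 'p, 'q) func, ('a, 'b, 'p, 'q) natt) psnat,
      ('o, 'm, 'c, 'd, ('a, 'b, 'p, 'q) func, ('a, 'b, 'p, 'q) natt) modif) natt) twofun" where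
  "weighted D J F =
     \<lparr>T0 = (\<lambda>C. Hom_cat (op2 D) J (hom_into F C)),
      T1 = weighted_func D J F,
      T2 = (\<lambda>\<alpha>. \<lparr>NDom = weighted_func D J F (NDom \<alpha>), NCod = weighted_func D J F (NCod \<alpha>),
        NT = (\<lambda>\<sigma>\<in>Obj (Hom_cat (op2 D) J (hom_into F (FDom (NDom \<alpha>)))).
          modif_hcomp (op2 D) (hom_into_nat D F \<alpha>) (id_modif (op2 D) \<sigma>))\<rparr>)\<rparr>"

definition weighted_pseudo_colimit :: "'u rel \<Rightarrow> ('o, 'm, 'n) twocat \<Rightarrow>
    ('o, 'm, 'n, 'u, 'u) psfun_cat \<Rightarrow> ('o, 'm, 'n, 'u, 'u) psfun_cat \<Rightarrow> ('u, 'u) cat \<Rightarrow> bool" where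
  "weighted_pseudo_colimit \<kappa> D J F W \<longleftrightarrow> W \<in> Cell0 (Cat \<kappa>) \<and>
     two_naturally_isomorphic (Cat \<kappa>) (representable W) (weighted D J F)"

end

theory Submission
  imports Defs
begin

text \<open>The colimit \<open>W\<close> is presented by generators and relations. A pseudo natural transformation
  \<open>J \<Rightarrow> Cat(F-,C)\<close> unfolds into a family of objects \<open>(d,x,a)\<close> of \<open>C\<close>, for \<open>x\<close> in \<open>J d\<close> and \<open>a\<close> in \<open>F d\<close>,
  with an action of the arrows of \<open>J d\<close> and of \<open>F d\<close> and with isomorphisms
  \<open>(b, x, F u a) \<rightarrow> (a', J u x, a)\<close> for \<open>u : a' \<rightarrow> b\<close>, subject to equations between composites: a cocone.
  Instead of dividing the free category by the congruence that these equations generate, two parallel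
  words are identified when they agree in every cocone in a small category; then the equations
  hold in \<open>W\<close> because they hold in every cocone, and evaluation at a cocone is a functor on \<open>W\<close>.
  The resulting bijections between functors \<open>W \<rightarrow> C\<close> and pseudo natural transformations, and between
  transformations and modifications, are whiskering with the universal cocone, hence 2-natural; the
  2-functoriality of \<open>C \<mapsto> Hom[D\<^sup>o\<^sup>p,Cat](J,Cat(F-,C))\<close> is transported along them from that of \<open>Cat(W,-)\<close>.\<close>

section \<open>Categories and functor categories\<close>

text \<open>Agreement in all cocones is preferred to the generated congruence because it makes the
  quotient concrete: the class of a word is its family of values, so composites are pointwise, the
  category laws are inherited from the targets, and evaluation is well defined by construction. The
  cocones in small categories over \<open>'u\<close> form a set, as these categories share one type,
  and the universal property asks for no other targets. The price is the size of \<open>W\<close>: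
  families of values range over a set with no useful bound. The classes are therefore counted by the
  words that reach them; regularity of \<kappa> bounds the sums over generators, and uncountability
  admits the union over all lengths. The coherence isomorphisms need formal inverses among the
  generators, since words contain no inverses; their values in a cocone are forced. Functors out of
  \<open>W\<close> are determined on generators and naturality can be tested there, so the
  comparison is an isomorphism of categories and not only an equivalence, and the same presentation
  yields the two-dimensional half of the universal property.\<close>

declare category.Dom_in [simp] category.Cod_in [simp] category.Idn_in [simp]
  category.Dom_Idn [simp] category.Cod_Idn [simp] category.Cmp_in [simp]
  category.Dom_Cmp [simp] category.Cod_Cmp [simp] category.Cmp_assoc [simp]

lemma Cmp_Idn_right' [simp]:
  "\<lbrakk>category C; f \<in> Arr C; x = Dom C f\<rbrakk> \<Longrightarrow> Cmp C f (Idn C x) = f"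
  by (simp add: category.Cmp_Idn_right)

lemma Cmp_Idn_left' [simp]:
  "\<lbrakk>category C; f \<in> Arr C; x = Cod C f\<rbrakk> \<Longrightarrow> Cmp C (Idn C x) f = f"
  by (simp add: category.Cmp_Idn_left)

declare cat_functor.FDom_category [simp] cat_functor.FCod_category [simp]
  nat_trans.NDom_functor [simp] nat_trans.NCod_functor [simp]
  nat_trans.FDom_eq [simp] nat_trans.FCod_eq [simp]

lemma functor_FOb_in [simp]:
  "\<lbrakk>cat_functor F; FCod F = B; x \<in> Obj (FDom F)\<rbrakk> \<Longrightarrow> FOb F x \<in> Obj B"
  using cat_functor.FOb_in[of F] by auto

lemma functor_FAr_in [simp]:
  "\<lbrakk>cat_functor F; FCod F = B; f \<in> Arr (FDom F)\<rbrakk> \<Longrightarrow> FAr F f \<in> Arr B"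
  using cat_functor.FAr_in[of F] by auto

lemma functor_Dom [simp]:
  "\<lbrakk>cat_functor F; FCod F = B; f \<in> Arr (FDom F)\<rbrakk> \<Longrightarrow> Dom B (FAr F f) = FOb F (Dom (FDom F) f)"
  using cat_functor.FAr_Dom[of F] by auto

lemma functor_Cod [simp]:
  "\<lbrakk>cat_functor F; FCod F = B; f \<in> Arr (FDom F)\<rbrakk> \<Longrightarrow> Cod B (FAr F f) = FOb F (Cod (FDom F) f)"
  using cat_functor.FAr_Cod[of F] by auto

lemma functor_Idn [simp]:
  "\<lbrakk>cat_functor F; FDom F = A; x \<in> Obj A\<rbrakk> \<Longrightarrow> FAr F (Idn A x) = Idn (FCod F) (FOb F x)"
  using cat_functor.FAr_Idn[of F] by auto

lemma functor_Cmp [simp]: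
  "\<lbrakk>cat_functor F; FDom F = A; f \<in> Arr A; g \<in> Arr A; Dom A g = Cod A f\<rbrakk>
    \<Longrightarrow> FAr F (Cmp A g f) = Cmp (FCod F) (FAr F g) (FAr F f)"
  using cat_functor.FAr_Cmp[of F] by auto

text \<open>Both underlying functions are extensional, so agreement on the carriers is equality of
  records. Most equations between functors below are reduced by this rule.\<close>

lemma func_eqI:
  assumes "cat_functor F" "cat_functor G" "FDom F = FDom G" "FCod F = FCod G"
    and "\<And>x. x \<in> Obj (FDom G) \<Longrightarrow> FOb F x = FOb G x"
    and "\<And>f. f \<in> Arr (FDom G) \<Longrightarrow> FAr F f = FAr G f"
  shows "F = G"
proof -
  have "FOb F = FOb G"
    by (rule PiE_ext[OF cat_functor.FOb_in[OF assms(1)]])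
      (use assms cat_functor.FOb_in[OF assms(2)] in simp_all)
  moreover have "FAr F = FAr G"
    by (rule PiE_ext[OF cat_functor.FAr_in[OF assms(1)]])
      (use assms cat_functor.FAr_in[OF assms(2)] in simp_all)
  ultimately show ?thesis using assms by simp
qed

lemma in_functors_iff [simp]:
  "F \<in> functors A B \<longleftrightarrow> cat_functor F \<and> FDom F = A \<and> FCod F = B"
  by (simp add: functors_def)

lemma id_func_simps [simp]:
  "FDom (id_func A) = A" "FCod (id_func A) = A"
  "x \<in> Obj A \<Longrightarrow> FOb (id_func A) x = x" "f \<in> Arr A \<Longrightarrow> FAr (id_func A) f = f"
  by (simp_all add: id_func_def)

lemma comp_func_simps [simp]:
  "FDom (comp_func G F) = FDom F" "FCod (comp_func G F) = FCod G"
  "x \<in> Obj (FDom F) \<Longrightarrow> FOb (comp_func G F) x = FOb G (FOb F x)"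
  "f \<in> Arr (FDom F) \<Longrightarrow> FAr (comp_func G F) f = FAr G (FAr F f)"
  by (simp_all add: comp_func_def)

lemma cat_functor_id_func [simp]: "category A \<Longrightarrow> cat_functor (id_func A)"
  by unfold_locales (auto simp: id_func_def)

lemma cat_functor_comp_func [simp]:
  "\<lbrakk>cat_functor F; cat_functor G; FCod F = FDom G\<rbrakk> \<Longrightarrow> cat_functor (comp_func G F)"
  by unfold_locales (auto simp: comp_func_def)

lemma comp_func_assoc [simp]:
  assumes "cat_functor F" "cat_functor G" "cat_functor H" "FCod F = FDom G" "FCod G = FDom H"
  shows "comp_func (comp_func H G) F = comp_func H (comp_func G F)"
  by (rule func_eqI) (use assms in simp_all)

lemma comp_func_id [simp]:
  "\<lbrakk>cat_functor F; A = FDom F\<rbrakk> \<Longrightarrow> comp_func F (id_func A) = F"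
  "\<lbrakk>cat_functor F; B = FCod F\<rbrakk> \<Longrightarrow> comp_func (id_func B) F = F"
  by (rule func_eqI; simp)+

section \<open>Natural transformations and their composites\<close>

lemma nat_NT_in [simp]:
  "\<lbrakk>nat_trans \<alpha>; FCod (NDom \<alpha>) = B; x \<in> Obj (FDom (NDom \<alpha>))\<rbrakk> \<Longrightarrow> NT \<alpha> x \<in> Arr B"
  using nat_trans.NT_in[of \<alpha>] by auto

lemma nat_NT_Dom [simp]:
  "\<lbrakk>nat_trans \<alpha>; FCod (NDom \<alpha>) = B; x \<in> Obj (FDom (NDom \<alpha>))\<rbrakk> \<Longrightarrow> Dom B (NT \<alpha> x) = FOb (NDom \<alpha>) x"
  using nat_trans.NT_Dom[of \<alpha>] by auto

lemma nat_NT_Cod [simp]: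
  "\<lbrakk>nat_trans \<alpha>; FCod (NDom \<alpha>) = B; x \<in> Obj (FDom (NDom \<alpha>))\<rbrakk> \<Longrightarrow> Cod B (NT \<alpha> x) = FOb (NCod \<alpha>) x"
  using nat_trans.NT_Cod[of \<alpha>] by auto

lemma nat_naturality:
  "\<lbrakk>nat_trans \<alpha>; NDom \<alpha> = F; NCod \<alpha> = G; f \<in> Arr (FDom F)\<rbrakk> \<Longrightarrow>
    Cmp (FCod F) (NT \<alpha> (Cod (FDom F) f)) (FAr F f) = Cmp (FCod F) (FAr G f) (NT \<alpha> (Dom (FDom F) f))"
  using nat_trans.naturality[of \<alpha>] by auto

lemma nat_eqI:
  assumes "nat_trans \<alpha>" "nat_trans \<beta>" "NDom \<alpha> = NDom \<beta>" "NCod \<alpha> = NCod \<beta>"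
    and "\<And>x. x \<in> Obj (FDom (NDom \<beta>)) \<Longrightarrow> NT \<alpha> x = NT \<beta> x"
  shows "\<alpha> = \<beta>"
proof -
  have "NT \<alpha> = NT \<beta>"
    by (rule PiE_ext[OF nat_trans.NT_in[OF assms(1)]])
      (use assms nat_trans.NT_in[OF assms(2)] in simp_all)
  then show ?thesis using assms by simp
qed

lemma nat_transI:
  assumes "cat_functor F" "cat_functor G" "FDom F = A" "FDom G = FDom F" "FCod G = FCod F"
    and "\<And>x. x \<in> Obj A \<Longrightarrow> t x \<in> Arr (FCod F) \<and> Dom (FCod F) (t x) = FOb F x
      \<and> Cod (FCod F) (t x) = FOb G x"
    and "\<And>f. f \<in> Arr A \<Longrightarrow> Cmp (FCod F) (t (Cod A f)) (FAr F f) = Cmp (FCod F) (FAr G f) (t (Dom A f))"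
  shows "nat_trans \<lparr>NDom = F, NCod = G, NT = (\<lambda>x\<in>Obj A. t x)\<rparr>"
  by (rule nat_trans.intro) (use assms in auto)

lemma cat_functorI:
  assumes "category A" "category B"
    and "\<And>x. x \<in> Obj A \<Longrightarrow> fo x \<in> Obj B"
    and "\<And>f. f \<in> Arr A \<Longrightarrow> fa f \<in> Arr B \<and> Dom B (fa f) = fo (Dom A f) \<and> Cod B (fa f) = fo (Cod A f)"
    and "\<And>x. x \<in> Obj A \<Longrightarrow> fa (Idn A x) = Idn B (fo x)"
    and "\<And>f g. \<lbrakk>f \<in> Arr A; g \<in> Arr A; Dom A g = Cod A f\<rbrakk> \<Longrightarrow> fa (Cmp A g f) = Cmp B (fa g) (fa f)"
  shows "cat_functor \<lparr>FDom = A, FCod = B, FOb = (\<lambda>x\<in>Obj A. fo x), FAr = (\<lambda>f\<in>Arr A. fa f)\<rparr>"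
  by unfold_locales (use assms in auto)

lemma id_nat_simps [simp]:
  "NDom (id_nat F) = F" "NCod (id_nat F) = F"
  "x \<in> Obj (FDom F) \<Longrightarrow> NT (id_nat F) x = Idn (FCod F) (FOb F x)"
  by (simp_all add: id_nat_def)

lemma vcomp_nat_simps [simp]:
  "NDom (\<beta> \<bullet>\<^sub>v \<alpha>) = NDom \<alpha>" "NCod (\<beta> \<bullet>\<^sub>v \<alpha>) = NCod \<beta>"
  "x \<in> Obj (FDom (NDom \<alpha>)) \<Longrightarrow> NT (\<beta> \<bullet>\<^sub>v \<alpha>) x = Cmp (FCod (NDom \<alpha>)) (NT \<beta> x) (NT \<alpha> x)"
  by (simp_all add: vcomp_nat_def)

lemma hcomp_nat_simps [simp]:
  "NDom (\<beta> \<star> \<alpha>) = comp_func (NDom \<beta>) (NDom \<alpha>)" "NCod (\<beta> \<star> \<alpha>) = comp_func (NCod \<beta>) (NCod \<alpha>)"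
  by (simp_all add: hcomp_nat_def)

lemma hcomp_nat_NT:
  "x \<in> Obj (FDom (NDom \<alpha>)) \<Longrightarrow>
    NT (\<beta> \<star> \<alpha>) x = Cmp (FCod (NDom \<beta>)) (NT \<beta> (FOb (NCod \<alpha>) x)) (FAr (NDom \<beta>) (NT \<alpha> x))"
  by (simp add: hcomp_nat_def)

lemma NT_whisker_left [simp]:
  "\<lbrakk>cat_functor G; nat_trans \<alpha>; FCod (NDom \<alpha>) = FDom G; x \<in> Obj (FDom (NDom \<alpha>))\<rbrakk>
    \<Longrightarrow> NT (id_nat G \<star> \<alpha>) x = FAr G (NT \<alpha> x)"
  by (simp add: hcomp_nat_NT)

lemma NT_whisker_right [simp]:
  "\<lbrakk>cat_functor F; nat_trans \<beta>; FCod F = FDom (NDom \<beta>); x \<in> Obj (FDom F)\<rbrakk>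
    \<Longrightarrow> NT (\<beta> \<star> id_nat F) x = NT \<beta> (FOb F x)"
  by (simp add: hcomp_nat_NT)

lemma nat_trans_id_nat [simp]: "cat_functor F \<Longrightarrow> nat_trans (id_nat F)"
  unfolding id_nat_def by (rule nat_transI) simp_all

text \<open>The simp rule \<open>Cmp_assoc\<close> nests composites to the right, which hides the
  subterm \<open>Cmp C h g\<close>. This restates an equation about it in the presence of a further
  arrow \<open>f\<close>, so that it can rewrite normalised terms.\<close>

lemma cat_eq_assoc:
  assumes "category C" "f \<in> Arr C" "g \<in> Arr C" "h \<in> Arr C" "Dom C g = Cod C f" "Dom C h = Cod C g"
    "Cmp C h g = k"
  shows "Cmp C h (Cmp C g f) = Cmp C k f"
  using assms by (metis category.Cmp_assoc)

lemma nat_trans_vcomp [simp]: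
  assumes "nat_trans \<alpha>" "nat_trans \<beta>" "NDom \<beta> = NCod \<alpha>"
  shows "nat_trans (\<beta> \<bullet>\<^sub>v \<alpha>)"
proof -
  have 2: "FDom (NCod \<beta>) = FDom (NDom \<alpha>)" "FCod (NCod \<beta>) = FCod (NDom \<alpha>)"
    using assms by simp_all
  show ?thesis unfolding vcomp_nat_def
  proof (rule nat_transI)
    fix f assume f: "f \<in> Arr (FDom (NDom \<alpha>))"
    let ?A = "FDom (NDom \<alpha>)" and ?B = "FCod (NDom \<alpha>)"
    have C: "category ?A" "category ?B" using assms by simp_all
    have n1: "Cmp ?B (NT \<alpha> (Cod ?A f)) (FAr (NDom \<alpha>) f) = Cmp ?B (FAr (NCod \<alpha>) f) (NT \<alpha> (Dom ?A f))"
      using nat_naturality[OF assms(1) refl refl f] .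
    have n2: "Cmp ?B (NT \<beta> (Cod ?A f)) (FAr (NCod \<alpha>) f) = Cmp ?B (FAr (NCod \<beta>) f) (NT \<beta> (Dom ?A f))"
      using nat_naturality[OF assms(2) refl refl] f assms by simp
    show "Cmp ?B (Cmp ?B (NT \<beta> (Cod ?A f)) (NT \<alpha> (Cod ?A f))) (FAr (NDom \<alpha>) f)
        = Cmp ?B (FAr (NCod \<beta>) f) (Cmp ?B (NT \<beta> (Dom ?A f)) (NT \<alpha> (Dom ?A f)))"
      using assms 2 f C n1 by (simp add: cat_eq_assoc[OF C(2) _ _ _ _ _ n2])
  qed (use assms 2 in simp_all)
qed

text \<open>Two squares are pasted: the image under \<open>NDom \<beta>\<close> of the square of
  \<alpha> at \<open>f\<close>, and the square of \<beta> at the arrow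
  \<open>FAr (NCod \<alpha>) f\<close>.\<close>

lemma nat_trans_hcomp [simp]:
  assumes "nat_trans \<alpha>" "nat_trans \<beta>" "FCod (NDom \<alpha>) = FDom (NDom \<beta>)"
  shows "nat_trans (\<beta> \<star> \<alpha>)"
  unfolding hcomp_nat_def
proof (rule nat_transI)
  let ?A = "FDom (NDom \<alpha>)" and ?B = "FDom (NDom \<beta>)" and ?C = "FCod (NDom \<beta>)"
  fix f assume f: "f \<in> Arr (FDom (NDom \<alpha>))"
  have C: "category ?A" "category ?B" "category ?C" using assms by simp_all
  have n1: "Cmp ?B (NT \<alpha> (Cod ?A f)) (FAr (NDom \<alpha>) f) = Cmp ?B (FAr (NCod \<alpha>) f) (NT \<alpha> (Dom ?A f))"
    using nat_naturality[OF assms(1) refl refl f] assms(3) by simp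
  have "FAr (NDom \<beta>) (Cmp ?B (NT \<alpha> (Cod ?A f)) (FAr (NDom \<alpha>) f))
      = FAr (NDom \<beta>) (Cmp ?B (FAr (NCod \<alpha>) f) (NT \<alpha> (Dom ?A f)))" using n1 by simp
  then have n1': "Cmp ?C (FAr (NDom \<beta>) (NT \<alpha> (Cod ?A f))) (FAr (NDom \<beta>) (FAr (NDom \<alpha>) f))
      = Cmp ?C (FAr (NDom \<beta>) (FAr (NCod \<alpha>) f)) (FAr (NDom \<beta>) (NT \<alpha> (Dom ?A f)))"
    using assms f C by simp
  have n2: "Cmp ?C (NT \<beta> (FOb (NCod \<alpha>) (Cod ?A f))) (FAr (NDom \<beta>) (FAr (NCod \<alpha>) f))
      = Cmp ?C (FAr (NCod \<beta>) (FAr (NCod \<alpha>) f)) (NT \<beta> (FOb (NCod \<alpha>) (Dom ?A f)))"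
    using nat_naturality[OF assms(2) refl refl, of "FAr (NCod \<alpha>) f"] f assms by simp
  let ?C' = "FCod (comp_func (NDom \<beta>) (NDom \<alpha>))"
  show "Cmp ?C' (Cmp ?C (NT \<beta> (FOb (NCod \<alpha>) (Cod ?A f))) (FAr (NDom \<beta>) (NT \<alpha> (Cod ?A f))))
      (FAr (comp_func (NDom \<beta>) (NDom \<alpha>)) f)
    = Cmp ?C' (FAr (comp_func (NCod \<beta>) (NCod \<alpha>)) f)
      (Cmp ?C (NT \<beta> (FOb (NCod \<alpha>) (Dom ?A f))) (FAr (NDom \<beta>) (NT \<alpha> (Dom ?A f))))"
    using assms f C n1' by (simp add: cat_eq_assoc[OF C(3) _ _ _ _ _ n2])
qed (use assms in simp_all)

section \<open>Functor categories and the composition functors between them\<close>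

lemma functor_cat_simps [simp]:
  "Obj (functor_cat A B) = functors A B"
  "\<alpha> \<in> Arr (functor_cat A B) \<longleftrightarrow> nat_trans \<alpha> \<and> FDom (NDom \<alpha>) = A \<and> FCod (NDom \<alpha>) = B"
  "Dom (functor_cat A B) = NDom" "Cod (functor_cat A B) = NCod"
  "Idn (functor_cat A B) = id_nat" "Cmp (functor_cat A B) = vcomp_nat"
  by (auto simp: functor_cat_def)

lemma vcomp_nat_laws:
  assumes "nat_trans \<alpha>"
  shows vcomp_id_nat_right: "\<alpha> \<bullet>\<^sub>v id_nat (NDom \<alpha>) = \<alpha>"
    and vcomp_id_nat_left: "id_nat (NCod \<alpha>) \<bullet>\<^sub>v \<alpha> = \<alpha>"
  by (rule nat_eqI; simp add: assms)+

lemma vcomp_nat_assoc: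
  assumes "nat_trans \<alpha>" "nat_trans \<beta>" "nat_trans \<gamma>" "NDom \<beta> = NCod \<alpha>" "NDom \<gamma> = NCod \<beta>"
  shows "(\<gamma> \<bullet>\<^sub>v \<beta>) \<bullet>\<^sub>v \<alpha> = \<gamma> \<bullet>\<^sub>v (\<beta> \<bullet>\<^sub>v \<alpha>)"
proof (rule nat_eqI)
  have "FDom (NCod \<beta>) = FDom (NDom \<alpha>)" "FCod (NCod \<beta>) = FCod (NDom \<alpha>)"
    using assms by simp_all
  then show "NT ((\<gamma> \<bullet>\<^sub>v \<beta>) \<bullet>\<^sub>v \<alpha>) x = NT (\<gamma> \<bullet>\<^sub>v \<beta> \<bullet>\<^sub>v \<alpha>) x"
    if "x \<in> Obj (FDom (NDom (\<gamma> \<bullet>\<^sub>v \<beta> \<bullet>\<^sub>v \<alpha>)))" for x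
    using that assms by simp
qed (use assms in simp_all)

lemma category_functor_cat [simp]: "category A \<Longrightarrow> category B \<Longrightarrow> category (functor_cat A B)"
  by unfold_locales (auto simp: vcomp_nat_laws vcomp_nat_assoc)

lemma postcomp_func_simps [simp]:
  "FDom (postcomp_func A H) = functor_cat A (FDom H)"
  "FCod (postcomp_func A H) = functor_cat A (FCod H)"
  "G \<in> functors A (FDom H) \<Longrightarrow> FOb (postcomp_func A H) G = comp_func H G"
  "\<gamma> \<in> Arr (functor_cat A (FDom H)) \<Longrightarrow> FAr (postcomp_func A H) \<gamma> = id_nat H \<star> \<gamma>"
  by (simp_all add: postcomp_func_def)

lemma precomp_func_simps [simp]:
  "FDom (precomp_func U C) = functor_cat (FCod U) C"
  "FCod (precomp_func U C) = functor_cat (FDom U) C"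
  "G \<in> functors (FCod U) C \<Longrightarrow> FOb (precomp_func U C) G = comp_func G U"
  "\<gamma> \<in> Arr (functor_cat (FCod U) C) \<Longrightarrow> FAr (precomp_func U C) \<gamma> = \<gamma> \<star> id_nat U"
  by (simp_all add: precomp_func_def)

lemma postcomp_nat_simps [simp]:
  "NDom (postcomp_nat A \<alpha>) = postcomp_func A (NDom \<alpha>)"
  "NCod (postcomp_nat A \<alpha>) = postcomp_func A (NCod \<alpha>)"
  "G \<in> functors A (FDom (NDom \<alpha>)) \<Longrightarrow> NT (postcomp_nat A \<alpha>) G = \<alpha> \<star> id_nat G"
  by (simp_all add: postcomp_nat_def)

lemma precomp_nat_simps [simp]:
  "NDom (precomp_nat \<alpha> C) = precomp_func (NDom \<alpha>) C"
  "NCod (precomp_nat \<alpha> C) = precomp_func (NCod \<alpha>) C"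
  "G \<in> functors (FCod (NDom \<alpha>)) C \<Longrightarrow> NT (precomp_nat \<alpha> C) G = id_nat G \<star> \<alpha>"
  by (simp_all add: precomp_nat_def)

lemma whisker_left_id [simp]:
  "\<lbrakk>cat_functor G; cat_functor H; FCod G = FDom H\<rbrakk> \<Longrightarrow> id_nat H \<star> id_nat G = id_nat (comp_func H G)"
  by (rule nat_eqI; simp)

lemma whisker_left_vcomp:
  assumes "nat_trans \<alpha>" "nat_trans \<beta>" "NDom \<beta> = NCod \<alpha>" "cat_functor H" "FCod (NDom \<alpha>) = FDom H"
  shows "id_nat H \<star> (\<beta> \<bullet>\<^sub>v \<alpha>) = (id_nat H \<star> \<beta>) \<bullet>\<^sub>v (id_nat H \<star> \<alpha>)"
proof (rule nat_eqI)
  have "FDom (NCod \<beta>) = FDom (NDom \<alpha>)" "FCod (NCod \<beta>) = FCod (NDom \<alpha>)"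
    using assms by simp_all
  then show "NT (id_nat H \<star> (\<beta> \<bullet>\<^sub>v \<alpha>)) x = NT ((id_nat H \<star> \<beta>) \<bullet>\<^sub>v (id_nat H \<star> \<alpha>)) x"
    if "x \<in> Obj (FDom (NDom ((id_nat H \<star> \<beta>) \<bullet>\<^sub>v (id_nat H \<star> \<alpha>))))" for x
    using that assms by simp
qed (use assms in simp_all)

lemma whisker_right_vcomp:
  assumes "nat_trans \<alpha>" "nat_trans \<beta>" "NDom \<beta> = NCod \<alpha>" "cat_functor U" "FDom (NDom \<alpha>) = FCod U"
  shows "(\<beta> \<bullet>\<^sub>v \<alpha>) \<star> id_nat U = (\<beta> \<star> id_nat U) \<bullet>\<^sub>v (\<alpha> \<star> id_nat U)"
proof (rule nat_eqI)
  have "FDom (NCod \<beta>) = FDom (NDom \<alpha>)" "FCod (NCod \<beta>) = FCod (NDom \<alpha>)"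
    using assms by simp_all
  then show "NT ((\<beta> \<bullet>\<^sub>v \<alpha>) \<star> id_nat U) x = NT ((\<beta> \<star> id_nat U) \<bullet>\<^sub>v (\<alpha> \<star> id_nat U)) x"
    if "x \<in> Obj (FDom (NDom ((\<beta> \<star> id_nat U) \<bullet>\<^sub>v (\<alpha> \<star> id_nat U))))" for x
    using that assms by simp
qed (use assms in simp_all)

text \<open>The two readings of the Godement composite; at \<open>x\<close> this is naturality of
  \<beta> at the arrow \<open>NT \<alpha> x\<close>. The same equation is the naturality square of
  \<open>postcomp_nat A \<beta>\<close> at \<alpha> and, read backwards, that of
  \<open>precomp_nat \<alpha> C\<close> at \<beta>.\<close>

lemma hcomp_nat_exchange:
  assumes "nat_trans \<alpha>" "nat_trans \<beta>" "FCod (NDom \<alpha>) = FDom (NDom \<beta>)"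
  shows "(\<beta> \<star> id_nat (NCod \<alpha>)) \<bullet>\<^sub>v (id_nat (NDom \<beta>) \<star> \<alpha>)
    = (id_nat (NCod \<beta>) \<star> \<alpha>) \<bullet>\<^sub>v (\<beta> \<star> id_nat (NDom \<alpha>))"
proof (rule nat_eqI)
  show "NT ((\<beta> \<star> id_nat (NCod \<alpha>)) \<bullet>\<^sub>v (id_nat (NDom \<beta>) \<star> \<alpha>)) x
      = NT ((id_nat (NCod \<beta>) \<star> \<alpha>) \<bullet>\<^sub>v (\<beta> \<star> id_nat (NDom \<alpha>))) x"
    if "x \<in> Obj (FDom (NDom ((id_nat (NCod \<beta>) \<star> \<alpha>) \<bullet>\<^sub>v (\<beta> \<star> id_nat (NDom \<alpha>)))))" for x
    using that assms nat_naturality[OF assms(2) refl refl, of "NT \<alpha> x"] by simp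
qed (use assms in simp_all)

lemma cat_functor_postcomp_func [simp]:
  assumes "category A" "cat_functor H"
  shows "cat_functor (postcomp_func A H)"
  unfolding postcomp_func_def
  by (rule cat_functorI) (use assms in \<open>auto simp: whisker_left_vcomp\<close>)

lemma cat_functor_precomp_func [simp]:
  assumes "category C" "cat_functor U"
  shows "cat_functor (precomp_func U C)"
  unfolding precomp_func_def
  by (rule cat_functorI) (use assms in \<open>auto simp: whisker_right_vcomp\<close>)

lemma nat_trans_postcomp_nat [simp]:
  assumes "category A" "nat_trans \<alpha>"
  shows "nat_trans (postcomp_nat A \<alpha>)"
  unfolding postcomp_nat_def
  by (rule nat_transI) (use assms in \<open>auto simp: hcomp_nat_exchange\<close>)

lemma nat_trans_precomp_nat [simp]:
  assumes "category C" "nat_trans \<alpha>"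
  shows "nat_trans (precomp_nat \<alpha> C)"
  unfolding precomp_nat_def
  by (rule nat_transI) (use assms in \<open>auto simp: hcomp_nat_exchange[symmetric]\<close>)

section \<open>The 2-functor Cat(W,-) on a full sub-2-category\<close>

lemma full_cat2_simps [simp]:
  "a \<in> Cell0 (full_cat2 S) \<longleftrightarrow> category a \<and> a \<in> S"
  "F \<in> Cell1 (full_cat2 S) \<longleftrightarrow> cat_functor F \<and> FDom F \<in> S \<and> FCod F \<in> S"
  "\<alpha> \<in> Cell2 (full_cat2 S) \<longleftrightarrow> nat_trans \<alpha> \<and> FDom (NDom \<alpha>) \<in> S \<and> FCod (NDom \<alpha>) \<in> S"
  "dom1 (full_cat2 S) = FDom" "cod1 (full_cat2 S) = FCod" "id1 (full_cat2 S) = id_func"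
  "cmp1 (full_cat2 S) = comp_func" "src2 (full_cat2 S) = NDom" "trg2 (full_cat2 S) = NCod"
  "id2 (full_cat2 S) = id_nat" "vcmp (full_cat2 S) = vcomp_nat" "hcmp (full_cat2 S) = hcomp_nat"
  by (auto simp: full_cat2_def)

text \<open>The right-hand side is what the definition of \<star> gives for the component at
  \<open>G\<close> of the horizontal composite of \<open>postcomp_nat W \<beta>\<close> and
  \<open>postcomp_nat W \<alpha>\<close>; hence this is preservation of horizontal composition by
  Cat(W,-).\<close>

lemma hcomp_nat_whisker:
  assumes "nat_trans \<alpha>" "nat_trans \<beta>" "FDom (NDom \<beta>) = FCod (NDom \<alpha>)" "cat_functor G"
    "FCod G = FDom (NDom \<alpha>)"
  shows "(\<beta> \<star> \<alpha>) \<star> id_nat G = (\<beta> \<star> id_nat (comp_func (NCod \<alpha>) G)) \<bullet>\<^sub>v (id_nat (NDom \<beta>) \<star> (\<alpha> \<star> id_nat G))"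
  by (rule nat_eqI) (use assms in \<open>simp_all add: hcomp_nat_NT\<close>)

lemma postcomp_func_comp_func [simp]:
  "\<lbrakk>category A; cat_functor G; cat_functor F; FCod F = FDom G\<rbrakk>
    \<Longrightarrow> postcomp_func A (comp_func G F) = comp_func (postcomp_func A G) (postcomp_func A F)"
  by (rule func_eqI) (auto intro!: nat_eqI)

lemma two_functor_representable:
  fixes S :: "('p, 'q) cat set"
  assumes "category W"
  shows "two_functor (full_cat2 S) CAT (representable W)"
  unfolding CAT_def
\<comment> \<open>Goals 8 to 12 are \<open>T1_id\<close>, \<open>T1_cmp\<close>,
  \<open>T2_id\<close>, \<open>T2_vcmp\<close> and \<open>T2_hcmp\<close>; the earlier ones are
  typing.\<close>
proof (rule two_functor.intro, goal_cases)
  case (8 a)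
  then have "postcomp_func W (id_func a) = id_func (functor_cat W a)"
    by (intro func_eqI) (use assms in \<open>auto intro!: nat_eqI\<close>)
  then show ?case by (simp add: representable_def)
next
  case (9 f g)
  then show ?case using assms by (auto simp: representable_def)
next
  case (10 f)
  then have "postcomp_nat W (id_nat f) = id_nat (postcomp_func W f)"
    by (intro nat_eqI) (use assms in auto)
  then show ?case by (simp add: representable_def)
next
  case (11 \<alpha> \<beta>)
  then have "postcomp_nat W (\<beta> \<bullet>\<^sub>v \<alpha>) = postcomp_nat W \<beta> \<bullet>\<^sub>v postcomp_nat W \<alpha>"
    by (intro nat_eqI) (use assms in \<open>auto simp: whisker_right_vcomp\<close>)
  then show ?case by (simp add: representable_def)
next
  case (12 \<alpha> \<beta>)
  then have "postcomp_nat W (\<beta> \<star> \<alpha>) = postcomp_nat W \<beta> \<star> postcomp_nat W \<alpha>"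
    by (intro nat_eqI) (use assms in \<open>auto simp: hcomp_nat_NT hcomp_nat_whisker\<close>)
  then show ?case by (simp add: representable_def)
qed (use assms in \<open>auto simp: representable_def\<close>)

section \<open>Transport of 2-functors along bijections\<close>

lemma two_naturally_isomorphicI:
  fixes fo :: "('a, 'b) cat \<Rightarrow> 'p \<Rightarrow> 'r" and fa :: "('a, 'b) cat \<Rightarrow> 'q \<Rightarrow> 's"
  assumes S: "two_functor (full_cat2 U) CAT S"
    and bij0: "\<And>a. \<lbrakk>category a; a \<in> U\<rbrakk> \<Longrightarrow> bij_betw (fo a) (Obj (T0 S a)) (Obj (T0 T a))"
    and bij1: "\<And>a. \<lbrakk>category a; a \<in> U\<rbrakk> \<Longrightarrow> bij_betw (fa a) (Arr (T0 S a)) (Arr (T0 T a))"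
    and dom: "\<And>a f. \<lbrakk>category a; a \<in> U; f \<in> Arr (T0 S a)\<rbrakk>
      \<Longrightarrow> Dom (T0 T a) (fa a f) = fo a (Dom (T0 S a) f)"
    and cod: "\<And>a f. \<lbrakk>category a; a \<in> U; f \<in> Arr (T0 S a)\<rbrakk>
      \<Longrightarrow> Cod (T0 T a) (fa a f) = fo a (Cod (T0 S a) f)"
    and idn: "\<And>a x. \<lbrakk>category a; a \<in> U; x \<in> Obj (T0 S a)\<rbrakk>
      \<Longrightarrow> Idn (T0 T a) (fo a x) = fa a (Idn (T0 S a) x)"
    and cmp: "\<And>a f g. \<lbrakk>category a; a \<in> U; f \<in> Arr (T0 S a); g \<in> Arr (T0 S a);
        Dom (T0 S a) g = Cod (T0 S a) f\<rbrakk>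
      \<Longrightarrow> Cmp (T0 T a) (fa a g) (fa a f) = fa a (Cmp (T0 S a) g f)"
    and T1: "\<And>H. \<lbrakk>cat_functor H; FDom H \<in> U; FCod H \<in> U\<rbrakk>
      \<Longrightarrow> FDom (T1 T H) = T0 T (FDom H) \<and> FCod (T1 T H) = T0 T (FCod H)
        \<and> FOb (T1 T H) \<in> extensional (Obj (T0 T (FDom H)))
        \<and> FAr (T1 T H) \<in> extensional (Arr (T0 T (FDom H)))"
    and T1_Ob: "\<And>H x. \<lbrakk>cat_functor H; FDom H \<in> U; FCod H \<in> U; x \<in> Obj (T0 S (FDom H))\<rbrakk>
      \<Longrightarrow> FOb (T1 T H) (fo (FDom H) x) = fo (FCod H) (FOb (T1 S H) x)"
    and T1_Ar: "\<And>H f. \<lbrakk>cat_functor H; FDom H \<in> U; FCod H \<in> U; f \<in> Arr (T0 S (FDom H))\<rbrakk>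
      \<Longrightarrow> FAr (T1 T H) (fa (FDom H) f) = fa (FCod H) (FAr (T1 S H) f)"
    and T2: "\<And>\<alpha>. \<lbrakk>nat_trans \<alpha>; FDom (NDom \<alpha>) \<in> U; FCod (NDom \<alpha>) \<in> U\<rbrakk>
      \<Longrightarrow> NDom (T2 T \<alpha>) = T1 T (NDom \<alpha>) \<and> NCod (T2 T \<alpha>) = T1 T (NCod \<alpha>)
        \<and> NT (T2 T \<alpha>) \<in> extensional (Obj (T0 T (FDom (NDom \<alpha>))))"
    and T2_NT: "\<And>\<alpha> x. \<lbrakk>nat_trans \<alpha>; FDom (NDom \<alpha>) \<in> U; FCod (NDom \<alpha>) \<in> U; x \<in> Obj (T0 S (FDom (NDom \<alpha>)))\<rbrakk>
      \<Longrightarrow> NT (T2 T \<alpha>) (fo (FDom (NDom \<alpha>)) x) = fa (FCod (NDom \<alpha>)) (NT (T2 S \<alpha>) x)"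
  shows "two_naturally_isomorphic (full_cat2 U) S T"
proof -
  interpret S: two_functor "full_cat2 U" CAT S by (fact S)
  have S0: "category (T0 S a)" if "category a" "a \<in> U" for a
    using S.T0_in[of a] that by (simp add: CAT_def)
  have S1: "cat_functor (T1 S H)" "FDom (T1 S H) = T0 S (FDom H)" "FCod (T1 S H) = T0 S (FCod H)"
    if "cat_functor H" "FDom H \<in> U" "FCod H \<in> U" for H
    using S.T1_in[of H] S.T1_dom[of H] S.T1_cod[of H] that by (simp_all add: CAT_def)
  have S2: "nat_trans (T2 S \<alpha>)" "NDom (T2 S \<alpha>) = T1 S (NDom \<alpha>)" "NCod (T2 S \<alpha>) = T1 S (NCod \<alpha>)"
    if "nat_trans \<alpha>" "FDom (NDom \<alpha>) \<in> U" "FCod (NDom \<alpha>) \<in> U" for \<alpha>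
    using S.T2_in[of \<alpha>] S.T2_src[of \<alpha>] S.T2_trg[of \<alpha>] that by (simp_all add: CAT_def)
  have Obj_S: "fo a x \<in> Obj (T0 T a)" if "category a" "a \<in> U" "x \<in> Obj (T0 S a)" for a x
    using bij0[OF that(1,2)] that(3) by (auto simp: bij_betw_def)
  have Arr_S: "fa a f \<in> Arr (T0 T a)" if "category a" "a \<in> U" "f \<in> Arr (T0 S a)" for a f
    using bij1[OF that(1,2)] that(3) by (auto simp: bij_betw_def)
  have Obj_T: "\<exists>x\<in>Obj (T0 S a). y = fo a x" if "category a" "a \<in> U" "y \<in> Obj (T0 T a)" for a y
    using bij0[OF that(1,2)] that(3) by (auto simp: bij_betw_def)
  have Arr_T: "\<exists>f\<in>Arr (T0 S a). g = fa a f" if "category a" "a \<in> U" "g \<in> Arr (T0 T a)" for a g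
    using bij1[OF that(1,2)] that(3) by (auto simp: bij_betw_def)
  have inj0: "x = y" if "fo a x = fo a y" "category a" "a \<in> U" "x \<in> Obj (T0 S a)" "y \<in> Obj (T0 S a)" for a x y
    using bij0[OF that(2,3)] that by (auto simp: bij_betw_def inj_on_def)
  note [simp] = S0 S1 S2 Obj_S Arr_S dom cod idn cmp T1_Ob T1_Ar T2_NT
  \<comment> \<open>The hypothesis \<open>cmp\<close> speaks only of arrows that are composable in
    \<open>T0 S a\<close>. Injectivity on objects reflects composability of the images back.\<close>
  have Dom_eqD: "Dom (T0 S a) g = Cod (T0 S a) f"
    if "category a" "a \<in> U" "f \<in> Arr (T0 S a)" "g \<in> Arr (T0 S a)"
      "Dom (T0 T a) (fa a g) = Cod (T0 T a) (fa a f)" for a f g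
    using that inj0[of a "Dom (T0 S a) g" "Cod (T0 S a) f"] by simp
  have T0c: "category (T0 T a)" if a: "category a" "a \<in> U" for a
  proof
    fix f g h assume "f \<in> Arr (T0 T a)" "g \<in> Arr (T0 T a)" "h \<in> Arr (T0 T a)"
      and e: "Dom (T0 T a) g = Cod (T0 T a) f" "Dom (T0 T a) h = Cod (T0 T a) g"
    then obtain f' g' h' where *: "f' \<in> Arr (T0 S a)" "g' \<in> Arr (T0 S a)" "h' \<in> Arr (T0 S a)"
      "f = fa a f'" "g = fa a g'" "h = fa a h'"
      using Arr_T[OF a] by metis
    show "Cmp (T0 T a) (Cmp (T0 T a) h g) f = Cmp (T0 T a) h (Cmp (T0 T a) g f)"
      using * a Dom_eqD[OF a *(1,2)] Dom_eqD[OF a *(2,3)] e by simp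
  next
    fix f g assume "f \<in> Arr (T0 T a)" "g \<in> Arr (T0 T a)"
      and e: "Dom (T0 T a) g = Cod (T0 T a) f"
    then obtain f' g' where *: "f' \<in> Arr (T0 S a)" "g' \<in> Arr (T0 S a)"
      "f = fa a f'" "g = fa a g'"
      using Arr_T[OF a] by metis
    have "Dom (T0 S a) g' = Cod (T0 S a) f'" using Dom_eqD[OF a *(1,2)] e * by simp
    then show "Cmp (T0 T a) g f \<in> Arr (T0 T a)" "Dom (T0 T a) (Cmp (T0 T a) g f) = Dom (T0 T a) f"
      "Cod (T0 T a) (Cmp (T0 T a) g f) = Cod (T0 T a) g"
      using * a by simp_all
  qed (use a in \<open>auto dest!: Obj_T[OF a] Arr_T[OF a]\<close>)
  have T1f: "cat_functor (T1 T H)" if H: "cat_functor H" "FDom H \<in> U" "FCod H \<in> U" for H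
  proof -
    have c: "category (FDom H)" "category (FCod H)" using H by simp_all
    show ?thesis
    proof
      show "FAr (T1 T H) (Cmp (FDom (T1 T H)) g f) = Cmp (FCod (T1 T H)) (FAr (T1 T H) g) (FAr (T1 T H) f)"
        if fg: "f \<in> Arr (FDom (T1 T H))" "g \<in> Arr (FDom (T1 T H))"
          "Dom (FDom (T1 T H)) g = Cod (FDom (T1 T H)) f" for f g
      proof -
        from fg T1[OF H] obtain f' g' where *: "f' \<in> Arr (T0 S (FDom H))" "g' \<in> Arr (T0 S (FDom H))"
          "f = fa (FDom H) f'" "g = fa (FDom H) g'"
          using Arr_T[OF c(1) H(2)] by metis
        have "Dom (T0 S (FDom H)) g' = Cod (T0 S (FDom H)) f'"
          using Dom_eqD[OF c(1) H(2) *(1,2)] fg(3) * T1[OF H] by simp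
        then show ?thesis using * H c T1[OF H] by simp
      qed
    qed (use H c T1[OF H] T0c in \<open>auto simp: PiE_def dest!: Obj_T[OF c(1) H(2)] Arr_T[OF c(1) H(2)]\<close>)
  qed
  note T1' = T1[THEN conjunct1] T1[THEN conjunct2, THEN conjunct1]
  note T2' = T2[THEN conjunct1] T2[THEN conjunct2, THEN conjunct1]
  note [simp] = T0c T1f T1' T2'
  have T2n: "nat_trans (T2 T \<alpha>)" if al: "nat_trans \<alpha>" "FDom (NDom \<alpha>) \<in> U" "FCod (NDom \<alpha>) \<in> U" for \<alpha>
  proof -
    have c: "category (FDom (NDom \<alpha>))" "category (FCod (NDom \<alpha>))" using al by simp_all
    have n: "cat_functor (NDom \<alpha>)" "cat_functor (NCod \<alpha>)" "FDom (NCod \<alpha>) = FDom (NDom \<alpha>)"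
      "FCod (NCod \<alpha>) = FCod (NDom \<alpha>)" using al by simp_all
    show ?thesis
    proof (rule nat_trans.intro)
      fix f assume "f \<in> Arr (FDom (NDom (T2 T \<alpha>)))"
      then obtain f' where *: "f' \<in> Arr (T0 S (FDom (NDom \<alpha>)))" "f = fa (FDom (NDom \<alpha>)) f'"
        using Arr_T[OF c(1) al(2)] al n by auto
      have "Cmp (T0 S (FCod (NDom \<alpha>))) (NT (T2 S \<alpha>) (Cod (T0 S (FDom (NDom \<alpha>))) f')) (FAr (T1 S (NDom \<alpha>)) f')
          = Cmp (T0 S (FCod (NDom \<alpha>))) (FAr (T1 S (NCod \<alpha>)) f') (NT (T2 S \<alpha>) (Dom (T0 S (FDom (NDom \<alpha>))) f'))"
        using nat_naturality[OF S2(1)[OF al] refl refl, of f'] * al n c by simp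
      then show "Cmp (FCod (NDom (T2 T \<alpha>))) (NT (T2 T \<alpha>) (Cod (FDom (NDom (T2 T \<alpha>))) f)) (FAr (NDom (T2 T \<alpha>)) f)
          = Cmp (FCod (NDom (T2 T \<alpha>))) (FAr (NCod (T2 T \<alpha>)) f) (NT (T2 T \<alpha>) (Dom (FDom (NDom (T2 T \<alpha>))) f))"
        using * al n c T1_Ar[OF n(2), of f'] by simp
    qed (use al n c T2[OF al] T1_Ob[OF n(2)] in \<open>auto simp: PiE_def dest!: Obj_T[OF c(1) al(2)]\<close>)
  qed
  note [simp] = T2n
  have S_cmp: "T1 S (comp_func g f) = comp_func (T1 S g) (T1 S f)"
    if "cat_functor f" "FDom f \<in> U" "FCod f \<in> U" "cat_functor g" "FDom g = FCod f" "FCod g \<in> U" for f g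
    using S.T1_cmp[of f g] that by (simp add: CAT_def)
  have T_cmp: "T1 T (comp_func g f) = comp_func (T1 T g) (T1 T f)"
    if f: "cat_functor f" "FDom f \<in> U" "FCod f \<in> U"
      and g: "cat_functor g" "FDom g = FCod f" "FCod g \<in> U" for f g
  proof -
    have c: "category (FDom f)" "category (FCod f)" using f by simp_all
    show ?thesis
      by (rule func_eqI)
        (use f g c S_cmp[OF f g] T1_Ob[of "comp_func g f"] T1_Ar[of "comp_func g f"] T1_Ob[of g] T1_Ar[of g] in
          \<open>auto dest!: Obj_T[OF c(1) f(2)] Arr_T[OF c(1) f(2)]\<close>)
  qed
  have "two_functor (full_cat2 U) CAT T"
    unfolding CAT_def
  \<comment> \<open>As for the representable 2-functor, goals 8 to 12 are preservation of identities
    and composites. Each is an equation of functors or transformations, tested on images of objects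
    and arrows of \<open>S\<close>.\<close>
  proof (rule two_functor.intro, goal_cases)
    case (8 a)
    then have a: "category a" "a \<in> U" by simp_all
    have "T1 S (id_func a) = id_func (T0 S a)" using S.T1_id[of a] a by (simp add: CAT_def)
    then have "T1 T (id_func a) = id_func (T0 T a)"
      by (intro func_eqI)
        (use a T1_Ob[of "id_func a"] T1_Ar[of "id_func a"] in \<open>auto dest!: Obj_T[OF a] Arr_T[OF a]\<close>)
    then show ?case by simp
  next
    case (9 f g)
    then show ?case using T_cmp[of f g] by simp
  next
    case (10 f)
    then have f: "cat_functor f" "FDom f \<in> U" "FCod f \<in> U" by simp_all
    have c: "category (FDom f)" "category (FCod f)" using f by simp_all
    have "T2 S (id_nat f) = id_nat (T1 S f)"
      using S.T2_id[of f] f by (simp add: CAT_def)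
    then have "T2 T (id_nat f) = id_nat (T1 T f)"
      by (intro nat_eqI) (use f c T2_NT[of "id_nat f"] in \<open>auto dest!: Obj_T[OF c(1) f(2)]\<close>)
    then show ?case by simp
  next
    case (11 \<alpha> \<beta>)
    then have al: "nat_trans \<alpha>" "FDom (NDom \<alpha>) \<in> U" "FCod (NDom \<alpha>) \<in> U"
      and be: "nat_trans \<beta>" "NDom \<beta> = NCod \<alpha>" by simp_all
    have c: "category (FDom (NDom \<alpha>))" "category (FCod (NDom \<alpha>))" using al by simp_all
    have n: "FDom (NCod \<beta>) = FDom (NDom \<alpha>)" "FCod (NCod \<beta>) = FCod (NDom \<alpha>)"
      using al be by simp_all
    have "T2 S (\<beta> \<bullet>\<^sub>v \<alpha>) = T2 S \<beta> \<bullet>\<^sub>v T2 S \<alpha>"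
      using S.T2_vcmp[of \<alpha> \<beta>] al be by (simp add: CAT_def)
    then have "T2 T (\<beta> \<bullet>\<^sub>v \<alpha>) = T2 T \<beta> \<bullet>\<^sub>v T2 T \<alpha>"
      by (intro nat_eqI)
        (use al be c n T2_NT[of "\<beta> \<bullet>\<^sub>v \<alpha>"] T2_NT[of \<beta>] in \<open>auto dest!: Obj_T[OF c(1) al(2)]\<close>)
    then show ?case by simp
  next
    case (12 \<alpha> \<beta>)
    then have al: "nat_trans \<alpha>" "FDom (NDom \<alpha>) \<in> U" "FCod (NDom \<alpha>) \<in> U"
      and be: "nat_trans \<beta>" "FDom (NDom \<beta>) = FCod (NDom \<alpha>)" "FCod (NDom \<beta>) \<in> U" by simp_all
    have c: "category (FDom (NDom \<alpha>))" "category (FCod (NDom \<alpha>))" "category (FCod (NDom \<beta>))"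
      using al be by simp_all
    have n: "cat_functor (NCod \<alpha>)" "cat_functor (NCod \<beta>)" "cat_functor (NDom \<alpha>)" "cat_functor (NDom \<beta>)"
      "FDom (NCod \<alpha>) = FDom (NDom \<alpha>)" "FCod (NCod \<alpha>) = FCod (NDom \<alpha>)"
      "FDom (NCod \<beta>) = FDom (NDom \<beta>)" "FCod (NCod \<beta>) = FCod (NDom \<beta>)"
      using al be by simp_all
    have e: "T2 S (\<beta> \<star> \<alpha>) = T2 S \<beta> \<star> T2 S \<alpha>"
      using S.T2_hcmp[of \<alpha> \<beta>] al be by (simp add: CAT_def)
    have "T2 T (\<beta> \<star> \<alpha>) = T2 T \<beta> \<star> T2 T \<alpha>"
    proof (rule nat_eqI)
      fix y assume "y \<in> Obj (FDom (NDom (T2 T \<beta> \<star> T2 T \<alpha>)))"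
      then obtain x where x: "x \<in> Obj (T0 S (FDom (NDom \<alpha>)))" "y = fo (FDom (NDom \<alpha>)) x"
        using al be n c Obj_T[OF c(1) al(2)] by auto
      show "NT (T2 T (\<beta> \<star> \<alpha>)) y = NT (T2 T \<beta> \<star> T2 T \<alpha>) y"
        using x al be n c e S_cmp T2_NT[of "\<beta> \<star> \<alpha>" x] T2_NT[of \<beta>] T1_Ob[of "NCod \<alpha>" x] T1_Ar[of "NDom \<beta>"]
        by (simp add: hcomp_nat_NT)
    qed (use al be n c T_cmp in simp_all)
    then show ?case by simp
  qed auto
  moreover
  define \<Phi> where "\<Phi> a = \<lparr>FDom = T0 S a, FCod = T0 T a, FOb = (\<lambda>x\<in>Obj (T0 S a). fo a x),
    FAr = (\<lambda>f\<in>Arr (T0 S a). fa a f)\<rparr>" for a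
  have \<Phi>_simps [simp]: "FDom (\<Phi> a) = T0 S a" "FCod (\<Phi> a) = T0 T a"
    "x \<in> Obj (T0 S a) \<Longrightarrow> FOb (\<Phi> a) x = fo a x" "f \<in> Arr (T0 S a) \<Longrightarrow> FAr (\<Phi> a) f = fa a f" for a x f
    by (simp_all add: \<Phi>_def)
  have \<Phi>f [simp]: "cat_functor (\<Phi> a)" if "category a" "a \<in> U" for a
    unfolding \<Phi>_def by (rule cat_functorI) (use that in simp_all)
  have "isomorphism_of_categories (\<Phi> a)" if a: "category a" "a \<in> U" for a
  proof -
    define \<Psi> where "\<Psi> = \<lparr>FDom = T0 T a, FCod = T0 S a,
      FOb = (\<lambda>x\<in>Obj (T0 T a). inv_into (Obj (T0 S a)) (fo a) x),
      FAr = (\<lambda>f\<in>Arr (T0 T a). inv_into (Arr (T0 S a)) (fa a) f)\<rparr>"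
    note inv [simp] = bij_betw_inv_into_left[OF bij0[OF a]] bij_betw_inv_into_left[OF bij1[OF a]]
    have \<Psi>_simps [simp]: "FDom \<Psi> = T0 T a" "FCod \<Psi> = T0 S a"
      "x \<in> Obj (T0 S a) \<Longrightarrow> FOb \<Psi> (fo a x) = x" "f \<in> Arr (T0 S a) \<Longrightarrow> FAr \<Psi> (fa a f) = f" for x f
      using a by (simp_all add: \<Psi>_def)
    have \<Psi>f [simp]: "cat_functor \<Psi>"
      unfolding \<Psi>_def
    proof (rule cat_functorI)
      fix f g assume "f \<in> Arr (T0 T a)" "g \<in> Arr (T0 T a)"
        and e: "Dom (T0 T a) g = Cod (T0 T a) f"
      then obtain f' g' where *: "f' \<in> Arr (T0 S a)" "g' \<in> Arr (T0 S a)"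
        "f = fa a f'" "g = fa a g'"
        using Arr_T[OF a] by metis
      have "Dom (T0 S a) g' = Cod (T0 S a) f'" using Dom_eqD[OF a *(1,2)] e * by simp
      then show "inv_into (Arr (T0 S a)) (fa a) (Cmp (T0 T a) g f) =
         Cmp (T0 S a) (inv_into (Arr (T0 S a)) (fa a) g) (inv_into (Arr (T0 S a)) (fa a) f)"
        using * a by simp
    qed (use a in \<open>auto dest!: Obj_T[OF a] Arr_T[OF a]\<close>)
    show ?thesis unfolding isomorphism_of_categories_def
    proof (intro conjI bexI[of _ \<Psi>])
      show "comp_func \<Psi> (\<Phi> a) = id_func (FDom (\<Phi> a))" by (rule func_eqI) (use a in auto)
      show "comp_func (\<Phi> a) \<Psi> = id_func (FCod (\<Phi> a))"
        by (rule func_eqI) (use a in \<open>auto dest!: Obj_T[OF a] Arr_T[OF a]\<close>)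
    qed (use a in simp_all)
  qed
  moreover have comm: "comp_func (T1 T H) (\<Phi> (FDom H)) = comp_func (\<Phi> (FCod H)) (T1 S H)"
    if "cat_functor H" "FDom H \<in> U" "FCod H \<in> U" for H
    by (rule func_eqI) (use that in simp_all)
  moreover have "T2 T \<alpha> \<star> id_nat (\<Phi> (FDom (NDom \<alpha>))) = id_nat (\<Phi> (FCod (NDom \<alpha>))) \<star> T2 S \<alpha>"
    if al: "nat_trans \<alpha>" "FDom (NDom \<alpha>) \<in> U" "FCod (NDom \<alpha>) \<in> U" for \<alpha>
  proof (rule nat_eqI)
    have c: "category (FDom (NDom \<alpha>))" "category (FCod (NDom \<alpha>))" using al by simp_all
    have n: "cat_functor (NDom \<alpha>)" "cat_functor (NCod \<alpha>)" "FDom (NCod \<alpha>) = FDom (NDom \<alpha>)"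
      "FCod (NCod \<alpha>) = FCod (NDom \<alpha>)" using al by simp_all
    note [simp] = al c n comm[OF n(1)] comm[OF n(2)]
    show "nat_trans (T2 T \<alpha> \<star> id_nat (\<Phi> (FDom (NDom \<alpha>))))"
      "nat_trans (id_nat (\<Phi> (FCod (NDom \<alpha>))) \<star> T2 S \<alpha>)" by simp_all
    show "NDom (T2 T \<alpha> \<star> id_nat (\<Phi> (FDom (NDom \<alpha>)))) = NDom (id_nat (\<Phi> (FCod (NDom \<alpha>))) \<star> T2 S \<alpha>)"
      using comm[OF n(1)] by simp
    show "NCod (T2 T \<alpha> \<star> id_nat (\<Phi> (FDom (NDom \<alpha>)))) = NCod (id_nat (\<Phi> (FCod (NDom \<alpha>))) \<star> T2 S \<alpha>)"
      using comm[OF n(2)] by simp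
    fix x assume "x \<in> Obj (FDom (NDom (id_nat (\<Phi> (FCod (NDom \<alpha>))) \<star> T2 S \<alpha>)))"
    then show "NT (T2 T \<alpha> \<star> id_nat (\<Phi> (FDom (NDom \<alpha>)))) x = NT (id_nat (\<Phi> (FCod (NDom \<alpha>))) \<star> T2 S \<alpha>) x"
      by simp
  qed
  ultimately show ?thesis
    unfolding two_naturally_isomorphic_def by (intro conjI exI[of _ \<Phi>]) (auto simp: S)
qed

section \<open>Categories presented by a class of models\<close>

text \<open>All that the size estimates use. Stability, the form that regularity takes for infinite
  \<kappa>, bounds sums and unions indexed by fewer than \<kappa> elements; with the natural numbers
  below \<kappa>, a union over all word lengths is of this kind.\<close>

lemma uncountable_regularD:
  assumes "uncountable_regular \<kappa>"
  shows uncountable_regular_stable: "stable \<kappa>"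
    and uncountable_regular_nat: "|UNIV :: nat set| <o \<kappa>"
    and uncountable_regular_Un: "\<lbrakk>|A| <o \<kappa>; |B| <o \<kappa>\<rbrakk> \<Longrightarrow> |A \<union> B| <o \<kappa>"
proof -
  have c: "Card_order \<kappa>" "natLeq <o \<kappa>" "regularCard \<kappa>"
    using assms by (auto simp: uncountable_regular_def)
  have "cinfinite \<kappa>"
    using cinfinite_mono[OF ordLess_imp_ordLeq[OF c(2)] natLeq_cinfinite] .
  then have inf: "\<not> finite (Field \<kappa>)" by (simp add: cinfinite_def)
  show "stable \<kappa>" using c inf by (simp add: regularCard_stable)
  show "|UNIV :: nat set| <o \<kappa>" using ordIso_ordLess_trans[OF card_of_nat c(2)] .
  show "\<lbrakk>|A| <o \<kappa>; |B| <o \<kappa>\<rbrakk> \<Longrightarrow> |A \<union> B| <o \<kappa>"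
    using card_of_Un_ordLess_infinite_Field[OF inf c(1)] by blast
qed

lemma card_of_image_ordLess: "|A| <o \<kappa> \<Longrightarrow> |f ` A| <o \<kappa>"
  by (rule ordLeq_ordLess_trans[OF card_of_image])

lemma card_of_subset_ordLess: "\<lbrakk>|B| <o \<kappa>; A \<subseteq> B\<rbrakk> \<Longrightarrow> |A| <o \<kappa>"
  by (rule ordLeq_ordLess_trans[OF card_of_mono1])

text \<open>Lets a set constructed on another type be renamed into \<open>'u\<close>, where the
  objects and arrows of the colimit have to live.\<close>

lemma ordLess_inj_on:
  fixes \<kappa> :: "'u rel"
  assumes "Card_order \<kappa>" "|A| <o \<kappa>"
  obtains f :: "'a \<Rightarrow> 'u" where "inj_on f A"
proof -
  have "|A| \<le>o |Field \<kappa>|"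
    using ordLess_imp_ordLeq[OF ordLess_ordIso_trans[OF assms(2) ordIso_symmetric[OF card_of_Field_ordIso[OF assms(1)]]]] .
  then show thesis using that card_of_ordLeq[of A "Field \<kappa>"] by blast
qed

section \<open>Words in a graph modulo agreement in all models\<close>

type_synonym ('p, 'q, 'x, 'g) graph_model = "('p, 'q) cat \<times> ('x \<Rightarrow> 'p) \<times> ('g \<Rightarrow> 'q)"

text \<open>A word is stored as its values, indexed by models. The restriction to \<open>M\<close>
  makes equality of such families the same as agreement in every model of \<open>M\<close>.\<close>

definition nil_values :: "('p, 'q, 'x, 'g) graph_model set \<Rightarrow> 'x \<Rightarrow> ('p, 'q, 'x, 'g) graph_model \<Rightarrow> 'q" where
  "nil_values M x = (\<lambda>m\<in>M. Idn (fst m) (fst (snd m) x))"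

definition cons_values :: "('p, 'q, 'x, 'g) graph_model set \<Rightarrow> 'g \<Rightarrow>
    (('p, 'q, 'x, 'g) graph_model \<Rightarrow> 'q) \<Rightarrow> ('p, 'q, 'x, 'g) graph_model \<Rightarrow> 'q" where
  "cons_values M \<gamma> \<phi> = (\<lambda>m\<in>M. Cmp (fst m) (\<phi> m) (snd (snd m) \<gamma>))"

lemma nil_values_simps [simp]:
  "nil_values M x \<in> extensional M" "m \<in> M \<Longrightarrow> nil_values M x m = Idn (fst m) (fst (snd m) x)"
  unfolding nil_values_def by (rule restrict_extensional) simp

lemma cons_values_simps [simp]:
  "cons_values M \<gamma> \<phi> \<in> extensional M"
  "m \<in> M \<Longrightarrow> cons_values M \<gamma> \<phi> m = Cmp (fst m) (\<phi> m) (snd (snd m) \<gamma>)"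
  unfolding cons_values_def by (rule restrict_extensional) simp

text \<open>\<open>(x, y, \<phi>)\<close> represents the paths from \<open>x\<close> to \<open>y\<close> with value \<open>\<phi> m\<close> in every model \<open>m\<close>.\<close>

inductive_set paths_mod ::
  "'x set \<Rightarrow> 'g set \<Rightarrow> ('g \<Rightarrow> 'x) \<Rightarrow> ('g \<Rightarrow> 'x) \<Rightarrow> ('p, 'q, 'x, 'g) graph_model set
    \<Rightarrow> ('x \<times> 'x \<times> (('p, 'q, 'x, 'g) graph_model \<Rightarrow> 'q)) set"
  for X :: "'x set" and G :: "'g set" and s t M where
  Nil: "x \<in> X \<Longrightarrow> (x, x, nil_values M x) \<in> paths_mod X G s t M"
| Cons: "\<lbrakk>\<gamma> \<in> G; (t \<gamma>, y, \<phi>) \<in> paths_mod X G s t M\<rbrakk>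
    \<Longrightarrow> (s \<gamma>, y, cons_values M \<gamma> \<phi>) \<in> paths_mod X G s t M"

text \<open>The models do not enter the bound: every class is reached by a word, so the classes lie
  in a union of countably many levels, one for each length, and each level is an image of the
  previous one times \<open>G\<close>.\<close>

lemma card_of_paths_mod:
  fixes X :: "'x set"
  assumes "uncountable_regular \<kappa>" "|X| <o \<kappa>" "|G| <o \<kappa>"
  shows "|paths_mod X G s t M| <o \<kappa>"
proof -
  \<comment> \<open>No check that \<open>t \<gamma>\<close> is the source of the path: the levels
    contain more than the actual classes, which is harmless for an upper bound.\<close>
  define step where "step = (\<lambda>((x :: 'x, y :: 'x, \<phi>), \<gamma>).
    (s \<gamma>, y, cons_values M \<gamma> \<phi>))"
  define lev where "lev = rec_nat ((\<lambda>x. (x, x, nil_values M x)) ` X)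
    (\<lambda>_ A. step ` (A \<times> G))"
  have l: "|lev n| <o \<kappa>" for n
  proof (induction n)
    case 0
    then show ?case using assms by (simp add: lev_def card_of_image_ordLess)
  next
    case (Suc n)
    have "lev (Suc n) = step ` (lev n \<times> G)" by (simp add: lev_def)
    then show ?case
      using stable_elim[OF uncountable_regular_stable[OF assms(1)] Suc assms(3)]
      by (simp add: card_of_image_ordLess)
  qed
  have "paths_mod X G s t M \<subseteq> (\<Union>n. lev n)"
  proof
    have "(x, y, \<phi>) \<in> (\<Union>n. lev n)" if "(x, y, \<phi>) \<in> paths_mod X G s t M" for x y \<phi>
      using that
    proof (induction rule: paths_mod.induct)
      case (Nil x)
      then have "(x, x, nil_values M x) \<in> lev 0" by (simp add: lev_def)
      then show ?case by blast
    next
      case (Cons \<gamma> y \<phi>)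
      then obtain n where "(t \<gamma>, y, \<phi>) \<in> lev n" by blast
      then have "step ((t \<gamma>, y, \<phi>), \<gamma>) \<in> lev (Suc n)" using Cons by (auto simp: lev_def)
      then have "(s \<gamma>, y, cons_values M \<gamma> \<phi>) \<in> lev (Suc n)" by (simp add: step_def)
      then show ?case by blast
    qed
    then show "p \<in> (\<Union>n. lev n)" if "p \<in> paths_mod X G s t M" for p
      using that by (metis prod_cases3)
  qed
  moreover have "|\<Union>n. lev n| <o \<kappa>"
    by (rule stable_UNION[OF uncountable_regular_stable[OF assms(1)] uncountable_regular_nat[OF assms(1)] l])
  ultimately show ?thesis by (rule card_of_subset_ordLess[rotated])
qed

text \<open>The last three outputs are the interface to the rest: evaluation functors at the models;
  their joint faithfulness, by which an equation valid in every model holds in \<open>W\<close>; and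
  induction over words, by which functors and transformations out of \<open>W\<close> are controlled
  on generators. Parallel words may be identified, objects never are.\<close>

lemma presented_category:
  fixes \<kappa> :: "'u rel" and M :: "(('p, 'q) cat \<times> ('x \<Rightarrow> 'p) \<times> ('g \<Rightarrow> 'q)) set"
  assumes \<kappa>: "uncountable_regular \<kappa>" "|X| <o \<kappa>" "|G| <o \<kappa>"
    and st: "\<And>\<gamma>. \<gamma> \<in> G \<Longrightarrow> s \<gamma> \<in> X \<and> t \<gamma> \<in> X"
    and M: "\<And>C ob ar. (C, ob, ar) \<in> M \<Longrightarrow> category C"
      "\<And>C ob ar x. \<lbrakk>(C, ob, ar) \<in> M; x \<in> X\<rbrakk> \<Longrightarrow> ob x \<in> Obj C"
      "\<And>C ob ar \<gamma>. \<lbrakk>(C, ob, ar) \<in> M; \<gamma> \<in> G\<rbrakk>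
        \<Longrightarrow> ar \<gamma> \<in> Arr C \<and> Dom C (ar \<gamma>) = ob (s \<gamma>) \<and> Cod C (ar \<gamma>) = ob (t \<gamma>)"
  obtains W :: "('u, 'u) cat" and obW arW E where
    "small_cat \<kappa> W" "bij_betw obW X (Obj W)"
    "\<And>\<gamma>. \<gamma> \<in> G \<Longrightarrow> arW \<gamma> \<in> Arr W \<and> Dom W (arW \<gamma>) = obW (s \<gamma>) \<and> Cod W (arW \<gamma>) = obW (t \<gamma>)"
    "\<And>C ob ar. (C, ob, ar) \<in> M \<Longrightarrow> E (C, ob, ar) \<in> functors W C
      \<and> (\<forall>x\<in>X. FOb (E (C, ob, ar)) (obW x) = ob x) \<and> (\<forall>\<gamma>\<in>G. FAr (E (C, ob, ar)) (arW \<gamma>) = ar \<gamma>)"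
    "\<And>f f'. \<lbrakk>f \<in> Arr W; f' \<in> Arr W; Dom W f = Dom W f'; Cod W f = Cod W f';
      \<And>m. m \<in> M \<Longrightarrow> FAr (E m) f = FAr (E m) f'\<rbrakk> \<Longrightarrow> f = f'"
    "\<And>P f. \<lbrakk>f \<in> Arr W; \<And>x. x \<in> X \<Longrightarrow> P (Idn W (obW x));
      \<And>\<gamma> f. \<lbrakk>\<gamma> \<in> G; f \<in> Arr W; Dom W f = obW (t \<gamma>); P f\<rbrakk> \<Longrightarrow> P (Cmp W f (arW \<gamma>))\<rbrakk> \<Longrightarrow> P f"
proof -
  let ?A = "paths_mod X G s t M"
  let ?id = "\<lambda>x. (x, x, nil_values M x)"
  \<comment> \<open>The class of a one-edge word with its trailing identity already cancelled;
    \<open>genA\<close> reconciles this form with \<open>Cons\<close> applied to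
    \<open>Nil\<close>.\<close>
  define gen where "gen \<gamma> = (s \<gamma>, t \<gamma>, \<lambda>m\<in>M. snd (snd m) \<gamma>)" for \<gamma>
  \<comment> \<open>The middle vertices are not compared, so this is meaningful for composable words
    only. As it is pointwise, the laws of \<open>W\<close> are those of the models.\<close>
  define cmp where "cmp = (\<lambda>(y :: 'x, z :: 'x, \<psi>) (x :: 'x, y' :: 'x, \<phi>).
    (x, z, \<lambda>m\<in>M. Cmp (fst m) (\<psi> m) (\<phi> m)))"
  have M': "category (fst m)" "x \<in> X \<Longrightarrow> fst (snd m) x \<in> Obj (fst m)"
    "\<gamma> \<in> G \<Longrightarrow> snd (snd m) \<gamma> \<in> Arr (fst m)"
    "\<gamma> \<in> G \<Longrightarrow> Dom (fst m) (snd (snd m) \<gamma>) = fst (snd m) (s \<gamma>)"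
    "\<gamma> \<in> G \<Longrightarrow> Cod (fst m) (snd (snd m) \<gamma>) = fst (snd m) (t \<gamma>)"
    if "m \<in> M" for m x \<gamma>
    using that M by (cases m; auto)+
  have inv: "x \<in> X \<and> y \<in> X \<and> \<phi> \<in> extensional M \<and> (\<forall>m\<in>M. \<phi> m \<in> Arr (fst m)
      \<and> Dom (fst m) (\<phi> m) = fst (snd m) x \<and> Cod (fst m) (\<phi> m) = fst (snd m) y)"
    if "(x, y, \<phi>) \<in> ?A" for x y \<phi>
    using that by (induction rule: paths_mod.induct) (simp_all add: M' st)
  have genA: "gen \<gamma> \<in> ?A" if "\<gamma> \<in> G" for \<gamma>
  proof -
    have "(s \<gamma>, t \<gamma>, cons_values M \<gamma> (nil_values M (t \<gamma>))) \<in> ?A"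
      using paths_mod.Cons[OF that paths_mod.Nil] that st by blast
    moreover have "cons_values M \<gamma> (nil_values M (t \<gamma>)) = (\<lambda>m\<in>M. snd (snd m) \<gamma>)"
      unfolding cons_values_def nil_values_def by (rule restrict_ext) (simp add: M' that)
    ultimately show ?thesis by (simp add: gen_def)
  qed
  have step: "(s \<gamma>, y, cons_values M \<gamma> \<phi>) = cmp (t \<gamma>, y, \<phi>) (gen \<gamma>)" for \<gamma> y \<phi>
    by (simp add: cmp_def gen_def cons_values_def cong: restrict_cong)
  \<comment> \<open>Words grow at their source end, so the induction runs over the word applied
    first; associativity in each model then moves the new edge outside the composite.\<close>
  have cmpA: "cmp (y, z, \<psi>) (x, y, \<phi>) \<in> ?A" if "(x, y, \<phi>) \<in> ?A" "(y, z, \<psi>) \<in> ?A" for x y z \<phi> \<psi>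
    using that
  proof (induction rule: paths_mod.induct)
    case (Nil x)
    then have "cmp (x, z, \<psi>) (?id x) = (x, z, \<psi>)"
      using inv[OF Nil(2)] by (simp add: cmp_def) (rule extensionalityI[of _ M]; simp add: M')
    then show ?case using Nil by simp
  next
    case (Cons \<gamma> y \<phi>)
    let ?r = "\<lambda>m\<in>M. Cmp (fst m) (\<psi> m) (\<phi> m)"
    have "(s \<gamma>, z, cons_values M \<gamma> ?r) \<in> ?A"
      using paths_mod.Cons[of \<gamma> G t z ?r X s M] Cons by (simp add: cmp_def)
    moreover have "cons_values M \<gamma> ?r = (\<lambda>m\<in>M. Cmp (fst m) (\<psi> m) (cons_values M \<gamma> \<phi> m))"
      unfolding cons_values_def
      by (rule restrict_ext) (use inv[OF Cons(2)] inv[OF Cons(4)] Cons(1) in \<open>simp add: M' st\<close>)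
    ultimately show ?case by (simp add: cmp_def)
  qed
  have "|?A| <o \<kappa>" using card_of_paths_mod[OF \<kappa>] .
  have "Card_order \<kappa>" using \<kappa>(1) by (simp add: uncountable_regular_def)
  \<comment> \<open>Vertices and classes are renamed injectively into \<open>'u\<close>;
    \<open>i'\<close> and \<open>j'\<close> undo the renaming.\<close>
  obtain i :: "'x \<Rightarrow> 'u" where i: "inj_on i X" using ordLess_inj_on[OF \<open>Card_order \<kappa>\<close> \<kappa>(2)] .
  obtain j :: "_ \<Rightarrow> 'u" where j: "inj_on j ?A" using ordLess_inj_on[OF \<open>Card_order \<kappa>\<close> \<open>|?A| <o \<kappa>\<close>] .
  define i' where "i' = inv_into X i"
  define j' where "j' = inv_into ?A j"
  have i' [simp]: "x \<in> X \<Longrightarrow> i' (i x) = x" for x using i by (simp add: i'_def)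
  have j' [simp]: "p \<in> ?A \<Longrightarrow> j' (j p) = p" for p using j by (simp add: j'_def)
  define W where "W = \<lparr>Obj = i ` X, Arr = j ` ?A, Dom = (\<lambda>f. i (fst (j' f))),
    Cod = (\<lambda>f. i (fst (snd (j' f)))), Idn = (\<lambda>x. j (?id (i' x))), Cmp = (\<lambda>g f. j (cmp (j' g) (j' f)))\<rparr>"
  have W_simps [simp]: "Obj W = i ` X" "Arr W = j ` ?A"
    "(x, y, \<phi>) \<in> ?A \<Longrightarrow> Dom W (j (x, y, \<phi>)) = i x" "(x, y, \<phi>) \<in> ?A \<Longrightarrow> Cod W (j (x, y, \<phi>)) = i y"
    "x \<in> X \<Longrightarrow> Idn W (i x) = j (?id x)"
    "p \<in> ?A \<Longrightarrow> q \<in> ?A \<Longrightarrow> Cmp W (j q) (j p) = j (cmp q p)" for x y \<phi> p q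
    by (simp_all add: W_def)
  have iD: "x = y" if "i x = i y" "x \<in> X" "y \<in> X" for x y using that i by (auto simp: inj_on_def)
  have inv1: "x \<in> X" "y \<in> X" if "(x, y, \<phi>) \<in> ?A" for x y \<phi> using inv[OF that] by simp_all
  have inv2: "\<phi> m \<in> Arr (fst m)" "Dom (fst m) (\<phi> m) = fst (snd m) x" "Cod (fst m) (\<phi> m) = fst (snd m) y"
    if "m \<in> M" "(x, y, \<phi>) \<in> ?A" for x y \<phi> m
    using inv[OF that(2)] that(1) by auto
  note id_in = paths_mod.Nil
  have ArrE: "\<exists>x y \<phi>. (x, y, \<phi>) \<in> ?A \<and> f = j (x, y, \<phi>)" if "f \<in> Arr W" for f
    using that by auto
  have compE: "\<exists>x y z \<phi> \<psi>. (x, y, \<phi>) \<in> ?A \<and> (y, z, \<psi>) \<in> ?A \<and> f = j (x, y, \<phi>) \<and> g = j (y, z, \<psi>)"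
    if "f \<in> Arr W" "g \<in> Arr W" "Dom W g = Cod W f" for f g
  proof -
    from that ArrE obtain x y \<phi> y' z \<psi> where *: "(x, y, \<phi>) \<in> ?A" "f = j (x, y, \<phi>)"
      "(y', z, \<psi>) \<in> ?A" "g = j (y', z, \<psi>)" by metis
    then have "y' = y" using that(3) iD inv1 by simp
    then show ?thesis using * by blast
  qed
  have cW: "category W"
  proof
    fix f g h assume f: "f \<in> Arr W" and g: "g \<in> Arr W" and h: "h \<in> Arr W"
      and e: "Dom W g = Cod W f" "Dom W h = Cod W g"
    from compE[OF f g e(1)] obtain x y z \<phi> \<psi> where 1: "(x, y, \<phi>) \<in> ?A" "(y, z, \<psi>) \<in> ?A"
        "f = j (x, y, \<phi>)" "g = j (y, z, \<psi>)" by blast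
    moreover from ArrE[OF h] obtain z' w \<chi> where 2: "(z', w, \<chi>) \<in> ?A" "h = j (z', w, \<chi>)" by blast
    moreover have "z' = z" using e(2) 1 2 iD inv1 by simp
    ultimately have *: "(x, y, \<phi>) \<in> ?A" "(y, z, \<psi>) \<in> ?A" "(z, w, \<chi>) \<in> ?A"
        "f = j (x, y, \<phi>)" "g = j (y, z, \<psi>)" "h = j (z, w, \<chi>)" by simp_all
    have "cmp (cmp (z, w, \<chi>) (y, z, \<psi>)) (x, y, \<phi>) = cmp (z, w, \<chi>) (cmp (y, z, \<psi>) (x, y, \<phi>))"
      using inv2[OF _ *(1)] inv2[OF _ *(2)] inv2[OF _ *(3)] by (simp add: cmp_def M' cong: restrict_cong)
    then show "Cmp W (Cmp W h g) f = Cmp W h (Cmp W g f)"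
      using * by (simp add: cmpA)
  next
    fix f g assume "f \<in> Arr W" "g \<in> Arr W" "Dom W g = Cod W f"
    from compE[OF this] obtain x y z \<phi> \<psi> where *: "(x, y, \<phi>) \<in> ?A" "(y, z, \<psi>) \<in> ?A"
        "f = j (x, y, \<phi>)" "g = j (y, z, \<psi>)" by blast
    then show "Cmp W g f \<in> Arr W" "Dom W (Cmp W g f) = Dom W f" "Cod W (Cmp W g f) = Cod W g"
      using cmpA[OF *(1,2)] by (simp_all, simp_all add: cmp_def)
  next
    fix f assume "f \<in> Arr W"
    then obtain x y \<phi> where *: "(x, y, \<phi>) \<in> ?A" "f = j (x, y, \<phi>)" by auto
    have "cmp (x, y, \<phi>) (?id x) = (x, y, \<phi>)" "cmp (?id y) (x, y, \<phi>) = (x, y, \<phi>)"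
      using inv[OF *(1)] by (simp add: cmp_def; intro extensionalityI[of _ M]; simp add: M')+
    then show "Cmp W f (Idn W (Dom W f)) = f" "Cmp W (Idn W (Cod W f)) f = f"
      using * by (simp_all add: inv1[OF *(1)] id_in)
  next
    fix f assume "f \<in> Arr W"
    with ArrE show "Dom W f \<in> Obj W" "Cod W f \<in> Obj W" using inv1 by fastforce+
  next
    fix x assume "x \<in> Obj W"
    then obtain x' where "x' \<in> X" "x = i x'" by auto
    then show "Idn W x \<in> Arr W" "Dom W (Idn W x) = x" "Cod W (Idn W x) = x" by (simp_all add: id_in)
  qed
  \<comment> \<open>Evaluation reads off the entry at the given model. No representative is chosen,
    since a class is its family of values.\<close>
  define E where "E = (\<lambda>(C, ob, ar). \<lparr>FDom = W, FCod = C, FOb = (\<lambda>x\<in>Obj W. ob (i' x)),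
    FAr = (\<lambda>f\<in>Arr W. snd (snd (j' f)) (C, ob, ar))\<rparr>)"
  have E_FAr: "FAr (E m) (j (x, y, \<phi>)) = \<phi> m" if "(x, y, \<phi>) \<in> ?A" for m x y \<phi>
    using that by (cases m) (simp add: E_def)
  show thesis
  proof (rule that)
    show "small_cat \<kappa> W"
      using cW \<kappa>(2) \<open>|?A| <o \<kappa>\<close> by (simp add: small_cat_def card_of_image_ordLess)
    show "bij_betw i X (Obj W)" using i by (simp add: bij_betw_def)
    show "j (gen \<gamma>) \<in> Arr W \<and> Dom W (j (gen \<gamma>)) = i (s \<gamma>) \<and> Cod W (j (gen \<gamma>)) = i (t \<gamma>)" if "\<gamma> \<in> G" for \<gamma>
      using genA[OF that] by (simp add: gen_def)
    show "E (C, ob, ar) \<in> functors W C \<and> (\<forall>x\<in>X. FOb (E (C, ob, ar)) (i x) = ob x)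
        \<and> (\<forall>\<gamma>\<in>G. FAr (E (C, ob, ar)) (j (gen \<gamma>)) = ar \<gamma>)" if m: "(C, ob, ar) \<in> M" for C ob ar
    proof -
      have "cat_functor (E (C, ob, ar))"
        unfolding E_def prod.case
      proof (rule cat_functorI)
        fix f g assume "f \<in> Arr W" "g \<in> Arr W" "Dom W g = Cod W f"
        from compE[OF this] obtain x y z \<phi> \<psi> where *: "(x, y, \<phi>) \<in> ?A" "(y, z, \<psi>) \<in> ?A"
            "f = j (x, y, \<phi>)" "g = j (y, z, \<psi>)" by blast
        then show "snd (snd (j' (Cmp W g f))) (C, ob, ar)
            = Cmp C (snd (snd (j' g)) (C, ob, ar)) (snd (snd (j' f)) (C, ob, ar))"
          using cmpA[OF *(1,2)] m by (simp, simp add: cmp_def)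
            next
        fix f assume "f \<in> Arr W"
        from ArrE[OF this] obtain x y \<phi> where *: "(x, y, \<phi>) \<in> ?A" "f = j (x, y, \<phi>)" by blast
        then show "snd (snd (j' f)) (C, ob, ar) \<in> Arr C
            \<and> Dom C (snd (snd (j' f)) (C, ob, ar)) = ob (i' (Dom W f))
            \<and> Cod C (snd (snd (j' f)) (C, ob, ar)) = ob (i' (Cod W f))"
          using inv2[OF m *(1)] inv1[OF *(1)] * by simp
      qed (use M[OF m] m in \<open>auto simp: cW id_in\<close>)
      moreover have "FDom (E (C, ob, ar)) = W" "FCod (E (C, ob, ar)) = C" by (simp_all add: E_def)
      moreover have "FOb (E (C, ob, ar)) (i x) = ob x" if "x \<in> X" for x using that by (simp add: E_def)
      moreover have "FAr (E (C, ob, ar)) (j (gen \<gamma>)) = ar \<gamma>" if "\<gamma> \<in> G" for \<gamma>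
        using E_FAr[of "s \<gamma>" "t \<gamma>" _ "(C, ob, ar)"] genA[OF that] m by (simp add: gen_def)
      ultimately show ?thesis by simp
    qed
    show "f = f'" if "f \<in> Arr W" "f' \<in> Arr W" and D: "Dom W f = Dom W f'" "Cod W f = Cod W f'"
      and eq: "\<And>m. m \<in> M \<Longrightarrow> FAr (E m) f = FAr (E m) f'" for f f'
    proof -
      from that(1,2) obtain x y \<phi> x' y' \<phi>' where *: "(x, y, \<phi>) \<in> ?A" "f = j (x, y, \<phi>)"
        "(x', y', \<phi>') \<in> ?A" "f' = j (x', y', \<phi>')" by auto
      then have "x' = x" "y' = y" using D iD inv1 by simp_all
      moreover have "\<phi> = \<phi>'"
      proof (rule extensionalityI)
        show "\<phi> \<in> extensional M" "\<phi>' \<in> extensional M" using inv * by blast+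
        show "\<phi> m = \<phi>' m" if "m \<in> M" for m using eq[OF that] * by (simp add: E_FAr)
      qed
      ultimately show ?thesis using * by simp
    qed
    show "P f" if f: "f \<in> Arr W" and Nil: "\<And>x. x \<in> X \<Longrightarrow> P (Idn W (i x))"
      and Cons: "\<And>\<gamma> f. \<lbrakk>\<gamma> \<in> G; f \<in> Arr W; Dom W f = i (t \<gamma>); P f\<rbrakk> \<Longrightarrow> P (Cmp W f (j (gen \<gamma>)))" for P f
    proof -
      have "P (j (x, y, \<phi>))" if "(x, y, \<phi>) \<in> ?A" for x y \<phi>
        using that
      proof (induction rule: paths_mod.induct)
        case (Nil x)
        then show ?case using \<open>\<And>x. x \<in> X \<Longrightarrow> P (Idn W (i x))\<close>[of x] by simp
      next
        case (Cons \<gamma> y \<phi>)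
        then show ?case
          using \<open>\<And>\<gamma> f. \<lbrakk>\<gamma> \<in> G; f \<in> Arr W; Dom W f = i (t \<gamma>); P f\<rbrakk> \<Longrightarrow> P (Cmp W f (j (gen \<gamma>)))\<close>[of \<gamma> "j (t \<gamma>, y, \<phi>)"]
          by (simp add: genA step)
      qed
      then show ?thesis using f by auto
    qed
  qed
qed

text \<open>Coherence cells and the components of modifications are transformations whose components
  are again transformations. This reduces their equality to entries indexed by \<open>x\<close> and
  \<open>a\<close>.\<close>

lemma nat2_eqI:
  assumes "nat_trans \<alpha>" "nat_trans \<beta>" "NDom \<alpha> = NDom \<beta>" "NCod \<alpha> = NCod \<beta>"
    and FCod: "FCod (NDom \<beta>) = functor_cat A B"
    and eq: "\<And>x a. \<lbrakk>x \<in> Obj (FDom (NDom \<beta>)); a \<in> Obj A\<rbrakk> \<Longrightarrow> NT (NT \<alpha> x) a = NT (NT \<beta> x) a"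
  shows "\<alpha> = \<beta>"
proof (rule nat_eqI)
  fix x assume x: "x \<in> Obj (FDom (NDom \<beta>))"
  have "NT \<alpha> x \<in> Arr (functor_cat A B)" "NT \<beta> x \<in> Arr (functor_cat A B)"
    "Dom (functor_cat A B) (NT \<alpha> x) = Dom (functor_cat A B) (NT \<beta> x)"
    "Cod (functor_cat A B) (NT \<alpha> x) = Cod (functor_cat A B) (NT \<beta> x)"
    using assms(1-5) x nat_NT_in[of \<alpha> "functor_cat A B" x] nat_NT_in[of \<beta> "functor_cat A B" x]
      nat_NT_Dom[of \<alpha> "functor_cat A B" x] nat_NT_Dom[of \<beta> "functor_cat A B" x]
      nat_NT_Cod[of \<alpha> "functor_cat A B" x] nat_NT_Cod[of \<beta> "functor_cat A B" x] by auto
  then show "NT \<alpha> x = NT \<beta> x" by (intro nat_eqI) (auto simp: eq[OF x])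
qed fact+

lemma precomp_func_comp_func [simp]:
  "\<lbrakk>category C; cat_functor G; cat_functor F; FCod F = FDom G\<rbrakk>
    \<Longrightarrow> precomp_func (comp_func G F) C = comp_func (precomp_func F C) (precomp_func G C)"
  by (rule func_eqI) (auto intro!: nat_eqI)

lemma precomp_func_id_func [simp]:
  "\<lbrakk>category C; category A\<rbrakk> \<Longrightarrow> precomp_func (id_func A) C = id_func (functor_cat A C)"
  by (rule func_eqI) (auto intro!: nat_eqI)

section \<open>Inverses of arrows and of transformations\<close>

definition inverse_arrow :: "('o, 'm) cat \<Rightarrow> 'm \<Rightarrow> 'm" where
  "inverse_arrow C f = (SOME g. g \<in> Arr C \<and> Dom C g = Cod C f \<and> Cod C g = Dom C f \<and>
     Cmp C g f = Idn C (Dom C f) \<and> Cmp C f g = Idn C (Cod C f))"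

lemma inverse_arrow:
  assumes "invertible C f"
  shows "inverse_arrow C f \<in> Arr C" "Dom C (inverse_arrow C f) = Cod C f"
    "Cod C (inverse_arrow C f) = Dom C f" "Cmp C (inverse_arrow C f) f = Idn C (Dom C f)"
    "Cmp C f (inverse_arrow C f) = Idn C (Cod C f)"
proof -
  have "\<exists>g. g \<in> Arr C \<and> Dom C g = Cod C f \<and> Cod C g = Dom C f \<and>
     Cmp C g f = Idn C (Dom C f) \<and> Cmp C f g = Idn C (Cod C f)"
    using assms by (auto simp: invertible_def)
  from someI_ex[OF this] show "inverse_arrow C f \<in> Arr C" "Dom C (inverse_arrow C f) = Cod C f"
    "Cod C (inverse_arrow C f) = Dom C f" "Cmp C (inverse_arrow C f) f = Idn C (Dom C f)"
    "Cmp C f (inverse_arrow C f) = Idn C (Cod C f)"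
    unfolding inverse_arrow_def by blast+
qed

text \<open>A left inverse equals a right inverse, by bracketing the threefold composite in two
  ways. This forces the value of a cocone on \<open>GKinv\<close> once its value on
  \<open>GK\<close> is known.\<close>

lemma inverse_unique:
  assumes "category C" "f \<in> Arr C" "g \<in> Arr C" "h \<in> Arr C" "Dom C g = Cod C f" "Cod C h = Dom C f"
    "Dom C h = Cod C f" "Cmp C g f = Idn C (Dom C f)" "Cmp C f h = Idn C (Cod C f)"
  shows "g = h"
proof -
  have "Cod C g = Dom C f" using assms by (metis category.Cod_Cmp category.Cod_Idn category.Dom_in)
  have "Cmp C (Cmp C g f) h = Cmp C g (Cmp C f h)"
    by (rule category.Cmp_assoc) (use assms in simp_all)
  then show ?thesis
    unfolding assms(8,9) using assms \<open>Cod C g = Dom C f\<close> by simp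
qed

text \<open>Inverses chosen pointwise are automatically natural, as conjugating the naturality
  squares of \<alpha> with them shows.\<close>

lemma invertible_functor_cat:
  assumes \<alpha>: "nat_trans \<alpha>" "FDom (NDom \<alpha>) = A" "FCod (NDom \<alpha>) = B"
    and inv: "\<And>x. x \<in> Obj A \<Longrightarrow> invertible B (NT \<alpha> x)"
  shows "invertible (functor_cat A B) \<alpha>"
proof -
  let ?i = "\<lambda>x. inverse_arrow B (NT \<alpha> x)"
  have c: "category A" "category B" "cat_functor (NDom \<alpha>)" "cat_functor (NCod \<alpha>)"
    "FDom (NCod \<alpha>) = A" "FCod (NCod \<alpha>) = B"
    using \<alpha> by auto
  note i_simps [simp] = inverse_arrow(1,2,3,5)[OF inv]
  let ?\<beta> = "\<lparr>NDom = NCod \<alpha>, NCod = NDom \<alpha>, NT = (\<lambda>x\<in>Obj A. ?i x)\<rparr>"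
  have \<beta>: "nat_trans ?\<beta>"
  proof (rule nat_transI)
    fix f assume f: "f \<in> Arr A"
    have n: "Cmp B (NT \<alpha> (Cod A f)) (FAr (NDom \<alpha>) f) = Cmp B (FAr (NCod \<alpha>) f) (NT \<alpha> (Dom A f))"
      using nat_naturality[OF \<alpha>(1) refl refl] f \<alpha> by simp
    let ?x = "Dom A f" and ?y = "Cod A f"
    \<comment> \<open>Insert \<open>NT \<alpha> ?x\<close> after its inverse on the right, cross the
      square of \<alpha>, and cancel at \<open>?y\<close> on the left.\<close>
    have "Cmp B (?i ?y) (FAr (NCod \<alpha>) f)
        = Cmp B (?i ?y) (Cmp B (FAr (NCod \<alpha>) f) (Cmp B (NT \<alpha> ?x) (?i ?x)))"
      using c f \<alpha> by simp
    also have "\<dots> = Cmp B (?i ?y) (Cmp B (Cmp B (FAr (NCod \<alpha>) f) (NT \<alpha> ?x)) (?i ?x))"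
      using c f \<alpha> by simp
    also have "\<dots> = Cmp B (Cmp B (?i ?y) (NT \<alpha> ?y)) (Cmp B (FAr (NDom \<alpha>) f) (?i ?x))"
      unfolding n[symmetric] using c f \<alpha> by simp
    also have "\<dots> = Cmp B (FAr (NDom \<alpha>) f) (?i ?x)"
      using c f \<alpha> by (simp add: inverse_arrow(4)[OF inv] del: category.Cmp_assoc)
    finally show "Cmp (FCod (NCod \<alpha>)) (?i ?y) (FAr (NCod \<alpha>) f) = Cmp (FCod (NCod \<alpha>)) (FAr (NDom \<alpha>) f) (?i ?x)"
      using c by simp
  qed (use c \<alpha> in simp_all)
  show ?thesis unfolding invertible_def
  proof (intro conjI bexI[of _ ?\<beta>])
    show "Cmp (functor_cat A B) ?\<beta> \<alpha> = Idn (functor_cat A B) (Dom (functor_cat A B) \<alpha>)"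
      "Cmp (functor_cat A B) \<alpha> ?\<beta> = Idn (functor_cat A B) (Cod (functor_cat A B) \<alpha>)"
      by (simp_all, (rule nat_eqI; use \<alpha> \<beta> c in \<open>simp add: inverse_arrow(4)[OF inv]\<close>)+)
  qed (use \<alpha> \<beta> c in simp_all)
qed

lemma invertible_functor_catD:
  assumes "invertible (functor_cat A B) \<alpha>" "x \<in> Obj A"
  shows "invertible B (NT \<alpha> x)"
proof -
  from assms(1) obtain \<beta> where \<alpha>: "nat_trans \<alpha>" "FDom (NDom \<alpha>) = A" "FCod (NDom \<alpha>) = B"
    and \<beta>: "nat_trans \<beta>" "FDom (NDom \<beta>) = A" "FCod (NDom \<beta>) = B" "NDom \<beta> = NCod \<alpha>" "NCod \<beta> = NDom \<alpha>"
    and e: "\<beta> \<bullet>\<^sub>v \<alpha> = id_nat (NDom \<alpha>)" "\<alpha> \<bullet>\<^sub>v \<beta> = id_nat (NCod \<alpha>)"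
    by (auto simp: invertible_def)
  have "NT (\<beta> \<bullet>\<^sub>v \<alpha>) x = NT (id_nat (NDom \<alpha>)) x" "NT (\<alpha> \<bullet>\<^sub>v \<beta>) x = NT (id_nat (NCod \<alpha>)) x"
    by (simp_all add: e)
  then show ?thesis unfolding invertible_def
    using \<alpha> \<beta> assms(2) by (intro conjI bexI[of _ "NT \<beta> x"]) auto
qed

lemma op2_simps [simp]:
  "Cell0 (op2 D) = Cell0 D" "Cell1 (op2 D) = Cell1 D" "Cell2 (op2 D) = Cell2 D"
  "dom1 (op2 D) = cod1 D" "cod1 (op2 D) = dom1 D" "id1 (op2 D) = id1 D"
  "cmp1 (op2 D) g f = cmp1 D f g" "src2 (op2 D) = src2 D" "trg2 (op2 D) = trg2 D"
  by (simp_all add: op2_def)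

lemma hom_into_simps [simp]:
  "P0 (hom_into F C) d = functor_cat (P0 F d) C" "P1 (hom_into F C) u = precomp_func (P1 F u) C"
  "P2 (hom_into F C) \<alpha> = precomp_nat (P2 F \<alpha>) C" "PCmp (hom_into F C) g f = precomp_nat (PCmp F f g) C"
  "PIdn (hom_into F C) d = precomp_nat (PIdn F d) C"
  by (simp_all add: hom_into_def)

section \<open>Generators and relations of the colimit\<close>

text \<open>\<open>GF\<close> and \<open>GJ\<close> are the actions of arrows of \<open>F d\<close>
  and \<open>J d\<close>, with the other variable held fixed; \<open>GK\<close> and
  \<open>GKinv\<close> are the two directions of a coherence isomorphism.\<close>

datatype ('o, 'm, 'c, 'd, 'a, 'b) gen =
  GF 'o 'c 'b | GJ 'o 'd 'a | GK 'm 'c 'a | GKinv 'm 'c 'a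

text \<open>Typing facts with \<open>op2\<close> and the 2-category of categories unfolded, in the
  form of simp rules. As \<open>J\<close> is contravariant, \<open>P1 J u\<close> runs from the
  category at \<open>cod1 D u\<close> to that at \<open>dom1 D u\<close>, and for \<open>u\<close>
  after \<open>v\<close> the comparison cells are \<open>PCmp F u v\<close> but
  \<open>PCmp J v u\<close>.\<close>

locale weight_data =
  fixes D :: "('o, 'm, 'n) twocat"
    and J :: "('o, 'm, 'n, 'c, 'd) psfun_cat" and F :: "('o, 'm, 'n, 'a, 'b) psfun_cat"
  assumes D_dom [simp]: "u \<in> Cell1 D \<Longrightarrow> dom1 D u \<in> Cell0 D"
    and D_cod [simp]: "u \<in> Cell1 D \<Longrightarrow> cod1 D u \<in> Cell0 D"
    and D_id [simp]: "d \<in> Cell0 D \<Longrightarrow> id1 D d \<in> Cell1 D"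
      "d \<in> Cell0 D \<Longrightarrow> dom1 D (id1 D d) = d" "d \<in> Cell0 D \<Longrightarrow> cod1 D (id1 D d) = d"
    and D_cmp [simp]: "\<lbrakk>u \<in> Cell1 D; v \<in> Cell1 D; cod1 D v = dom1 D u\<rbrakk> \<Longrightarrow> cmp1 D u v \<in> Cell1 D"
      "\<lbrakk>u \<in> Cell1 D; v \<in> Cell1 D; cod1 D v = dom1 D u\<rbrakk> \<Longrightarrow> dom1 D (cmp1 D u v) = dom1 D v"
      "\<lbrakk>u \<in> Cell1 D; v \<in> Cell1 D; cod1 D v = dom1 D u\<rbrakk> \<Longrightarrow> cod1 D (cmp1 D u v) = cod1 D u"
    and D_2 [simp]: "\<alpha> \<in> Cell2 D \<Longrightarrow> src2 D \<alpha> \<in> Cell1 D" "\<alpha> \<in> Cell2 D \<Longrightarrow> trg2 D \<alpha> \<in> Cell1 D"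
      "\<alpha> \<in> Cell2 D \<Longrightarrow> dom1 D (trg2 D \<alpha>) = dom1 D (src2 D \<alpha>)"
      "\<alpha> \<in> Cell2 D \<Longrightarrow> cod1 D (trg2 D \<alpha>) = cod1 D (src2 D \<alpha>)"
    and J0 [simp]: "d \<in> Cell0 D \<Longrightarrow> category (P0 J d)"
    and J1 [simp]: "u \<in> Cell1 D \<Longrightarrow> cat_functor (P1 J u)"
      "u \<in> Cell1 D \<Longrightarrow> FDom (P1 J u) = P0 J (cod1 D u)" "u \<in> Cell1 D \<Longrightarrow> FCod (P1 J u) = P0 J (dom1 D u)"
    and J2 [simp]: "\<alpha> \<in> Cell2 D \<Longrightarrow> nat_trans (P2 J \<alpha>)"
      "\<alpha> \<in> Cell2 D \<Longrightarrow> NDom (P2 J \<alpha>) = P1 J (src2 D \<alpha>)" "\<alpha> \<in> Cell2 D \<Longrightarrow> NCod (P2 J \<alpha>) = P1 J (trg2 D \<alpha>)"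
    and JC [simp]: "\<lbrakk>u \<in> Cell1 D; v \<in> Cell1 D; cod1 D v = dom1 D u\<rbrakk> \<Longrightarrow> nat_trans (PCmp J v u)"
      "\<lbrakk>u \<in> Cell1 D; v \<in> Cell1 D; cod1 D v = dom1 D u\<rbrakk> \<Longrightarrow> NDom (PCmp J v u) = comp_func (P1 J v) (P1 J u)"
      "\<lbrakk>u \<in> Cell1 D; v \<in> Cell1 D; cod1 D v = dom1 D u\<rbrakk> \<Longrightarrow> NCod (PCmp J v u) = P1 J (cmp1 D u v)"
    and JI [simp]: "d \<in> Cell0 D \<Longrightarrow> nat_trans (PIdn J d)"
      "d \<in> Cell0 D \<Longrightarrow> NDom (PIdn J d) = id_func (P0 J d)" "d \<in> Cell0 D \<Longrightarrow> NCod (PIdn J d) = P1 J (id1 D d)"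
    and F0 [simp]: "d \<in> Cell0 D \<Longrightarrow> category (P0 F d)"
    and F1 [simp]: "u \<in> Cell1 D \<Longrightarrow> cat_functor (P1 F u)"
      "u \<in> Cell1 D \<Longrightarrow> FDom (P1 F u) = P0 F (dom1 D u)" "u \<in> Cell1 D \<Longrightarrow> FCod (P1 F u) = P0 F (cod1 D u)"
    and F2 [simp]: "\<alpha> \<in> Cell2 D \<Longrightarrow> nat_trans (P2 F \<alpha>)"
      "\<alpha> \<in> Cell2 D \<Longrightarrow> NDom (P2 F \<alpha>) = P1 F (src2 D \<alpha>)" "\<alpha> \<in> Cell2 D \<Longrightarrow> NCod (P2 F \<alpha>) = P1 F (trg2 D \<alpha>)"
    and FC [simp]: "\<lbrakk>u \<in> Cell1 D; v \<in> Cell1 D; cod1 D v = dom1 D u\<rbrakk> \<Longrightarrow> nat_trans (PCmp F u v)"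
      "\<lbrakk>u \<in> Cell1 D; v \<in> Cell1 D; cod1 D v = dom1 D u\<rbrakk> \<Longrightarrow> NDom (PCmp F u v) = comp_func (P1 F u) (P1 F v)"
      "\<lbrakk>u \<in> Cell1 D; v \<in> Cell1 D; cod1 D v = dom1 D u\<rbrakk> \<Longrightarrow> NCod (PCmp F u v) = P1 F (cmp1 D u v)"
    and FI [simp]: "d \<in> Cell0 D \<Longrightarrow> nat_trans (PIdn F d)"
      "d \<in> Cell0 D \<Longrightarrow> NDom (PIdn F d) = id_func (P0 F d)" "d \<in> Cell0 D \<Longrightarrow> NCod (PIdn F d) = P1 F (id1 D d)"
begin

definition gen_obs :: "('o \<times> 'c \<times> 'a) set" where
  "gen_obs = (SIGMA d : Cell0 D. Obj (P0 J d) \<times> Obj (P0 F d))"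

definition gens :: "('o, 'm, 'c, 'd, 'a, 'b) gen set" where
  "gens = {\<gamma>. case \<gamma> of
      GF d x \<psi> \<Rightarrow> d \<in> Cell0 D \<and> x \<in> Obj (P0 J d) \<and> \<psi> \<in> Arr (P0 F d)
    | GJ d \<phi> a \<Rightarrow> d \<in> Cell0 D \<and> \<phi> \<in> Arr (P0 J d) \<and> a \<in> Obj (P0 F d)
    | GK u x a \<Rightarrow> u \<in> Cell1 D \<and> x \<in> Obj (P0 J (cod1 D u)) \<and> a \<in> Obj (P0 F (dom1 D u))
    | GKinv u x a \<Rightarrow> u \<in> Cell1 D \<and> x \<in> Obj (P0 J (cod1 D u)) \<and> a \<in> Obj (P0 F (dom1 D u))}"

primrec gen_src :: "('o, 'm, 'c, 'd, 'a, 'b) gen \<Rightarrow> 'o \<times> 'c \<times> 'a" where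
  "gen_src (GF d x \<psi>) = (d, x, Dom (P0 F d) \<psi>)"
| "gen_src (GJ d \<phi> a) = (d, Dom (P0 J d) \<phi>, a)"
| "gen_src (GK u x a) = (cod1 D u, x, FOb (P1 F u) a)"
| "gen_src (GKinv u x a) = (dom1 D u, FOb (P1 J u) x, a)"

primrec gen_trg :: "('o, 'm, 'c, 'd, 'a, 'b) gen \<Rightarrow> 'o \<times> 'c \<times> 'a" where
  "gen_trg (GF d x \<psi>) = (d, x, Cod (P0 F d) \<psi>)"
| "gen_trg (GJ d \<phi> a) = (d, Cod (P0 J d) \<phi>, a)"
| "gen_trg (GK u x a) = (dom1 D u, FOb (P1 J u) x, a)"
| "gen_trg (GKinv u x a) = (cod1 D u, x, FOb (P1 F u) a)"

lemma gen_obs_iff [simp]: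
  "(d, x, a) \<in> gen_obs \<longleftrightarrow> d \<in> Cell0 D \<and> x \<in> Obj (P0 J d) \<and> a \<in> Obj (P0 F d)"
  by (auto simp: gen_obs_def)

lemma gens_iff [simp]:
  "GF d x \<psi> \<in> gens \<longleftrightarrow> d \<in> Cell0 D \<and> x \<in> Obj (P0 J d) \<and> \<psi> \<in> Arr (P0 F d)"
  "GJ d \<phi> a \<in> gens \<longleftrightarrow> d \<in> Cell0 D \<and> \<phi> \<in> Arr (P0 J d) \<and> a \<in> Obj (P0 F d)"
  "GK u x a \<in> gens \<longleftrightarrow> u \<in> Cell1 D \<and> x \<in> Obj (P0 J (cod1 D u)) \<and> a \<in> Obj (P0 F (dom1 D u))"
  "GKinv u x a \<in> gens \<longleftrightarrow> u \<in> Cell1 D \<and> x \<in> Obj (P0 J (cod1 D u)) \<and> a \<in> Obj (P0 F (dom1 D u))"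
  by (auto simp: gens_def)

lemma gen_src_trg: "\<gamma> \<in> gens \<Longrightarrow> gen_src \<gamma> \<in> gen_obs \<and> gen_trg \<gamma> \<in> gen_obs"
  by (cases \<gamma>) auto

end

text \<open>The axioms of a pseudo natural transformation from \<open>J\<close> to Cat(F-,C),
  uncurried into equations of arrows of \<open>C\<close>. \<open>F_Idn\<close> to
  \<open>J_Cmp\<close> are functoriality in each variable, and \<open>FJ\<close> is naturality of
  the action of \<phi>. \<open>K_F\<close> and \<open>K_J\<close> are naturality of a coherence cell
  in \<open>a\<close> and in \<open>x\<close>. \<open>K_2\<close>, \<open>K_Cmp\<close> and
  \<open>K_Idn\<close> are \<open>S1_natural\<close>, \<open>S1_cmp\<close> and
  \<open>S1_id\<close>, where the 2-cells belonging to \<open>F\<close> act through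
  \<open>GF\<close> and those belonging to \<open>J\<close> through \<open>GJ\<close>.\<close>

locale cocone = weight_data D J F
  for D :: "('o, 'm, 'n) twocat"
    and J :: "('o, 'm, 'n, 'c, 'd) psfun_cat" and F :: "('o, 'm, 'n, 'a, 'b) psfun_cat" +
  fixes C :: "('p, 'q) cat" and ob :: "'o \<times> 'c \<times> 'a \<Rightarrow> 'p" and ar :: "('o, 'm, 'c, 'd, 'a, 'b) gen \<Rightarrow> 'q"
  assumes C [simp]: "category C"
    and ob [simp]: "p \<in> gen_obs \<Longrightarrow> ob p \<in> Obj C"
    and ar [simp]: "\<gamma> \<in> gens \<Longrightarrow> ar \<gamma> \<in> Arr C" "\<gamma> \<in> gens \<Longrightarrow> Dom C (ar \<gamma>) = ob (gen_src \<gamma>)"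
      "\<gamma> \<in> gens \<Longrightarrow> Cod C (ar \<gamma>) = ob (gen_trg \<gamma>)"
    and F_Idn [simp]: "\<lbrakk>d \<in> Cell0 D; x \<in> Obj (P0 J d); a \<in> Obj (P0 F d)\<rbrakk>
      \<Longrightarrow> ar (GF d x (Idn (P0 F d) a)) = Idn C (ob (d, x, a))"
    and F_Cmp [simp]: "\<lbrakk>d \<in> Cell0 D; x \<in> Obj (P0 J d); \<psi> \<in> Arr (P0 F d); \<psi>' \<in> Arr (P0 F d);
        Dom (P0 F d) \<psi>' = Cod (P0 F d) \<psi>\<rbrakk>
      \<Longrightarrow> ar (GF d x (Cmp (P0 F d) \<psi>' \<psi>)) = Cmp C (ar (GF d x \<psi>')) (ar (GF d x \<psi>))"
    and J_Idn [simp]: "\<lbrakk>d \<in> Cell0 D; x \<in> Obj (P0 J d); a \<in> Obj (P0 F d)\<rbrakk>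
      \<Longrightarrow> ar (GJ d (Idn (P0 J d) x) a) = Idn C (ob (d, x, a))"
    and J_Cmp [simp]: "\<lbrakk>d \<in> Cell0 D; a \<in> Obj (P0 F d); \<phi> \<in> Arr (P0 J d); \<phi>' \<in> Arr (P0 J d);
        Dom (P0 J d) \<phi>' = Cod (P0 J d) \<phi>\<rbrakk>
      \<Longrightarrow> ar (GJ d (Cmp (P0 J d) \<phi>' \<phi>) a) = Cmp C (ar (GJ d \<phi>' a)) (ar (GJ d \<phi> a))"
    and FJ: "\<lbrakk>d \<in> Cell0 D; \<phi> \<in> Arr (P0 J d); \<psi> \<in> Arr (P0 F d)\<rbrakk>
      \<Longrightarrow> Cmp C (ar (GF d (Cod (P0 J d) \<phi>) \<psi>)) (ar (GJ d \<phi> (Dom (P0 F d) \<psi>)))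
        = Cmp C (ar (GJ d \<phi> (Cod (P0 F d) \<psi>))) (ar (GF d (Dom (P0 J d) \<phi>) \<psi>))"
    and K_inv: "\<lbrakk>u \<in> Cell1 D; x \<in> Obj (P0 J (cod1 D u)); a \<in> Obj (P0 F (dom1 D u))\<rbrakk>
      \<Longrightarrow> Cmp C (ar (GKinv u x a)) (ar (GK u x a)) = Idn C (ob (cod1 D u, x, FOb (P1 F u) a))"
      "\<lbrakk>u \<in> Cell1 D; x \<in> Obj (P0 J (cod1 D u)); a \<in> Obj (P0 F (dom1 D u))\<rbrakk>
      \<Longrightarrow> Cmp C (ar (GK u x a)) (ar (GKinv u x a)) = Idn C (ob (dom1 D u, FOb (P1 J u) x, a))"
    and K_J: "\<lbrakk>u \<in> Cell1 D; \<phi> \<in> Arr (P0 J (cod1 D u)); a \<in> Obj (P0 F (dom1 D u))\<rbrakk>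
      \<Longrightarrow> Cmp C (ar (GK u (Cod (P0 J (cod1 D u)) \<phi>) a)) (ar (GJ (cod1 D u) \<phi> (FOb (P1 F u) a)))
        = Cmp C (ar (GJ (dom1 D u) (FAr (P1 J u) \<phi>) a)) (ar (GK u (Dom (P0 J (cod1 D u)) \<phi>) a))"
    and K_F: "\<lbrakk>u \<in> Cell1 D; x \<in> Obj (P0 J (cod1 D u)); \<psi> \<in> Arr (P0 F (dom1 D u))\<rbrakk>
      \<Longrightarrow> Cmp C (ar (GK u x (Cod (P0 F (dom1 D u)) \<psi>))) (ar (GF (cod1 D u) x (FAr (P1 F u) \<psi>)))
        = Cmp C (ar (GF (dom1 D u) (FOb (P1 J u) x) \<psi>)) (ar (GK u x (Dom (P0 F (dom1 D u)) \<psi>)))"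
    and K_2: "\<lbrakk>\<alpha> \<in> Cell2 D; x \<in> Obj (P0 J (cod1 D (src2 D \<alpha>))); a \<in> Obj (P0 F (dom1 D (src2 D \<alpha>)))\<rbrakk>
      \<Longrightarrow> Cmp C (ar (GK (trg2 D \<alpha>) x a)) (ar (GF (cod1 D (src2 D \<alpha>)) x (NT (P2 F \<alpha>) a)))
        = Cmp C (ar (GJ (dom1 D (src2 D \<alpha>)) (NT (P2 J \<alpha>) x) a)) (ar (GK (src2 D \<alpha>) x a))"
    and K_Cmp: "\<lbrakk>u \<in> Cell1 D; v \<in> Cell1 D; cod1 D v = dom1 D u; x \<in> Obj (P0 J (cod1 D u));
        a \<in> Obj (P0 F (dom1 D v))\<rbrakk>
      \<Longrightarrow> Cmp C (ar (GK (cmp1 D u v) x a)) (ar (GF (cod1 D u) x (NT (PCmp F u v) a)))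
        = Cmp C (ar (GJ (dom1 D v) (NT (PCmp J v u) x) a))
            (Cmp C (ar (GK v (FOb (P1 J u) x) a)) (ar (GK u x (FOb (P1 F v) a))))"
    and K_Idn: "\<lbrakk>d \<in> Cell0 D; x \<in> Obj (P0 J d); a \<in> Obj (P0 F d)\<rbrakk>
      \<Longrightarrow> Cmp C (ar (GK (id1 D d) x a)) (ar (GF d x (NT (PIdn F d) a))) = ar (GJ d (NT (PIdn J d) x) a)"

section \<open>From cocones to pseudo natural transformations\<close>

context weight_data
begin

text \<open>\<open>mk_F\<close>, \<open>mk_S0\<close> and \<open>mk_S1\<close> curry the cocone
  again. Its value on \<open>GKinv\<close> survives only as the invertibility of
  \<open>mk_S1\<close>.\<close>

definition mk_F :: "('p, 'q) cat \<Rightarrow> ('o \<times> 'c \<times> 'a \<Rightarrow> 'p) \<Rightarrow> (('o, 'm, 'c, 'd, 'a, 'b) gen \<Rightarrow> 'q) \<Rightarrow>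
    'o \<Rightarrow> 'c \<Rightarrow> ('a, 'b, 'p, 'q) func" where
  "mk_F C ob ar d x = \<lparr>FDom = P0 F d, FCod = C, FOb = (\<lambda>a\<in>Obj (P0 F d). ob (d, x, a)),
     FAr = (\<lambda>\<psi>\<in>Arr (P0 F d). ar (GF d x \<psi>))\<rparr>"

definition mk_S0 :: "('p, 'q) cat \<Rightarrow> ('o \<times> 'c \<times> 'a \<Rightarrow> 'p) \<Rightarrow> (('o, 'm, 'c, 'd, 'a, 'b) gen \<Rightarrow> 'q) \<Rightarrow>
    'o \<Rightarrow> ('c, 'd, ('a, 'b, 'p, 'q) func, ('a, 'b, 'p, 'q) natt) func" where
  "mk_S0 C ob ar d = \<lparr>FDom = P0 J d, FCod = functor_cat (P0 F d) C,
     FOb = (\<lambda>x\<in>Obj (P0 J d). mk_F C ob ar d x),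
     FAr = (\<lambda>\<phi>\<in>Arr (P0 J d). \<lparr>NDom = mk_F C ob ar d (Dom (P0 J d) \<phi>), NCod = mk_F C ob ar d (Cod (P0 J d) \<phi>),
       NT = (\<lambda>a\<in>Obj (P0 F d). ar (GJ d \<phi> a))\<rparr>)\<rparr>"

definition mk_S1 :: "('p, 'q) cat \<Rightarrow> ('o \<times> 'c \<times> 'a \<Rightarrow> 'p) \<Rightarrow> (('o, 'm, 'c, 'd, 'a, 'b) gen \<Rightarrow> 'q) \<Rightarrow>
    'm \<Rightarrow> ('c, 'd, ('a, 'b, 'p, 'q) func, ('a, 'b, 'p, 'q) natt) natt" where
  "mk_S1 C ob ar u = \<lparr>NDom = comp_func (precomp_func (P1 F u) C) (mk_S0 C ob ar (cod1 D u)),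
     NCod = comp_func (mk_S0 C ob ar (dom1 D u)) (P1 J u),
     NT = (\<lambda>x\<in>Obj (P0 J (cod1 D u)). \<lparr>NDom = comp_func (mk_F C ob ar (cod1 D u) x) (P1 F u),
       NCod = mk_F C ob ar (dom1 D u) (FOb (P1 J u) x), NT = (\<lambda>a\<in>Obj (P0 F (dom1 D u)). ar (GK u x a))\<rparr>)\<rparr>"

definition mk_psnat :: "('p, 'q) cat \<Rightarrow> ('o \<times> 'c \<times> 'a \<Rightarrow> 'p) \<Rightarrow> (('o, 'm, 'c, 'd, 'a, 'b) gen \<Rightarrow> 'q) \<Rightarrow>
    ('o, 'm, 'c, 'd, ('a, 'b, 'p, 'q) func, ('a, 'b, 'p, 'q) natt) psnat" where
  "mk_psnat C ob ar = \<lparr>S0 = (\<lambda>d\<in>Cell0 D. mk_S0 C ob ar d), S1 = (\<lambda>u\<in>Cell1 D. mk_S1 C ob ar u)\<rparr>"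

lemma mk_F_simps [simp]:
  "FDom (mk_F C ob ar d x) = P0 F d" "FCod (mk_F C ob ar d x) = C"
  "a \<in> Obj (P0 F d) \<Longrightarrow> FOb (mk_F C ob ar d x) a = ob (d, x, a)"
  "\<psi> \<in> Arr (P0 F d) \<Longrightarrow> FAr (mk_F C ob ar d x) \<psi> = ar (GF d x \<psi>)"
  by (simp_all add: mk_F_def)

lemma mk_S0_simps [simp]:
  "FDom (mk_S0 C ob ar d) = P0 J d" "FCod (mk_S0 C ob ar d) = functor_cat (P0 F d) C"
  "x \<in> Obj (P0 J d) \<Longrightarrow> FOb (mk_S0 C ob ar d) x = mk_F C ob ar d x"
  "\<phi> \<in> Arr (P0 J d) \<Longrightarrow> NDom (FAr (mk_S0 C ob ar d) \<phi>) = mk_F C ob ar d (Dom (P0 J d) \<phi>)"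
  "\<phi> \<in> Arr (P0 J d) \<Longrightarrow> NCod (FAr (mk_S0 C ob ar d) \<phi>) = mk_F C ob ar d (Cod (P0 J d) \<phi>)"
  "\<phi> \<in> Arr (P0 J d) \<Longrightarrow> a \<in> Obj (P0 F d) \<Longrightarrow> NT (FAr (mk_S0 C ob ar d) \<phi>) a = ar (GJ d \<phi> a)"
  by (simp_all add: mk_S0_def)

lemma mk_S1_simps [simp]:
  "NDom (mk_S1 C ob ar u) = comp_func (precomp_func (P1 F u) C) (mk_S0 C ob ar (cod1 D u))"
  "NCod (mk_S1 C ob ar u) = comp_func (mk_S0 C ob ar (dom1 D u)) (P1 J u)"
  "x \<in> Obj (P0 J (cod1 D u)) \<Longrightarrow> NDom (NT (mk_S1 C ob ar u) x) = comp_func (mk_F C ob ar (cod1 D u) x) (P1 F u)"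
  "x \<in> Obj (P0 J (cod1 D u)) \<Longrightarrow> NCod (NT (mk_S1 C ob ar u) x) = mk_F C ob ar (dom1 D u) (FOb (P1 J u) x)"
  "x \<in> Obj (P0 J (cod1 D u)) \<Longrightarrow> a \<in> Obj (P0 F (dom1 D u)) \<Longrightarrow> NT (NT (mk_S1 C ob ar u) x) a = ar (GK u x a)"
  by (simp_all add: mk_S1_def)

lemma mk_psnat_simps [simp]:
  "d \<in> Cell0 D \<Longrightarrow> S0 (mk_psnat C ob ar) d = mk_S0 C ob ar d"
  "u \<in> Cell1 D \<Longrightarrow> S1 (mk_psnat C ob ar) u = mk_S1 C ob ar u"
  by (simp_all add: mk_psnat_def)

end

context cocone
begin

abbreviation "cF \<equiv> mk_F C ob ar"
abbreviation "cS0 \<equiv> mk_S0 C ob ar"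
abbreviation "cS1 \<equiv> mk_S1 C ob ar"

lemma cat_functor_mk_F [simp]: "\<lbrakk>d \<in> Cell0 D; x \<in> Obj (P0 J d)\<rbrakk> \<Longrightarrow> cat_functor (cF d x)"
  unfolding mk_F_def by (rule cat_functorI) simp_all

lemma nat_trans_mk_J [simp]: "\<lbrakk>d \<in> Cell0 D; \<phi> \<in> Arr (P0 J d)\<rbrakk> \<Longrightarrow> nat_trans (FAr (cS0 d) \<phi>)"
  unfolding mk_S0_def by simp (rule nat_transI; simp add: FJ)

lemma cat_functor_mk_S0 [simp]: "d \<in> Cell0 D \<Longrightarrow> cat_functor (cS0 d)"
  unfolding mk_S0_def
proof (rule cat_functorI, goal_cases)
  case (5 x)
  then show ?case by (intro nat_eqI) (auto intro!: nat_transI)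
next
  case (6 f g)
  then show ?case
    using nat_trans_mk_J[of d f] nat_trans_mk_J[of d g] nat_trans_mk_J[of d "Cmp (P0 J d) g f"]
    by (intro nat_eqI) (simp_all add: mk_S0_def)
next
  case (4 f)
  then show ?case using nat_trans_mk_J[of d f] by (simp add: mk_S0_def)
qed simp_all

lemma nat_trans_mk_K [simp]:
  "\<lbrakk>u \<in> Cell1 D; x \<in> Obj (P0 J (cod1 D u))\<rbrakk> \<Longrightarrow> nat_trans (NT (cS1 u) x)"
  unfolding mk_S1_def by simp (rule nat_transI; simp add: K_F)

lemma nat_trans_mk_S1 [simp]: "u \<in> Cell1 D \<Longrightarrow> nat_trans (cS1 u)"
proof -
  assume u: "u \<in> Cell1 D"
  let ?t = "\<lambda>x. \<lparr>NDom = comp_func (cF (cod1 D u) x) (P1 F u),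
       NCod = cF (dom1 D u) (FOb (P1 J u) x), NT = (\<lambda>a\<in>Obj (P0 F (dom1 D u)). ar (GK u x a))\<rparr>"
  have t: "nat_trans (?t x)" if "x \<in> Obj (P0 J (cod1 D u))" for x
    using nat_trans_mk_K[OF u that] that by (simp add: mk_S1_def)
  show ?thesis unfolding mk_S1_def
  proof (rule nat_transI, goal_cases)
    case (7 f)
    then show ?case using u by (simp, intro nat_eqI) (simp_all add: t K_J)
  qed (use u t in simp_all)
qed

text \<open>Compared entrywise by \<open>nat2_eqI\<close>, the coherence axioms become
  \<open>K_2\<close>, \<open>K_Cmp\<close> and \<open>K_Idn\<close>. For invertibility two layers of
  components are peeled off, down to arrows of \<open>C\<close> whose inverses are the values on
  \<open>GKinv\<close>.\<close>

lemma pseudo_nat_mk_psnat: "pseudo_nat (op2 D) J (hom_into F C) (mk_psnat C ob ar)"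
proof (rule pseudo_nat.intro, goal_cases)
  case (1)
  then show ?case by (simp add: mk_psnat_def)
next
  case (2)
  then show ?case by (simp add: mk_psnat_def)
next
  case (4 u)
  then have u: "u \<in> Cell1 D" by simp
  have "invertible (functor_cat (P0 J (cod1 D u)) (functor_cat (P0 F (dom1 D u)) C)) (cS1 u)"
  proof (intro invertible_functor_cat)
    fix x a assume x: "x \<in> Obj (P0 J (cod1 D u))" and a: "a \<in> Obj (P0 F (dom1 D u))"
    show "invertible C (NT (NT (cS1 u) x) a)"
      unfolding invertible_def using u x a
      by (intro conjI bexI[of _ "ar (GKinv u x a)"]) (simp_all add: K_inv)
  qed (use u in simp_all)
  then show ?case using u by simp
next
  case (7 \<alpha>)
  then show ?case
    by simp (rule nat2_eqI[where A = "P0 F (dom1 D (src2 D \<alpha>))" and B = C]; simp add: K_2)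
next
  case (8 u v)
  then show ?case
    by simp (rule nat2_eqI[where A = "P0 F (dom1 D v)" and B = C]; simp add: K_Cmp)
next
  case (9 d)
  then show ?case
    by simp (rule nat2_eqI[where A = "P0 F d" and B = C]; simp add: K_Idn)
qed simp_all

end

lemma psnat_eqI:
  fixes \<sigma> \<tau> :: "('o, 'm, 'p, 'q, 'r, 's) psnat"
  assumes "S0 \<sigma> \<in> extensional A" "S0 \<tau> \<in> extensional A" "S1 \<sigma> \<in> extensional B" "S1 \<tau> \<in> extensional B"
    and "\<And>d. d \<in> A \<Longrightarrow> S0 \<sigma> d = S0 \<tau> d" "\<And>u. u \<in> B \<Longrightarrow> S1 \<sigma> u = S1 \<tau> u"
  shows "\<sigma> = \<tau>"
proof -
  have "S0 \<sigma> = S0 \<tau>" by (rule extensionalityI[OF assms(1,2)]) (rule assms(5))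
  moreover have "S1 \<sigma> = S1 \<tau>" by (rule extensionalityI[OF assms(3,4)]) (rule assms(6))
  ultimately show ?thesis by simp
qed

text \<open>Composition on the two sides commutes strictly, by associativity. This is why an
  identity can serve as coherence cell of Cat(F-,H): its domain is also the required
  codomain.\<close>

lemma postcomp_precomp_commute:
  "\<lbrakk>cat_functor U; cat_functor H\<rbrakk> \<Longrightarrow>
    comp_func (precomp_func U (FCod H)) (postcomp_func (FCod U) H)
    = comp_func (postcomp_func (FDom U) H) (precomp_func U (FDom H))"
  by (rule func_eqI) (auto intro!: nat_eqI)

section \<open>From pseudo natural transformations back to cocones\<close>

context weight_data
begin

definition ob_of :: "('o, 'm, 'c, 'd, ('a, 'b, 'p, 'q) func, ('a, 'b, 'p, 'q) natt) psnat
    \<Rightarrow> 'o \<times> 'c \<times> 'a \<Rightarrow> 'p" where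
  "ob_of \<sigma> = (\<lambda>(d, x, a). FOb (FOb (S0 \<sigma> d) x) a)"

primrec ar_of :: "('p, 'q) cat \<Rightarrow> ('o, 'm, 'c, 'd, ('a, 'b, 'p, 'q) func, ('a, 'b, 'p, 'q) natt) psnat
    \<Rightarrow> ('o, 'm, 'c, 'd, 'a, 'b) gen \<Rightarrow> 'q" where
  "ar_of C \<sigma> (GF d x \<psi>) = FAr (FOb (S0 \<sigma> d) x) \<psi>"
| "ar_of C \<sigma> (GJ d \<phi> a) = NT (FAr (S0 \<sigma> d) \<phi>) a"
| "ar_of C \<sigma> (GK u x a) = NT (NT (S1 \<sigma> u) x) a"
| "ar_of C \<sigma> (GKinv u x a) = inverse_arrow C (NT (NT (S1 \<sigma> u) x) a)"

lemma ob_of_simp [simp]: "ob_of \<sigma> (d, x, a) = FOb (FOb (S0 \<sigma> d) x) a"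
  by (simp add: ob_of_def)

text \<open>Currying after uncurrying returns \<sigma> itself, not merely an isomorphic
  transformation, because \<sigma> and all functors and transformations inside it are
  extensional.\<close>

lemma cocone_of_pseudo_nat:
  assumes C: "category C" and \<sigma>: "pseudo_nat (op2 D) J (hom_into F C) \<sigma>"
  shows "cocone D J F C (ob_of \<sigma>) (ar_of C \<sigma>)"
    and "mk_psnat C (ob_of \<sigma>) (ar_of C \<sigma>) = \<sigma>"
proof -
  interpret s: pseudo_nat "op2 D" J "hom_into F C" \<sigma> by (fact \<sigma>)
  note [simp] = C
  have S0 [simp]: "cat_functor (S0 \<sigma> d)" "FDom (S0 \<sigma> d) = P0 J d" "FCod (S0 \<sigma> d) = functor_cat (P0 F d) C"
    if "d \<in> Cell0 D" for d
    using s.S0_in[of d] that by simp_all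
  have S0x [simp]: "cat_functor (FOb (S0 \<sigma> d) x)" "FDom (FOb (S0 \<sigma> d) x) = P0 F d" "FCod (FOb (S0 \<sigma> d) x) = C"
    if "d \<in> Cell0 D" "x \<in> Obj (P0 J d)" for d x
    using functor_FOb_in[OF S0(1)[OF that(1)] refl, of x] that by simp_all
  have S0f [simp]: "nat_trans (FAr (S0 \<sigma> d) \<phi>)" "NDom (FAr (S0 \<sigma> d) \<phi>) = FOb (S0 \<sigma> d) (Dom (P0 J d) \<phi>)"
      "NCod (FAr (S0 \<sigma> d) \<phi>) = FOb (S0 \<sigma> d) (Cod (P0 J d) \<phi>)"
    if "d \<in> Cell0 D" "\<phi> \<in> Arr (P0 J d)" for d \<phi>
    using functor_FAr_in[OF S0(1)[OF that(1)] refl, of \<phi>] functor_Dom[OF S0(1)[OF that(1)] refl, of \<phi>]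
      functor_Cod[OF S0(1)[OF that(1)] refl, of \<phi>] that by simp_all
  have S1d [simp]: "NDom (S1 \<sigma> u) = comp_func (precomp_func (P1 F u) C) (S0 \<sigma> (cod1 D u))"
      "NCod (S1 \<sigma> u) = comp_func (S0 \<sigma> (dom1 D u)) (P1 J u)" if "u \<in> Cell1 D" for u
    using s.S1_NDom[of u] s.S1_NCod[of u] that by simp_all
  have S1i: "invertible (functor_cat (P0 J (cod1 D u)) (functor_cat (P0 F (dom1 D u)) C)) (S1 \<sigma> u)"
    if "u \<in> Cell1 D" for u using s.S1_invertible[of u] that by simp
  have S1n [simp]: "nat_trans (S1 \<sigma> u)" if "u \<in> Cell1 D" for u
    using S1i[OF that] by (simp add: invertible_def)
  have S1x [simp]: "nat_trans (NT (S1 \<sigma> u) x)"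
      "NDom (NT (S1 \<sigma> u) x) = comp_func (FOb (S0 \<sigma> (cod1 D u)) x) (P1 F u)"
      "NCod (NT (S1 \<sigma> u) x) = FOb (S0 \<sigma> (dom1 D u)) (FOb (P1 J u) x)"
    if "u \<in> Cell1 D" "x \<in> Obj (P0 J (cod1 D u))" for u x
    using nat_NT_in[OF S1n[OF that(1)] refl, of x] nat_NT_Dom[OF S1n[OF that(1)] refl, of x]
      nat_NT_Cod[OF S1n[OF that(1)] refl, of x] that by simp_all
  have S1xi: "invertible C (NT (NT (S1 \<sigma> u) x) a)"
    if "u \<in> Cell1 D" "x \<in> Obj (P0 J (cod1 D u))" "a \<in> Obj (P0 F (dom1 D u))" for u x a
    using invertible_functor_catD[OF invertible_functor_catD[OF S1i]] that by blast
  note inv [simp] = inverse_arrow[OF S1xi]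
  show cc: "cocone D J F C (ob_of \<sigma>) (ar_of C \<sigma>)"
  \<comment> \<open>Goals 10 and 13 to 17 are \<open>FJ\<close>, \<open>K_J\<close>,
    \<open>K_F\<close>, \<open>K_2\<close>, \<open>K_Cmp\<close> and \<open>K_Idn\<close>. Each is
    one naturality or coherence axiom of \<sigma>, evaluated at the given objects or arrows.\<close>
  proof (intro cocone.intro weight_data_axioms cocone_axioms.intro, goal_cases)
    case (2 p)
    then show ?case by (cases p) simp
  next
    case (3 \<gamma>)
    then show ?case by (cases \<gamma>) simp_all
  next
    case (4 \<gamma>)
    then show ?case by (cases \<gamma>) simp_all
  next
    case (5 \<gamma>)
    then show ?case by (cases \<gamma>) simp_all
  next
    case (10 d \<phi> \<psi>)
    then show ?case using nat_trans.naturality[of "FAr (S0 \<sigma> d) \<phi>" \<psi>] by simp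
  next
    case (13 u \<phi> a)
    then show ?case
      using arg_cong[OF nat_trans.naturality[of "S1 \<sigma> u" \<phi>], of "\<lambda>\<alpha>. NT \<alpha> a"] by simp
  next
    case (14 u x \<psi>)
    then show ?case using nat_trans.naturality[of "NT (S1 \<sigma> u) x" \<psi>] by simp
  next
    case (15 \<alpha> x a)
    then show ?case
      using arg_cong[OF s.S1_natural[of \<alpha>], of "\<lambda>\<alpha>. NT (NT \<alpha> x) a"] by simp
  next
    case (16 u v x a)
    then show ?case
      using arg_cong[OF s.S1_cmp[of u v], of "\<lambda>\<alpha>. NT (NT \<alpha> x) a"] by simp
  next
    case (17 d x a)
    then show ?case
      using arg_cong[OF s.S1_id[of d], of "\<lambda>\<alpha>. NT (NT \<alpha> x) a"] by simp
  qed simp_all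
  interpret cocone D J F C "ob_of \<sigma>" "ar_of C \<sigma>" by (fact cc)
  have F: "cF d x = FOb (S0 \<sigma> d) x" if "d \<in> Cell0 D" "x \<in> Obj (P0 J d)" for d x
    by (rule func_eqI) (use that in simp_all)
  have S0: "cS0 d = S0 \<sigma> d" if "d \<in> Cell0 D" for d
  proof (rule func_eqI)
    show "FAr (cS0 d) f = FAr (S0 \<sigma> d) f" if "f \<in> Arr (FDom (S0 \<sigma> d))" for f
      by (rule nat_eqI) (use that \<open>d \<in> Cell0 D\<close> in \<open>simp_all add: F\<close>)
  qed (use that in \<open>simp_all add: F\<close>)
  have S1: "cS1 u = S1 \<sigma> u" if "u \<in> Cell1 D" for u
    by (rule nat2_eqI[where A = "P0 F (dom1 D u)" and B = C]; use that in \<open>simp add: S0\<close>)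
  show "mk_psnat C (ob_of \<sigma>) (ar_of C \<sigma>) = \<sigma>"
    by (rule psnat_eqI[of _ "Cell0 D" _ "Cell1 D"])
      (use s.S0_ext s.S1_ext in \<open>simp_all add: S0 S1\<close>, simp_all add: mk_psnat_def)
qed

lemma mk_psnat_cong:
  assumes ob: "\<And>p. p \<in> gen_obs \<Longrightarrow> ob p = ob' p" and ar: "\<And>\<gamma>. \<gamma> \<in> gens \<Longrightarrow> ar \<gamma> = ar' \<gamma>"
  shows "mk_psnat C ob ar = mk_psnat C ob' ar'"
proof -
  have F: "mk_F C ob ar d x = mk_F C ob' ar' d x" if "d \<in> Cell0 D" "x \<in> Obj (P0 J d)" for d x
    using that by (simp add: mk_F_def ob ar cong: restrict_cong)
  have S0: "mk_S0 C ob ar d = mk_S0 C ob' ar' d" if "d \<in> Cell0 D" for d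
    using that by (simp add: mk_S0_def F ar cong: restrict_cong)
  have "mk_S1 C ob ar u = mk_S1 C ob' ar' u" if "u \<in> Cell1 D" for u
    using that by (simp add: mk_S1_def S0 F ar cong: restrict_cong)
  with S0 show ?thesis by (simp add: mk_psnat_def cong: restrict_cong)
qed

text \<open>Values on objects and on \<open>GF\<close>, \<open>GJ\<close> and \<open>GK\<close> are
  read off from the transformation by evaluation. Those on \<open>GKinv\<close> are inverses of
  entries and thus determined by them.\<close>

lemma mk_psnat_inject:
  assumes "cocone D J F C ob ar" "cocone D J F C ob' ar'" "mk_psnat C ob ar = mk_psnat C ob' ar'"
  shows "\<And>p. p \<in> gen_obs \<Longrightarrow> ob p = ob' p" and "\<And>\<gamma>. \<gamma> \<in> gens \<Longrightarrow> ar \<gamma> = ar' \<gamma>"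
proof -
  interpret c: cocone D J F C ob ar by fact
  interpret c': cocone D J F C ob' ar' by fact
  have ob: "ob (d, x, a) = ob' (d, x, a)" if "(d, x, a) \<in> gen_obs" for d x a
    using that arg_cong[OF assms(3), of "\<lambda>\<sigma>. FOb (FOb (S0 \<sigma> d) x) a"] by simp
  then show ob': "ob p = ob' p" if "p \<in> gen_obs" for p using that by (cases p) simp
  have K: "ar (GK u x a) = ar' (GK u x a)" if "GK u x a \<in> gens" for u x a
    using that arg_cong[OF assms(3), of "\<lambda>\<sigma>. NT (NT (S1 \<sigma> u) x) a"] by simp
  show "ar \<gamma> = ar' \<gamma>" if \<gamma>: "\<gamma> \<in> gens" for \<gamma>
  proof (cases \<gamma>)
    case (GF d x \<psi>)
    then show ?thesis using \<gamma> arg_cong[OF assms(3), of "\<lambda>\<sigma>. FAr (FOb (S0 \<sigma> d) x) \<psi>"] by simp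
  next
    case (GJ d \<phi> a)
    then show ?thesis using \<gamma> arg_cong[OF assms(3), of "\<lambda>\<sigma>. NT (FAr (S0 \<sigma> d) \<phi>) a"] by simp
  next
    case (GK u x a)
    then show ?thesis using \<gamma> K by simp
  next
    case (GKinv u x a)
    have "ar (GKinv u x a) = ar' (GKinv u x a)"
      by (rule inverse_unique[OF c.C, of "ar (GK u x a)"])
        (use GKinv \<gamma> K[of u x a] ob' c.K_inv[of u x a] c'.K_inv[of u x a] in simp_all)
    then show ?thesis using GKinv by simp
  qed
qed

end

section \<open>Images of cocones under functors\<close>

context cocone
begin

lemma cocone_comp_func:
  assumes H: "cat_functor H" "FDom H = C" "FCod H = C'"
  shows "cocone D J F C' (FOb H \<circ> ob) (FAr H \<circ> ar)"
proof -
  have [simp]: "category C'" using H by auto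
  show ?thesis
  proof (intro cocone.intro weight_data_axioms cocone_axioms.intro, goal_cases)
    case (10 d \<phi> \<psi>)
    then show ?case using arg_cong[OF FJ[OF 10], of "FAr H"] H by simp
  next
    case (11 u x a)
    then show ?case using arg_cong[OF K_inv(1)[OF 11], of "FAr H"] H by simp
  next
    case (12 u x a)
    then show ?case using arg_cong[OF K_inv(2)[OF 12], of "FAr H"] H by simp
  next
    case (13 u \<phi> a)
    then show ?case using arg_cong[OF K_J[OF 13], of "FAr H"] H by simp
  next
    case (14 u x \<psi>)
    then show ?case using arg_cong[OF K_F[OF 14], of "FAr H"] H by simp
  next
    case (15 \<alpha> x a)
    then show ?case using arg_cong[OF K_2[OF 15], of "FAr H"] H by simp
  next
    case (16 u v x a)
    then show ?case using arg_cong[OF K_Cmp[OF 16], of "FAr H"] H by simp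
  next
    case (17 d x a)
    then show ?case using arg_cong[OF K_Idn[OF 17], of "FAr H"] H by simp
  qed (use H in simp_all)
qed

text \<open>Composing with Cat(F-,H) amounts to applying \<open>H\<close> to every value of the
  cocone. The coherence cells of Cat(F-,H) are identities, so the entries of the composite cell are
  images of entries.\<close>

lemma mk_comp_func:
  assumes H: "cat_functor H" "FDom H = C" "FCod H = C'"
  shows "\<lbrakk>d \<in> Cell0 D; x \<in> Obj (P0 J d)\<rbrakk> \<Longrightarrow> comp_func H (cF d x) = mk_F C' (FOb H \<circ> ob) (FAr H \<circ> ar) d x"
    and "d \<in> Cell0 D \<Longrightarrow> comp_func (postcomp_func (P0 F d) H) (cS0 d) = mk_S0 C' (FOb H \<circ> ob) (FAr H \<circ> ar) d"
    and "psnat_comp (op2 D) (hom_into_func D F H) (mk_psnat C ob ar) = mk_psnat C' (FOb H \<circ> ob) (FAr H \<circ> ar)"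
proof -
  interpret H: cocone D J F C' "FOb H \<circ> ob" "FAr H \<circ> ar" by (rule cocone_comp_func[OF H])
  note [simp] = H
  show F: "comp_func H (cF d x) = H.cF d x" if "d \<in> Cell0 D" "x \<in> Obj (P0 J d)" for d x
    by (rule func_eqI) (use that in simp_all)
  show S0: "comp_func (postcomp_func (P0 F d) H) (cS0 d) = H.cS0 d" if "d \<in> Cell0 D" for d
  proof (rule func_eqI)
    show "FAr (comp_func (postcomp_func (P0 F d) H) (cS0 d)) f = FAr (H.cS0 d) f"
      if "f \<in> Arr (FDom (H.cS0 d))" for f
      using that \<open>d \<in> Cell0 D\<close> by simp (rule nat_eqI; simp add: F)
  qed (use that in \<open>simp_all add: F\<close>)
  have S1: "(id_nat (postcomp_func (P0 F (dom1 D u)) H) \<star> cS1 u) \<bullet>\<^sub>v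
      (id_nat (comp_func (precomp_func (P1 F u) C') (postcomp_func (P0 F (cod1 D u)) H)) \<star> id_nat (cS0 (cod1 D u)))
      = H.cS1 u" if u: "u \<in> Cell1 D" for u
  proof -
    \<comment> \<open>The identity cell sits at one of two equal composites. \<open>c\<close>,
      \<open>c'\<close> and \<open>c''\<close> bring the domains and codomains of all factors to a
      common form before entries are compared.\<close>
    have c: "comp_func (precomp_func (P1 F u) C') (postcomp_func (P0 F (cod1 D u)) H)
        = comp_func (postcomp_func (P0 F (dom1 D u)) H) (precomp_func (P1 F u) C)"
      using postcomp_precomp_commute[of "P1 F u" H] u by simp
    have c': "comp_func (postcomp_func (P0 F (dom1 D u)) H) (comp_func (precomp_func (P1 F u) C) (cS0 (cod1 D u)))
        = comp_func (precomp_func (P1 F u) C') (H.cS0 (cod1 D u))"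
      unfolding S0[symmetric, OF D_cod[OF u]] using u
      by (simp add: comp_func_assoc[symmetric] c del: comp_func_assoc)
    have c'': "comp_func (postcomp_func (P0 F (dom1 D u)) H) (comp_func (cS0 (dom1 D u)) (P1 J u))
        = comp_func (H.cS0 (dom1 D u)) (P1 J u)"
      unfolding S0[symmetric, OF D_dom[OF u]] using u by simp
    show ?thesis unfolding c
      by (rule nat2_eqI[where A = "P0 F (dom1 D u)" and B = C']; use u in \<open>simp add: c' c'' F\<close>)
  qed
  show "psnat_comp (op2 D) (hom_into_func D F H) (mk_psnat C ob ar) = mk_psnat C' (FOb H \<circ> ob) (FAr H \<circ> ar)"
    by (rule psnat_eqI[of _ "Cell0 D" _ "Cell1 D"])
      (use S1 in \<open>auto simp: psnat_comp_def hom_into_func_def mk_psnat_def S0\<close>)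
qed

end

section \<open>Modifications\<close>

text \<open>An uncurried modification: naturality at \<open>GF\<close> and \<open>GJ\<close> makes
  the entries a transformation between the functors \<open>S0\<close>, and at \<open>GK\<close> it
  is \<open>M0_square\<close>. Having it at every generator, \<open>GKinv\<close> included, is what
  permits induction over words in \<open>W\<close>.\<close>

locale cocone_map = cocone D J F C ob ar + c': cocone D J F C ob' ar'
  for D :: "('o, 'm, 'n) twocat"
    and J :: "('o, 'm, 'n, 'c, 'd) psfun_cat" and F :: "('o, 'm, 'n, 'a, 'b) psfun_cat"
    and C :: "('p, 'q) cat" and ob ar ob' ar' +
  fixes m :: "'o \<times> 'c \<times> 'a \<Rightarrow> 'q"
  assumes m [simp]: "p \<in> gen_obs \<Longrightarrow> m p \<in> Arr C" "p \<in> gen_obs \<Longrightarrow> Dom C (m p) = ob p"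
      "p \<in> gen_obs \<Longrightarrow> Cod C (m p) = ob' p"
    and m_natural: "\<gamma> \<in> gens \<Longrightarrow> Cmp C (m (gen_trg \<gamma>)) (ar \<gamma>) = Cmp C (ar' \<gamma>) (m (gen_src \<gamma>))"

context weight_data
begin

definition mk_M0 :: "('p, 'q) cat \<Rightarrow> ('o \<times> 'c \<times> 'a \<Rightarrow> 'p) \<Rightarrow> (('o, 'm, 'c, 'd, 'a, 'b) gen \<Rightarrow> 'q) \<Rightarrow>
    ('o \<times> 'c \<times> 'a \<Rightarrow> 'p) \<Rightarrow> (('o, 'm, 'c, 'd, 'a, 'b) gen \<Rightarrow> 'q) \<Rightarrow> ('o \<times> 'c \<times> 'a \<Rightarrow> 'q) \<Rightarrow>
    'o \<Rightarrow> ('c, 'd, ('a, 'b, 'p, 'q) func, ('a, 'b, 'p, 'q) natt) natt" where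
  "mk_M0 C ob ar ob' ar' m d = \<lparr>NDom = mk_S0 C ob ar d, NCod = mk_S0 C ob' ar' d,
     NT = (\<lambda>x\<in>Obj (P0 J d). \<lparr>NDom = mk_F C ob ar d x, NCod = mk_F C ob' ar' d x,
       NT = (\<lambda>a\<in>Obj (P0 F d). m (d, x, a))\<rparr>)\<rparr>"

definition mk_modif :: "('p, 'q) cat \<Rightarrow> ('o \<times> 'c \<times> 'a \<Rightarrow> 'p) \<Rightarrow> (('o, 'm, 'c, 'd, 'a, 'b) gen \<Rightarrow> 'q) \<Rightarrow>
    ('o \<times> 'c \<times> 'a \<Rightarrow> 'p) \<Rightarrow> (('o, 'm, 'c, 'd, 'a, 'b) gen \<Rightarrow> 'q) \<Rightarrow> ('o \<times> 'c \<times> 'a \<Rightarrow> 'q) \<Rightarrow>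
    ('o, 'm, 'c, 'd, ('a, 'b, 'p, 'q) func, ('a, 'b, 'p, 'q) natt) modif" where
  "mk_modif C ob ar ob' ar' m = \<lparr>MDom = mk_psnat C ob ar, MCod = mk_psnat C ob' ar',
     M0 = (\<lambda>d\<in>Cell0 D. mk_M0 C ob ar ob' ar' m d)\<rparr>"

lemma mk_M0_simps [simp]:
  "NDom (mk_M0 C ob ar ob' ar' m d) = mk_S0 C ob ar d"
  "NCod (mk_M0 C ob ar ob' ar' m d) = mk_S0 C ob' ar' d"
  "x \<in> Obj (P0 J d) \<Longrightarrow> NDom (NT (mk_M0 C ob ar ob' ar' m d) x) = mk_F C ob ar d x"
  "x \<in> Obj (P0 J d) \<Longrightarrow> NCod (NT (mk_M0 C ob ar ob' ar' m d) x) = mk_F C ob' ar' d x"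
  "x \<in> Obj (P0 J d) \<Longrightarrow> a \<in> Obj (P0 F d) \<Longrightarrow> NT (NT (mk_M0 C ob ar ob' ar' m d) x) a = m (d, x, a)"
  by (simp_all add: mk_M0_def)

lemma mk_modif_simps [simp]:
  "MDom (mk_modif C ob ar ob' ar' m) = mk_psnat C ob ar"
  "MCod (mk_modif C ob ar ob' ar' m) = mk_psnat C ob' ar'"
  "d \<in> Cell0 D \<Longrightarrow> M0 (mk_modif C ob ar ob' ar' m) d = mk_M0 C ob ar ob' ar' m d"
  "M0 (mk_modif C ob ar ob' ar' m) \<in> extensional (Cell0 D)"
  by (simp_all add: mk_modif_def)

text \<open>Sources and targets are compared as transformations rather than as cocones; the functors
  \<open>mk_S0\<close> and \<open>mk_F\<close> inside the entries are recovered from them by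
  evaluation.\<close>

lemma mk_modif_cong:
  assumes "mk_psnat C ob1 ar1 = mk_psnat C ob2 ar2" "mk_psnat C ob1' ar1' = mk_psnat C ob2' ar2'"
    and m: "\<And>p. p \<in> gen_obs \<Longrightarrow> m1 p = m2 p"
  shows "mk_modif C ob1 ar1 ob1' ar1' m1 = mk_modif C ob2 ar2 ob2' ar2' m2"
proof -
  have S: "mk_S0 C ob1 ar1 d = mk_S0 C ob2 ar2 d" "mk_S0 C ob1' ar1' d = mk_S0 C ob2' ar2' d" if "d \<in> Cell0 D" for d
    using arg_cong[OF assms(1), of "\<lambda>\<sigma>. S0 \<sigma> d"] arg_cong[OF assms(2), of "\<lambda>\<sigma>. S0 \<sigma> d"] that by simp_all
  have F: "mk_F C ob1 ar1 d x = mk_F C ob2 ar2 d x" "mk_F C ob1' ar1' d x = mk_F C ob2' ar2' d x"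
    if "d \<in> Cell0 D" "x \<in> Obj (P0 J d)" for d x
    using arg_cong[OF S(1), of d "\<lambda>G. FOb G x"] arg_cong[OF S(2), of d "\<lambda>G. FOb G x"] that by simp_all
  show ?thesis
    using assms(1,2) by (simp add: mk_modif_def mk_M0_def S F m cong: restrict_cong)
qed

lemma mk_modif_inject:
  assumes "mk_modif C ob ar ob' ar' m1 = mk_modif C ob ar ob' ar' m2" "p \<in> gen_obs"
  shows "m1 p = m2 p"
proof -
  obtain d x a where p: "p = (d, x, a)" by (cases p)
  show ?thesis using arg_cong[OF assms(1), of "\<lambda>\<Gamma>. NT (NT (M0 \<Gamma> d) x) a"] assms(2) p by simp
qed

lemma modif_eqI:
  fixes \<Gamma> \<Delta> :: "('o, 'm, 'p, 'q, 'r, 's) modif"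
  assumes "MDom \<Gamma> = MDom \<Delta>" "MCod \<Gamma> = MCod \<Delta>" "M0 \<Gamma> \<in> extensional (Cell0 D)"
    "M0 \<Delta> \<in> extensional (Cell0 D)" "\<And>d. d \<in> Cell0 D \<Longrightarrow> M0 \<Gamma> d = M0 \<Delta> d"
  shows "\<Gamma> = \<Delta>"
proof -
  have "M0 \<Gamma> = M0 \<Delta>" by (rule extensionalityI[OF assms(3,4)]) (rule assms(5))
  with assms(1,2) show ?thesis by simp
qed

end

context cocone_map
begin

abbreviation "M \<equiv> mk_M0 C ob ar ob' ar' m"

lemma nat_trans_mk_m [simp]:
  "\<lbrakk>d \<in> Cell0 D; x \<in> Obj (P0 J d)\<rbrakk> \<Longrightarrow> nat_trans (NT (M d) x)"
  unfolding mk_M0_def using m_natural[of "GF d x _"] by simp (rule nat_transI; simp)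

lemma nat_trans_mk_M0 [simp]: "d \<in> Cell0 D \<Longrightarrow> nat_trans (M d)"
  unfolding mk_M0_def
proof (rule nat_transI, goal_cases)
  case (6 x)
  then show ?case using nat_trans_mk_m[of d x] by (simp add: mk_M0_def)
next
  case (7 f)
  then have x: "Dom (P0 J d) f \<in> Obj (P0 J d)" "Cod (P0 J d) f \<in> Obj (P0 J d)" by simp_all
  show ?case
    using 7 nat_trans_mk_m[OF 7(1) x(1)] nat_trans_mk_m[OF 7(1) x(2)] m_natural[of "GJ d f _"]
    by (simp, intro nat_eqI) (simp_all add: mk_M0_def)
qed simp_all

lemma modification_mk_modif: "modification (op2 D) J (hom_into F C) (mk_modif C ob ar ob' ar' m)"
proof (rule modification.intro, goal_cases)
  case (7 u)
  then show ?case
    using m_natural[of "GK u _ _"]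
    by simp (rule nat2_eqI[where A = "P0 F (dom1 D u)" and B = C]; simp)
qed (simp_all add: pseudo_nat_mk_psnat c'.pseudo_nat_mk_psnat)

end

text \<open>Here \<open>m\<close> is the family of entries of \<Gamma>. Its squares at
  \<open>GF\<close>, \<open>GJ\<close> and \<open>GK\<close> are naturality in \<open>a\<close>,
  naturality in \<open>x\<close> and \<open>M0_square\<close>; the square at \<open>GKinv\<close> is
  derived from the one at \<open>GK\<close>.\<close>

lemma (in weight_data) modification_mk_modifE:
  assumes c: "cocone D J F C ob ar" and c': "cocone D J F C ob' ar'"
    and \<Gamma>: "modification (op2 D) J (hom_into F C) \<Gamma>"
    and MDom: "MDom \<Gamma> = mk_psnat C ob ar" and MCod: "MCod \<Gamma> = mk_psnat C ob' ar'"
  obtains m where "cocone_map D J F C ob ar ob' ar' m" "\<Gamma> = mk_modif C ob ar ob' ar' m"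
proof -
  interpret c: cocone D J F C ob ar by fact
  interpret c': cocone D J F C ob' ar' by fact
  interpret \<Gamma>: modification "op2 D" J "hom_into F C" \<Gamma> by fact
  define m where "m = (\<lambda>(d, x, a). NT (NT (M0 \<Gamma> d) x) a)"
  have [simp]: "m (d, x, a) = NT (NT (M0 \<Gamma> d) x) a" for d x a by (simp add: m_def)
  have n [simp]: "nat_trans (M0 \<Gamma> d)" "NDom (M0 \<Gamma> d) = c.cS0 d" "NCod (M0 \<Gamma> d) = c'.cS0 d"
    if "d \<in> Cell0 D" for d
    using \<Gamma>.M0_nat_trans[of d] \<Gamma>.M0_NDom[of d] \<Gamma>.M0_NCod[of d] that MDom MCod by simp_all
  have nx [simp]: "nat_trans (NT (M0 \<Gamma> d) x)" "NDom (NT (M0 \<Gamma> d) x) = c.cF d x" "NCod (NT (M0 \<Gamma> d) x) = c'.cF d x"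
    if "d \<in> Cell0 D" "x \<in> Obj (P0 J d)" for d x
    using nat_NT_in[OF n(1)[OF that(1)] refl, of x] nat_NT_Dom[OF n(1)[OF that(1)] refl, of x]
      nat_NT_Cod[OF n(1)[OF that(1)] refl, of x] that by simp_all
  have mK: "Cmp C (m (gen_trg (GK u x a))) (ar (GK u x a)) = Cmp C (ar' (GK u x a)) (m (gen_src (GK u x a)))"
    if "GK u x a \<in> gens" for u x a
    using that arg_cong[OF \<Gamma>.M0_square[of u], of "\<lambda>\<alpha>. NT (NT \<alpha> x) a"] MDom MCod by simp
  have mp: "m p \<in> Arr C \<and> Dom C (m p) = ob p \<and> Cod C (m p) = ob' p" if "p \<in> gen_obs" for p
    using that by (cases p) simp
  have "cocone_map D J F C ob ar ob' ar' m"
  proof (intro cocone_map.intro cocone_map_axioms.intro)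
    fix \<gamma> assume \<gamma>: "\<gamma> \<in> gens"
    show "Cmp C (m (gen_trg \<gamma>)) (ar \<gamma>) = Cmp C (ar' \<gamma>) (m (gen_src \<gamma>))"
    proof (cases \<gamma>)
      case (GF d x \<psi>)
      then show ?thesis using \<gamma> nat_trans.naturality[of "NT (M0 \<Gamma> d) x" \<psi>] by simp
    next
      case (GJ d \<phi> a)
      then show ?thesis using \<gamma> arg_cong[OF nat_trans.naturality[of "M0 \<Gamma> d" \<phi>], of "\<lambda>\<alpha>. NT \<alpha> a"] by simp
    next
      case (GK u x a)
      then show ?thesis using \<gamma> mK by blast
    next
      case (GKinv u x a)
      let ?K = "GK u x a" and ?K' = "GKinv u x a"
      have K: "?K \<in> gens" "?K' \<in> gens" using \<gamma> GKinv by simp_all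
      let ?s = "(cod1 D u, x, FOb (P1 F u) a)" and ?t = "(dom1 D u, FOb (P1 J u) x, a)"
      have st: "?s \<in> gen_obs" "?t \<in> gen_obs" using K by simp_all
      note mp' = mp[OF st(1)] mp[OF st(2)]
      \<comment> \<open>The square at \<open>GK\<close> is conjugated with the inverses: insert the
        identity \<open>ar' ?K'\<close> after \<open>ar' ?K\<close>, cross the square, and cancel
        \<open>ar ?K\<close> against \<open>ar ?K'\<close>.\<close>
      have "Cmp C (m ?s) (ar ?K') = Cmp C (Cmp C (ar' ?K') (ar' ?K)) (Cmp C (m ?s) (ar ?K'))"
        using K st mp' c'.K_inv[of u x a] by (simp del: category.Cmp_assoc \<open>\<And>d x a. m (d, x, a) = _ d x a\<close>)
      also have "\<dots> = Cmp C (ar' ?K') (Cmp C (Cmp C (ar' ?K) (m ?s)) (ar ?K'))"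
        using K st mp' by simp
      also have "\<dots> = Cmp C (ar' ?K') (Cmp C (Cmp C (m ?t) (ar ?K)) (ar ?K'))"
        using mK[OF K(1)] by simp
      also have "\<dots> = Cmp C (ar' ?K') (Cmp C (m ?t) (Cmp C (ar ?K) (ar ?K')))"
        using K st mp' by simp
      also have "\<dots> = Cmp C (ar' ?K') (m ?t)"
        using K st mp' c.K_inv[of u x a] by simp
      finally show ?thesis using GKinv by simp
    qed
  qed (use mp c c' in simp_all)
  moreover
  interpret cocone_map D J F C ob ar ob' ar' m by fact
  have "M0 \<Gamma> d = M d" if "d \<in> Cell0 D" for d
    by (rule nat2_eqI[where A = "P0 F d" and B = C]; use that in simp)
  then have "\<Gamma> = mk_modif C ob ar ob' ar' m"
    by (intro modif_eqI) (simp_all add: MDom MCod \<Gamma>.M0_ext[simplified])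
  ultimately show thesis using that by blast
qed

context cocone_map
begin

text \<open>The counterpart of \<open>mk_comp_func\<close> for modifications: whiskering applies
  \<open>H\<close> to the entries, and the squares of the result are images of squares.\<close>

lemma modif_hcomp_mk_modif:
  assumes H: "cat_functor H" "FDom H = C" "FCod H = C'"
  shows "modif_hcomp (op2 D) (id_modif (op2 D) (hom_into_func D F H)) (mk_modif C ob ar ob' ar' m)
    = mk_modif C' (FOb H \<circ> ob) (FAr H \<circ> ar) (FOb H \<circ> ob') (FAr H \<circ> ar') (FAr H \<circ> m)"
proof -
  interpret H: cocone D J F C' "FOb H \<circ> ob" "FAr H \<circ> ar" by (rule cocone_comp_func[OF H])
  interpret H': cocone D J F C' "FOb H \<circ> ob'" "FAr H \<circ> ar'" by (rule c'.cocone_comp_func[OF H])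
  note [simp] = H mk_comp_func[OF H] c'.mk_comp_func[OF H]
  interpret Hm: cocone_map D J F C' "FOb H \<circ> ob" "FAr H \<circ> ar" "FOb H \<circ> ob'" "FAr H \<circ> ar'" "FAr H \<circ> m"
  proof (unfold_locales, goal_cases)
    case (4 \<gamma>)
    have p: "gen_src \<gamma> \<in> gen_obs" "gen_trg \<gamma> \<in> gen_obs" using gen_src_trg[OF 4] by simp_all
    show ?case using arg_cong[OF m_natural[OF 4], of "FAr H"] 4 p by simp
  qed simp_all
  have "id_nat (postcomp_func (P0 F d) H) \<star> M d = Hm.M d" if "d \<in> Cell0 D" for d
    by (rule nat2_eqI[where A = "P0 F d" and B = C']; use that in simp)
  moreover have "S0 (hom_into_func D F H) d = postcomp_func (P0 F d) H" if "d \<in> Cell0 D" for d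
    using that by (simp add: hom_into_func_def)
  ultimately show ?thesis by (intro modif_eqI) (simp_all add: modif_hcomp_def id_modif_def)
qed

end

section \<open>Identities, vertical composites and images under transformations\<close>

lemma (in cocone) cocone_map_id: "cocone_map D J F C ob ar ob ar (\<lambda>p. Idn C (ob p))"
proof (unfold_locales, goal_cases)
  case (4 \<gamma>)
  then show ?case using gen_src_trg[OF 4] by simp
qed simp_all

lemma (in cocone) id_modif_mk_psnat:
  "id_modif (op2 D) (mk_psnat C ob ar) = mk_modif C ob ar ob ar (\<lambda>p. Idn C (ob p))"
proof -
  interpret i: cocone_map D J F C ob ar ob ar "\<lambda>p. Idn C (ob p)" by (rule cocone_map_id)
  have "id_nat (cS0 d) = i.M d" if "d \<in> Cell0 D" for d
    by (rule nat2_eqI[where A = "P0 F d" and B = C]; use that in simp)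
  then show ?thesis by (intro modif_eqI) (simp_all add: id_modif_def)
qed

text \<open>Composition is entrywise in \<open>C\<close>: at each generator the squares of
  \<open>m\<close> and \<open>m'\<close> are pasted.\<close>

lemma modif_vcomp_mk_modif:
  assumes "cocone_map D J F C ob ar ob' ar' m" "cocone_map D J F C ob' ar' ob'' ar'' m'"
  shows "modif_vcomp (op2 D) (weight_data.mk_modif D J F C ob' ar' ob'' ar'' m')
      (weight_data.mk_modif D J F C ob ar ob' ar' m)
    = weight_data.mk_modif D J F C ob ar ob'' ar'' (\<lambda>p. Cmp C (m' p) (m p))"
proof -
  interpret m: cocone_map D J F C ob ar ob' ar' m by fact
  interpret m': cocone_map D J F C ob' ar' ob'' ar'' m' by fact
  interpret mm: cocone_map D J F C ob ar ob'' ar'' "\<lambda>p. Cmp C (m' p) (m p)"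
  proof (unfold_locales, goal_cases)
    case (4 \<gamma>)
    have p: "m.gen_src \<gamma> \<in> m.gen_obs" "m.gen_trg \<gamma> \<in> m.gen_obs" using m.gen_src_trg[OF 4] by simp_all
    have "Cmp C (Cmp C (m' (m.gen_trg \<gamma>)) (m (m.gen_trg \<gamma>))) (ar \<gamma>)
        = Cmp C (m' (m.gen_trg \<gamma>)) (Cmp C (ar' \<gamma>) (m (m.gen_src \<gamma>)))"
      using 4 p m.m_natural[OF 4] by simp
    also have "\<dots> = Cmp C (Cmp C (m' (m.gen_trg \<gamma>)) (ar' \<gamma>)) (m (m.gen_src \<gamma>))"
      using 4 p by simp
    also have "\<dots> = Cmp C (ar'' \<gamma>) (Cmp C (m' (m.gen_src \<gamma>)) (m (m.gen_src \<gamma>)))"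
      unfolding m'.m_natural[OF 4] using 4 p by simp
    finally show ?case .
  qed simp_all
  have "m'.M d \<bullet>\<^sub>v m.M d = mm.M d" if "d \<in> Cell0 D" for d
    by (rule nat2_eqI[where A = "P0 F d" and B = C]; use that in simp)
  then show ?thesis by (intro m.modif_eqI) (simp_all add: modif_vcomp_def)
qed

text \<open>The square at a generator \<gamma> is naturality of \<alpha> at the arrow
  \<open>ar \<gamma>\<close>. For the universal cocone this is how transformations between functors
  on \<open>W\<close> become modifications.\<close>

lemma (in cocone) cocone_map_nat_trans:
  assumes \<alpha>: "nat_trans \<alpha>" "FDom (NDom \<alpha>) = C" "FCod (NDom \<alpha>) = C'"
  shows "cocone_map D J F C' (FOb (NDom \<alpha>) \<circ> ob) (FAr (NDom \<alpha>) \<circ> ar)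
    (FOb (NCod \<alpha>) \<circ> ob) (FAr (NCod \<alpha>) \<circ> ar) (NT \<alpha> \<circ> ob)"
proof -
  interpret H: cocone D J F C' "FOb (NDom \<alpha>) \<circ> ob" "FAr (NDom \<alpha>) \<circ> ar"
    by (rule cocone_comp_func) (use \<alpha> in simp_all)
  interpret H': cocone D J F C' "FOb (NCod \<alpha>) \<circ> ob" "FAr (NCod \<alpha>) \<circ> ar"
    by (rule cocone_comp_func) (use \<alpha> in simp_all)
  show ?thesis
  proof (unfold_locales, goal_cases)
    case (4 \<gamma>)
    then show ?case using nat_trans.naturality[OF \<alpha>(1), of "ar \<gamma>"] \<alpha> by simp
  qed (use \<alpha> in simp_all)
qed

lemma (in cocone) modif_hcomp_hom_into_nat:
  assumes \<alpha>: "nat_trans \<alpha>" "FDom (NDom \<alpha>) = C" "FCod (NDom \<alpha>) = C'"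
  shows "modif_hcomp (op2 D) (hom_into_nat D F \<alpha>) (id_modif (op2 D) (mk_psnat C ob ar))
    = mk_modif C' (FOb (NDom \<alpha>) \<circ> ob) (FAr (NDom \<alpha>) \<circ> ar) (FOb (NCod \<alpha>) \<circ> ob) (FAr (NCod \<alpha>) \<circ> ar) (NT \<alpha> \<circ> ob)"
proof -
  have N: "cat_functor (NDom \<alpha>)" "cat_functor (NCod \<alpha>)" "FDom (NCod \<alpha>) = C" "FCod (NCod \<alpha>) = C'"
    using \<alpha> by simp_all
  note [simp] = \<alpha> N mk_comp_func[OF N(1) \<alpha>(2,3)] mk_comp_func[OF N(2-4)]
  interpret Hm: cocone_map D J F C' "FOb (NDom \<alpha>) \<circ> ob" "FAr (NDom \<alpha>) \<circ> ar"
    "FOb (NCod \<alpha>) \<circ> ob" "FAr (NCod \<alpha>) \<circ> ar" "NT \<alpha> \<circ> ob"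
    by (rule cocone_map_nat_trans[OF \<alpha>])
  have "postcomp_nat (P0 F d) \<alpha> \<star> id_nat (cS0 d) = Hm.M d" if "d \<in> Cell0 D" for d
    by (rule nat2_eqI[where A = "P0 F d" and B = C']; use that in simp)
  then show ?thesis
    by (intro modif_eqI) (simp_all add: modif_hcomp_def id_modif_def hom_into_nat_def)
qed

section \<open>The colimit\<close>

text \<open>Any \<open>W\<close> with a universal cocone will do, however it was built.
  \<open>universal\<close> gives existence of the mediating functor, while \<open>bij\<close> and
  \<open>induct\<close> give its uniqueness. They also give the two-dimensional part: components are
  prescribed on objects \<open>obW p\<close>, and naturality spreads from generators to all
  words.\<close>

lemma (in weight_data) two_naturally_isomorphic_weighted:
  fixes W :: "('w, 'z) cat" and U :: "('p, 'q) cat set"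
  assumes W: "cocone D J F W obW arW"
    and bij: "bij_betw obW gen_obs (Obj W)"
    and induct: "\<And>P f. \<lbrakk>f \<in> Arr W; \<And>p. p \<in> gen_obs \<Longrightarrow> P (Idn W (obW p));
      \<And>\<gamma> f. \<lbrakk>\<gamma> \<in> gens; f \<in> Arr W; Dom W f = obW (gen_trg \<gamma>); P f\<rbrakk> \<Longrightarrow> P (Cmp W f (arW \<gamma>))\<rbrakk> \<Longrightarrow> P f"
    and universal: "\<And>C ob ar. \<lbrakk>C \<in> U; cocone D J F C ob ar\<rbrakk> \<Longrightarrow>
      \<exists>H\<in>functors W C. (\<forall>p\<in>gen_obs. FOb H (obW p) = ob p) \<and> (\<forall>\<gamma>\<in>gens. FAr H (arW \<gamma>) = ar \<gamma>)"
  shows "two_naturally_isomorphic (full_cat2 U) (representable W) (weighted D J F)"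
proof -
  interpret W: cocone D J F W obW arW by fact
  define \<Phi>0 :: "('p, 'q) cat \<Rightarrow> ('w, 'z, 'p, 'q) func \<Rightarrow> _" where "\<Phi>0 C H = mk_psnat C (FOb H \<circ> obW) (FAr H \<circ> arW)" for C H
  define \<Phi>1 :: "('p, 'q) cat \<Rightarrow> ('w, 'z, 'p, 'q) natt \<Rightarrow> _" where "\<Phi>1 C \<alpha> = mk_modif C (FOb (NDom \<alpha>) \<circ> obW) (FAr (NDom \<alpha>) \<circ> arW)
    (FOb (NCod \<alpha>) \<circ> obW) (FAr (NCod \<alpha>) \<circ> arW) (NT \<alpha> \<circ> obW)" for C \<alpha>
  have Obj_W: "Obj W = obW ` gen_obs" using bij by (simp add: bij_betw_def)
  note comp_W = W.cocone_comp_func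
  have func_W_eqI: "H = K" if H: "cat_functor H" "FDom H = W" "FCod H = C"
    and K: "cat_functor K" "FDom K = W" "FCod K = C"
    and ob: "\<And>p. p \<in> gen_obs \<Longrightarrow> FOb H (obW p) = FOb K (obW p)"
    and ar: "\<And>\<gamma>. \<gamma> \<in> gens \<Longrightarrow> FAr H (arW \<gamma>) = FAr K (arW \<gamma>)" for H K :: "('w, 'z, 'p, 'q) func" and C
  proof (rule func_eqI)
    show "FAr H f = FAr K f" if "f \<in> Arr (FDom K)" for f
      using that unfolding K(2) by (rule induct) (use H K ob ar in simp_all)
  qed (use H K ob in \<open>auto simp: Obj_W\<close>)
  have inj0: "H = K" if "\<Phi>0 C H = \<Phi>0 C K" "H \<in> functors W C" "K \<in> functors W C" for C H K
  proof (rule func_W_eqI)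
    have c: "cocone D J F C (FOb H \<circ> obW) (FAr H \<circ> arW)" "cocone D J F C (FOb K \<circ> obW) (FAr K \<circ> arW)"
      using that by (auto intro!: comp_W)
    show "FOb H (obW p) = FOb K (obW p)" if "p \<in> gen_obs" for p
      using mk_psnat_inject(1)[OF c _ that] \<open>\<Phi>0 C H = \<Phi>0 C K\<close> by (simp add: \<Phi>0_def)
    show "FAr H (arW \<gamma>) = FAr K (arW \<gamma>)" if "\<gamma> \<in> gens" for \<gamma>
      using mk_psnat_inject(2)[OF c _ that] \<open>\<Phi>0 C H = \<Phi>0 C K\<close> by (simp add: \<Phi>0_def)
  qed (use that in simp_all)
  have surj0: "\<exists>H\<in>functors W C. \<sigma> = \<Phi>0 C H"
    if C: "category C" "C \<in> U" and \<sigma>: "pseudo_nat (op2 D) J (hom_into F C) \<sigma>" for C \<sigma>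
  proof -
    obtain H where H: "H \<in> functors W C" "\<And>p. p \<in> gen_obs \<Longrightarrow> FOb H (obW p) = ob_of \<sigma> p"
      "\<And>\<gamma>. \<gamma> \<in> gens \<Longrightarrow> FAr H (arW \<gamma>) = ar_of C \<sigma> \<gamma>"
      using universal[OF C(2) cocone_of_pseudo_nat(1)[OF C(1) \<sigma>]] by blast
    have "\<Phi>0 C H = mk_psnat C (ob_of \<sigma>) (ar_of C \<sigma>)"
      unfolding \<Phi>0_def by (rule mk_psnat_cong) (simp_all add: H)
    then show ?thesis using H(1) cocone_of_pseudo_nat(2)[OF C(1) \<sigma>] by auto
  qed
  show ?thesis
  \<comment> \<open>Goals 2 and 3 are the bijections on objects and arrows, 4 to 7 their
    compatibility with the category structures, and 9, 10 and 12 their naturality in the target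
    category.\<close>
  proof (rule two_naturally_isomorphicI[where fo = \<Phi>0 and fa = \<Phi>1], goal_cases)
    case 1
    show ?case by (rule two_functor_representable) simp
  next
    case (2 C)
    show ?case
    proof (rule bij_betw_imageI)
      show "inj_on (\<Phi>0 C) (Obj (T0 (representable W) C))"
        using inj0 by (auto simp: inj_on_def representable_def)
      show "\<Phi>0 C ` Obj (T0 (representable W) C) = Obj (T0 (weighted D J F) C)"
      proof (intro equalityI subsetI)
        fix \<sigma> assume "\<sigma> \<in> \<Phi>0 C ` Obj (T0 (representable W) C)"
        then obtain H where H: "cat_functor H" "FDom H = W" "FCod H = C" "\<sigma> = \<Phi>0 C H"
          by (auto simp: representable_def)
        then show "\<sigma> \<in> Obj (T0 (weighted D J F) C)"
          using cocone.pseudo_nat_mk_psnat[OF comp_W[OF H(1-3)]]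
          by (simp add: weighted_def Hom_cat_def \<Phi>0_def)
      next
        fix \<sigma> assume "\<sigma> \<in> Obj (T0 (weighted D J F) C)"
        then show "\<sigma> \<in> \<Phi>0 C ` Obj (T0 (representable W) C)"
          using surj0[OF 2, of \<sigma>] by (auto simp: weighted_def Hom_cat_def representable_def)
      qed
    qed
  next
    case (3 C)
    show ?case
    proof (rule bij_betw_imageI)
      show "inj_on (\<Phi>1 C) (Arr (T0 (representable W) C))"
      proof (rule inj_onI)
        fix \<alpha> \<beta> assume "\<alpha> \<in> Arr (T0 (representable W) C)" "\<beta> \<in> Arr (T0 (representable W) C)"
          and eq: "\<Phi>1 C \<alpha> = \<Phi>1 C \<beta>"
        then have \<alpha>: "nat_trans \<alpha>" "FDom (NDom \<alpha>) = W" "FCod (NDom \<alpha>) = C"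
          and \<beta>: "nat_trans \<beta>" "FDom (NDom \<beta>) = W" "FCod (NDom \<beta>) = C"
          by (simp_all add: representable_def)
        have "\<Phi>0 C (NDom \<alpha>) = \<Phi>0 C (NDom \<beta>)" "\<Phi>0 C (NCod \<alpha>) = \<Phi>0 C (NCod \<beta>)"
          using arg_cong[OF eq, of MDom] arg_cong[OF eq, of MCod] by (simp_all add: \<Phi>1_def \<Phi>0_def)
        then have N: "NDom \<alpha> = NDom \<beta>" "NCod \<alpha> = NCod \<beta>" using inj0 \<alpha> \<beta> by simp_all
        show "\<alpha> = \<beta>"
        proof (rule nat_eqI)
          fix x assume "x \<in> Obj (FDom (NDom \<beta>))"
          then obtain p where "p \<in> gen_obs" "x = obW p" using \<beta> by (auto simp: Obj_W)
          then show "NT \<alpha> x = NT \<beta> x"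
            using mk_modif_inject[of C _ _ _ _ "NT \<alpha> \<circ> obW" "NT \<beta> \<circ> obW" p] eq
            by (simp add: \<Phi>1_def N)
        qed (use \<alpha> \<beta> N in simp_all)
      qed
      show "\<Phi>1 C ` Arr (T0 (representable W) C) = Arr (T0 (weighted D J F) C)"
      proof (intro equalityI subsetI)
        fix \<Gamma> assume "\<Gamma> \<in> \<Phi>1 C ` Arr (T0 (representable W) C)"
        then obtain \<alpha> where \<alpha>: "nat_trans \<alpha>" "FDom (NDom \<alpha>) = W" "FCod (NDom \<alpha>) = C" "\<Gamma> = \<Phi>1 C \<alpha>"
          by (auto simp: representable_def)
        then show "\<Gamma> \<in> Arr (T0 (weighted D J F) C)"
          using cocone_map.modification_mk_modif[OF W.cocone_map_nat_trans[OF \<alpha>(1-3)]]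
          by (simp add: weighted_def Hom_cat_def \<Phi>1_def)
      next
        fix \<Gamma> assume "\<Gamma> \<in> Arr (T0 (weighted D J F) C)"
        then have \<Gamma>: "modification (op2 D) J (hom_into F C) \<Gamma>" by (simp add: weighted_def Hom_cat_def)
        obtain H where H: "H \<in> functors W C" "MDom \<Gamma> = \<Phi>0 C H"
          using surj0[OF 3 modification.MDom_pseudo_nat[OF \<Gamma>]] by blast
        obtain K where K: "K \<in> functors W C" "MCod \<Gamma> = \<Phi>0 C K"
          using surj0[OF 3 modification.MCod_pseudo_nat[OF \<Gamma>]] by blast
        have c: "cocone D J F C (FOb H \<circ> obW) (FAr H \<circ> arW)" "cocone D J F C (FOb K \<circ> obW) (FAr K \<circ> arW)"
          using H K by (auto intro!: comp_W)
        obtain m where m: "cocone_map D J F C (FOb H \<circ> obW) (FAr H \<circ> arW) (FOb K \<circ> obW) (FAr K \<circ> arW) m"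
          "\<Gamma> = mk_modif C (FOb H \<circ> obW) (FAr H \<circ> arW) (FOb K \<circ> obW) (FAr K \<circ> arW) m"
          using modification_mk_modifE[OF c \<Gamma> H(2)[unfolded \<Phi>0_def] K(2)[unfolded \<Phi>0_def]] by blast
        interpret m: cocone_map D J F C "FOb H \<circ> obW" "FAr H \<circ> arW" "FOb K \<circ> obW" "FAr K \<circ> arW" m
          by (fact m(1))
        \<comment> \<open>The entries of a modification are indexed by triples, the components of a
          transformation by objects of \<open>W\<close>. Injectivity of \<open>obW\<close> makes the
          change of index unambiguous.\<close>
        define t where "t x = m (inv_into gen_obs obW x)" for x
        have t: "t (obW p) = m p" if "p \<in> gen_obs" for p
          using bij_betw_inv_into_left[OF bij that] by (simp add: t_def)
        have HK [simp]: "cat_functor H" "FDom H = W" "FCod H = C" "cat_functor K" "FDom K = W" "FCod K = C"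
          using H(1) K(1) by simp_all
        let ?\<alpha> = "\<lparr>NDom = H, NCod = K, NT = (\<lambda>x\<in>Obj W. t x)\<rparr>"
        have tx: "t x \<in> Arr C \<and> Dom C (t x) = FOb H x \<and> Cod C (t x) = FOb K x" if "x \<in> Obj W" for x
          using that by (auto simp: Obj_W t)
        have "nat_trans ?\<alpha>"
        proof (rule nat_transI)
          fix f assume "f \<in> Arr W"
          then have "Cmp C (t (Cod W f)) (FAr H f) = Cmp C (FAr K f) (t (Dom W f))"
          proof (rule induct)
            show "Cmp C (t (Cod W (Idn W (obW p)))) (FAr H (Idn W (obW p))) =
              Cmp C (FAr K (Idn W (obW p))) (t (Dom W (Idn W (obW p))))" if "p \<in> gen_obs" for p
              using that tx[of "obW p"] by simp
          next
            fix \<gamma> f assume g: "\<gamma> \<in> gens" "f \<in> Arr W" "Dom W f = obW (gen_trg \<gamma>)"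
              and IH: "Cmp C (t (Cod W f)) (FAr H f) = Cmp C (FAr K f) (t (Dom W f))"
            have p: "gen_src \<gamma> \<in> gen_obs" "gen_trg \<gamma> \<in> gen_obs" using gen_src_trg[OF g(1)] by simp_all
            \<comment> \<open>The square of the shorter word, given by the induction hypothesis, is
              pasted with the square of \<open>m\<close> at the generator.\<close>
            have "Cmp C (t (Cod W f)) (FAr H (Cmp W f (arW \<gamma>)))
                = Cmp C (Cmp C (t (Cod W f)) (FAr H f)) (FAr H (arW \<gamma>))"
              using g p tx[of "Cod W f"] by simp
            also have "\<dots> = Cmp C (FAr K f) (Cmp C (m (gen_trg \<gamma>)) (FAr H (arW \<gamma>)))"
              unfolding IH using g p by (simp add: t)
            also have "\<dots> = Cmp C (FAr K f) (Cmp C (FAr K (arW \<gamma>)) (m (gen_src \<gamma>)))"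
              using m.m_natural[OF g(1)] by simp
            also have "\<dots> = Cmp C (FAr K (Cmp W f (arW \<gamma>))) (t (obW (gen_src \<gamma>)))"
              using g p by (simp add: t)
            finally show "Cmp C (t (Cod W (Cmp W f (arW \<gamma>)))) (FAr H (Cmp W f (arW \<gamma>)))
              = Cmp C (FAr K (Cmp W f (arW \<gamma>))) (t (Dom W (Cmp W f (arW \<gamma>))))"
              using g by simp
          qed
          then show "Cmp (FCod H) (t (Cod W f)) (FAr H f) = Cmp (FCod H) (FAr K f) (t (Dom W f))" by simp
        qed (use tx in simp_all)
        moreover have "\<Phi>1 C ?\<alpha> = \<Gamma>"
          unfolding \<Phi>1_def m(2) by (rule mk_modif_cong) (simp_all add: t)
        ultimately show "\<Gamma> \<in> \<Phi>1 C ` Arr (T0 (representable W) C)"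
          by (intro image_eqI[of _ _ ?\<alpha>]) (simp_all add: representable_def)
      qed
    qed
  next
    case (4 C \<alpha>)
    then show ?case by (simp add: representable_def weighted_def Hom_cat_def \<Phi>0_def \<Phi>1_def)
  next
    case (5 C \<alpha>)
    then show ?case by (simp add: representable_def weighted_def Hom_cat_def \<Phi>0_def \<Phi>1_def)
  next
    case (6 C H)
    then have H: "cat_functor H" "FDom H = W" "FCod H = C" by (simp_all add: representable_def)
    have "id_modif (op2 D) (\<Phi>0 C H) = \<Phi>1 C (id_nat H)"
      unfolding \<Phi>0_def cocone.id_modif_mk_psnat[OF comp_W[OF H]] \<Phi>1_def
      by (rule mk_modif_cong) (use H in simp_all)
    then show ?case by (simp add: representable_def weighted_def Hom_cat_def)
  next
    case (7 C \<alpha> \<beta>)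
    then have \<alpha>: "nat_trans \<alpha>" "FDom (NDom \<alpha>) = W" "FCod (NDom \<alpha>) = C"
      and \<beta>: "nat_trans \<beta>" "FDom (NDom \<beta>) = W" "FCod (NDom \<beta>) = C" and e: "NDom \<beta> = NCod \<alpha>"
      by (simp_all add: representable_def)
    have "modif_vcomp (op2 D) (\<Phi>1 C \<beta>) (\<Phi>1 C \<alpha>) = \<Phi>1 C (\<beta> \<bullet>\<^sub>v \<alpha>)"
      unfolding \<Phi>1_def e
        modif_vcomp_mk_modif[OF W.cocone_map_nat_trans[OF \<alpha>] W.cocone_map_nat_trans[OF \<beta>, unfolded e]]
      by (rule mk_modif_cong) (use \<alpha> \<beta> in simp_all)
    then show ?case by (simp add: representable_def weighted_def Hom_cat_def)
  next
    case (8 H)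
    then show ?case by (simp add: weighted_def weighted_func_def)
  next
    case (9 H G)
    then have H: "cat_functor H" and G: "cat_functor G" "FDom G = W" "FCod G = FDom H"
      by (simp_all add: representable_def)
    note c = comp_W[OF G]
    have "psnat_comp (op2 D) (hom_into_func D F H) (\<Phi>0 (FDom H) G) = \<Phi>0 (FCod H) (comp_func H G)"
      unfolding \<Phi>0_def cocone.mk_comp_func(3)[OF c H refl refl]
      by (rule mk_psnat_cong) (use G in simp_all)
    then show ?case
      using cocone.pseudo_nat_mk_psnat[OF c] G
      by (simp add: weighted_def weighted_func_def Hom_cat_def representable_def \<Phi>0_def)
  next
    case (10 H \<alpha>)
    then have H: "cat_functor H" and \<alpha>: "nat_trans \<alpha>" "FDom (NDom \<alpha>) = W" "FCod (NDom \<alpha>) = FDom H"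
      by (simp_all add: representable_def)
    note c = W.cocone_map_nat_trans[OF \<alpha>]
    have "modif_hcomp (op2 D) (id_modif (op2 D) (hom_into_func D F H)) (\<Phi>1 (FDom H) \<alpha>)
        = \<Phi>1 (FCod H) (id_nat H \<star> \<alpha>)"
      unfolding \<Phi>1_def cocone_map.modif_hcomp_mk_modif[OF c H refl refl]
      by (intro mk_modif_cong mk_psnat_cong) (use \<alpha> H in simp_all)
    then show ?case
      using cocone_map.modification_mk_modif[OF c] \<alpha>
      by (simp add: weighted_def weighted_func_def Hom_cat_def representable_def \<Phi>1_def)
  next
    case (11 \<alpha>)
    then show ?case by (simp add: weighted_def)
  next
    case (12 \<alpha> G)
    then have \<alpha>: "nat_trans \<alpha>" and G: "cat_functor G" "FDom G = W" "FCod G = FDom (NDom \<alpha>)"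
      by (simp_all add: representable_def)
    note c = comp_W[OF G]
    have "modif_hcomp (op2 D) (hom_into_nat D F \<alpha>) (id_modif (op2 D) (\<Phi>0 (FDom (NDom \<alpha>)) G))
        = \<Phi>1 (FCod (NDom \<alpha>)) (\<alpha> \<star> id_nat G)"
      unfolding \<Phi>0_def \<Phi>1_def cocone.modif_hcomp_hom_into_nat[OF c \<alpha> refl refl]
      by (intro mk_modif_cong mk_psnat_cong) (use \<alpha> G in simp_all)
    then show ?case
      using cocone.pseudo_nat_mk_psnat[OF c] G
      by (simp add: weighted_def Hom_cat_def representable_def \<Phi>0_def)
  qed
qed

section \<open>Size of the presentation and existence of the colimit\<close>

lemma weight_dataI:
  assumes D: "two_category D" and J: "pseudo_functor (op2 D) (full_cat2 S) J"
    and F: "pseudo_functor D (full_cat2 T) F"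
  shows "weight_data D J F"
proof -
  interpret D: two_category D by (fact D)
  interpret J: pseudo_functor "op2 D" "full_cat2 S" J by (fact J)
  interpret F: pseudo_functor D "full_cat2 T" F by (fact F)
  interpret u: category "under_cat D" by (fact D.under_category)
  interpret v: category "vert_cat D" by (fact D.vert_category)
  have u: "Obj (under_cat D) = Cell0 D" "Arr (under_cat D) = Cell1 D" "Dom (under_cat D) = dom1 D"
    "Cod (under_cat D) = cod1 D" "Idn (under_cat D) = id1 D" "Cmp (under_cat D) = cmp1 D"
    by (simp_all add: under_cat_def)
  have v: "Arr (vert_cat D) = Cell2 D" "Dom (vert_cat D) = src2 D" "Cod (vert_cat D) = trg2 D"
    "Obj (vert_cat D) = Cell1 D"
    by (simp_all add: vert_cat_def)
  have inv: "\<beta> \<in> Cell2 E" if "invertible (vert_cat E) \<beta>" for \<beta> and E :: "('x, 'y, 'z) twocat"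
    using that by (simp add: invertible_def vert_cat_def)
  show ?thesis
    apply (rule weight_data.intro)
    subgoal using u.Dom_in u by simp
    subgoal using u.Cod_in u by simp
    subgoal using u.Idn_in u by simp
    subgoal using u.Dom_Idn u by simp
    subgoal using u.Cod_Idn u by simp
    subgoal using u.Cmp_in u by simp
    subgoal using u.Dom_Cmp u by simp
    subgoal using u.Cod_Cmp u by simp
    subgoal using v.Dom_in v by simp
    subgoal using v.Cod_in v by simp
    subgoal using D.dom1_trg2 by simp
    subgoal using D.cod1_trg2 by simp
    subgoal for d using J.P0_in[of d] by simp
    subgoal for u using J.P1_in[of u] by simp
    subgoal for u using J.P1_dom[of u] by simp
    subgoal for u using J.P1_cod[of u] by simp
    subgoal for \<alpha> using J.P2_in[of \<alpha>] by simp
    subgoal for \<alpha> using J.P2_src[of \<alpha>] by simp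
    subgoal for \<alpha> using J.P2_trg[of \<alpha>] by simp
    subgoal for u v using inv[OF J.PCmp_invertible[of u v]] by simp
    subgoal for u v using J.PCmp_src[of u v] by simp
    subgoal for u v using J.PCmp_trg[of u v] by simp
    subgoal for d using inv[OF J.PIdn_invertible[of d]] by simp
    subgoal for d using J.PIdn_src[of d] by simp
    subgoal for d using J.PIdn_trg[of d] by simp
    subgoal for d using F.P0_in[of d] by simp
    subgoal for u using F.P1_in[of u] by simp
    subgoal for u using F.P1_dom[of u] by simp
    subgoal for u using F.P1_cod[of u] by simp
    subgoal for \<alpha> using F.P2_in[of \<alpha>] by simp
    subgoal for \<alpha> using F.P2_src[of \<alpha>] by simp
    subgoal for \<alpha> using F.P2_trg[of \<alpha>] by simp
    subgoal for u v using inv[OF F.PCmp_invertible[of v u]] by simp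
    subgoal for u v using F.PCmp_src[of v u] by simp
    subgoal for u v using F.PCmp_trg[of v u] by simp
    subgoal for d using inv[OF F.PIdn_invertible[of d]] by simp
    subgoal for d using F.PIdn_src[of d] by simp
    subgoal for d using F.PIdn_trg[of d] by simp
    done
qed

text \<open>Each constructor contributes an image of a sum of small sets over the 0-cells or 1-cells
  of \<open>D\<close>, which stability bounds.\<close>

lemma (in weight_data) card_of_gens:
  assumes \<kappa>: "uncountable_regular \<kappa>"
    and D: "|Cell0 D| <o \<kappa>" "|Cell1 D| <o \<kappa>"
    and J: "\<And>d. d \<in> Cell0 D \<Longrightarrow> small_cat \<kappa> (P0 J d)"
    and F: "\<And>d. d \<in> Cell0 D \<Longrightarrow> small_cat \<kappa> (P0 F d)"
  shows "|gen_obs| <o \<kappa>" "|gens| <o \<kappa>"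
proof -
  note Sig = stable_elim[OF uncountable_regular_stable[OF \<kappa>]]
  have s: "|Obj (P0 J d)| <o \<kappa>" "|Arr (P0 J d)| <o \<kappa>" "|Obj (P0 F d)| <o \<kappa>" "|Arr (P0 F d)| <o \<kappa>"
    if "d \<in> Cell0 D" for d
    using J[OF that] F[OF that] by (simp_all add: small_cat_def)
  show "|gen_obs| <o \<kappa>" unfolding gen_obs_def by (intro Sig D s)
  let ?A = "(\<lambda>(d, x, \<psi>). GF d x \<psi>) ` (SIGMA d : Cell0 D. Obj (P0 J d) \<times> Arr (P0 F d))"
  let ?B = "(\<lambda>(d, \<phi>, a). GJ d \<phi> a) ` (SIGMA d : Cell0 D. Arr (P0 J d) \<times> Obj (P0 F d))"
  let ?K = "SIGMA u : Cell1 D. Obj (P0 J (cod1 D u)) \<times> Obj (P0 F (dom1 D u))"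
  let ?C = "(\<lambda>(u, x, a). GK u x a) ` ?K" and ?C' = "(\<lambda>(u, x, a). GKinv u x a) ` ?K"
  have "gens \<subseteq> (?A \<union> ?B) \<union> (?C \<union> ?C')"
  proof
    fix \<gamma> assume "\<gamma> \<in> gens"
    then show "\<gamma> \<in> (?A \<union> ?B) \<union> (?C \<union> ?C')" by (cases \<gamma>) (auto simp: image_iff)
  qed
  moreover have "|(?A \<union> ?B) \<union> (?C \<union> ?C')| <o \<kappa>"
    by (intro uncountable_regular_Un[OF \<kappa>] card_of_image_ordLess Sig D s) simp_all
  ultimately show "|gens| <o \<kappa>" by (rule card_of_subset_ordLess[rotated])
qed

text \<open>The models are the cocones in small categories over \<open>'u\<close> themselves. Such a
  cocone is at once a test for equality of words and a target of the universal property: the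
  relations hold in \<open>W\<close> because they hold in every test, and the evaluation functors
  are the mediating ones.\<close>

lemma (in weight_data) weighted_pseudo_colimit_exists:
  fixes \<kappa> :: "'u rel"
  assumes \<kappa>: "uncountable_regular \<kappa>" and small: "|gen_obs| <o \<kappa>" "|gens| <o \<kappa>"
  shows "\<exists>W :: ('u, 'u) cat. small_cat \<kappa> W \<and>
    two_naturally_isomorphic (Cat \<kappa>) (representable W) (weighted D J F)"
proof -
  define M :: "('u, 'u, 'o \<times> 'c \<times> 'a, ('o, 'm, 'c, 'd, 'a, 'b) gen) graph_model set"
    where "M = {(C, ob, ar). small_cat \<kappa> C \<and> cocone D J F C ob ar}"
  obtain W :: "('u, 'u) cat" and obW arW E where W: "small_cat \<kappa> W" "bij_betw obW gen_obs (Obj W)"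
    and arW: "\<And>\<gamma>. \<gamma> \<in> gens \<Longrightarrow>
      arW \<gamma> \<in> Arr W \<and> Dom W (arW \<gamma>) = obW (gen_src \<gamma>) \<and> Cod W (arW \<gamma>) = obW (gen_trg \<gamma>)"
    and E: "\<And>C ob ar. (C, ob, ar) \<in> M \<Longrightarrow> E (C, ob, ar) \<in> functors W C
      \<and> (\<forall>p\<in>gen_obs. FOb (E (C, ob, ar)) (obW p) = ob p) \<and> (\<forall>\<gamma>\<in>gens. FAr (E (C, ob, ar)) (arW \<gamma>) = ar \<gamma>)"
    and faithful: "\<And>f f'. \<lbrakk>f \<in> Arr W; f' \<in> Arr W; Dom W f = Dom W f'; Cod W f = Cod W f';
      \<And>m. m \<in> M \<Longrightarrow> FAr (E m) f = FAr (E m) f'\<rbrakk> \<Longrightarrow> f = f'"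
    and induct: "\<And>P f. \<lbrakk>f \<in> Arr W; \<And>p. p \<in> gen_obs \<Longrightarrow> P (Idn W (obW p));
      \<And>\<gamma> f. \<lbrakk>\<gamma> \<in> gens; f \<in> Arr W; Dom W f = obW (gen_trg \<gamma>); P f\<rbrakk> \<Longrightarrow> P (Cmp W f (arW \<gamma>))\<rbrakk> \<Longrightarrow> P f"
  proof (rule presented_category[OF \<kappa> small, of gen_src gen_trg M])
    fix C ob ar assume "(C, ob, ar) \<in> M"
    then interpret cocone D J F C ob ar by (simp add: M_def)
    show "category C" by simp
    show "ob x \<in> Obj C" if "x \<in> gen_obs" for x using that by simp
    show "ar \<gamma> \<in> Arr C \<and> Dom C (ar \<gamma>) = ob (gen_src \<gamma>) \<and> Cod C (ar \<gamma>) = ob (gen_trg \<gamma>)"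
      if "\<gamma> \<in> gens" for \<gamma> using that by simp
  qed (use gen_src_trg in blast)+
  have cW [simp]: "category W" using W(1) by (simp add: small_cat_def)
  have obW [simp]: "obW p \<in> Obj W" if "p \<in> gen_obs" for p
    using that W(2) by (auto simp: bij_betw_def)
  have arW_simps [simp]: "arW \<gamma> \<in> Arr W" "Dom W (arW \<gamma>) = obW (gen_src \<gamma>)" "Cod W (arW \<gamma>) = obW (gen_trg \<gamma>)"
    if "\<gamma> \<in> gens" for \<gamma> using arW[OF that] by simp_all
  \<comment> \<open>Joint faithfulness with the evaluation functor replaced by a variable
    \<open>H\<close> known only through its values on generators. An equation of words in
    \<open>W\<close> thereby turns into the same equation in a cocone.\<close>
  have eqI: "f = f'" if "f \<in> Arr W" "f' \<in> Arr W" "Dom W f = Dom W f'" "Cod W f = Cod W f'"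
    and eq: "\<And>(C :: ('u, 'u) cat) ob ar H. \<lbrakk>cocone D J F C ob ar; cat_functor H; FDom H = W; FCod H = C;
      \<And>p. p \<in> gen_obs \<Longrightarrow> FOb H (obW p) = ob p; \<And>\<gamma>. \<gamma> \<in> gens \<Longrightarrow> FAr H (arW \<gamma>) = ar \<gamma>\<rbrakk>
      \<Longrightarrow> FAr H f = FAr H f'" for f f'
  proof (rule faithful[OF that(1-4)])
    fix m assume m: "m \<in> M"
    obtain C ob ar where "m = (C, ob, ar)" by (cases m)
    then show "FAr (E m) f = FAr (E m) f'"
      using E[of C ob ar] m by (intro eq[of C ob ar]) (simp_all add: M_def)
  qed
  have "cocone D J F W obW arW"
  \<comment> \<open>Goals 6 to 17 are the relations; each follows by \<open>eqI\<close> from the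
    same relation in the test cocone.\<close>
  proof (intro cocone.intro weight_data_axioms cocone_axioms.intro, goal_cases)
    case (6 d x a)
    then show ?case
      by - (rule eqI, simp_all, (frule cocone.F_Idn[of D J F _ _ _ d x a]; simp))
  next
    case (7 d x \<psi> \<psi>')
    then show ?case
      by - (rule eqI, simp_all, (frule cocone.F_Cmp[of D J F _ _ _ d x \<psi> \<psi>']; simp))
  next
    case (8 d x a)
    then show ?case
      by - (rule eqI, simp_all, (frule cocone.J_Idn[of D J F _ _ _ d x a]; simp))
  next
    case (9 d a \<phi> \<phi>')
    then show ?case
      by - (rule eqI, simp_all, (frule cocone.J_Cmp[of D J F _ _ _ d a \<phi> \<phi>']; simp))
  next
    case (10 d \<phi> \<psi>)
    then show ?case
      by - (rule eqI, simp_all, (frule cocone.FJ[of D J F _ _ _ d \<phi> \<psi>]; simp))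
  next
    case (11 u x a)
    then show ?case
      by - (rule eqI, simp_all, (frule cocone.K_inv(1)[of D J F _ _ _ u x a]; simp))
  next
    case (12 u x a)
    then show ?case
      by - (rule eqI, simp_all, (frule cocone.K_inv(2)[of D J F _ _ _ u x a]; simp))
  next
    case (13 u \<phi> a)
    then show ?case
      by - (rule eqI, simp_all, (frule cocone.K_J[of D J F _ _ _ u \<phi> a]; simp))
  next
    case (14 u x \<psi>)
    then show ?case
      by - (rule eqI, simp_all, (frule cocone.K_F[of D J F _ _ _ u x \<psi>]; simp))
  next
    case (15 \<alpha> x a)
    then show ?case
      by - (rule eqI, simp_all, (frule cocone.K_2[of D J F _ _ _ \<alpha> x a]; simp))
  next
    case (16 u v x a)
    then show ?case
      by - (rule eqI, simp_all, (frule cocone.K_Cmp[of D J F _ _ _ u v x a]; simp))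
  next
    case (17 d x a)
    then show ?case
      by - (rule eqI, simp_all, (frule cocone.K_Idn[of D J F _ _ _ d x a]; simp))
  qed simp_all
  then have "two_naturally_isomorphic (full_cat2 {C :: ('u, 'u) cat. small_cat \<kappa> C}) (representable W) (weighted D J F)"
  proof (rule two_naturally_isomorphic_weighted[OF _ W(2)])
    show "P f" if "f \<in> Arr W" "\<And>p. p \<in> gen_obs \<Longrightarrow> P (Idn W (obW p))"
      "\<And>\<gamma> f. \<lbrakk>\<gamma> \<in> gens; f \<in> Arr W; Dom W f = obW (gen_trg \<gamma>); P f\<rbrakk> \<Longrightarrow> P (Cmp W f (arW \<gamma>))" for P f
      using that by (rule induct)
    \<comment> \<open>The mediating functor is evaluation at the given cocone, which belongs to
      \<open>M\<close> because \<open>C\<close> is small.\<close>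
    show "\<exists>H\<in>functors W C. (\<forall>p\<in>gen_obs. FOb H (obW p) = ob p) \<and> (\<forall>\<gamma>\<in>gens. FAr H (arW \<gamma>) = ar \<gamma>)"
      if "C \<in> {C :: ('u, 'u) cat. small_cat \<kappa> C}" "cocone D J F C ob ar" for C :: "('u, 'u) cat" and ob ar
      using E[of C ob ar] that by (intro bexI[of _ "E (C, ob, ar)"]) (simp_all add: M_def)
  qed
  then show ?thesis using W(1) by (auto simp: Cat_def)
qed

theorem lemma4p11:
  fixes \<kappa> :: "'u rel" and D :: "('o, 'm, 'n) twocat"
    and J F :: "('o, 'm, 'n, 'u, 'u) psfun_cat"
  assumes "uncountable_regular \<kappa>"
    and "small_two_category \<kappa> D"
    and "pseudo_functor (op2 D) (Cat \<kappa>) J"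
    and "pseudo_functor D (Cat \<kappa>) F"
  shows "\<exists>W. weighted_pseudo_colimit \<kappa> D J F W"
proof -
  have D: "two_category D" "|Cell0 D| <o \<kappa>" "|Cell1 D| <o \<kappa>"
    using assms(2) by (simp_all add: small_two_category_def)
  interpret weight_data D J F
    using weight_dataI[OF D(1)] assms(3,4) by (simp add: Cat_def)
  have "small_cat \<kappa> (P0 J d)" "small_cat \<kappa> (P0 F d)" if "d \<in> Cell0 D" for d
    using pseudo_functor.P0_in[OF assms(3), of d] pseudo_functor.P0_in[OF assms(4), of d] that
    by (simp_all add: Cat_def)
  then obtain W :: "('u, 'u) cat" where "small_cat \<kappa> W"
    "two_naturally_isomorphic (Cat \<kappa>) (representable W) (weighted D J F)"
    using weighted_pseudo_colimit_exists[OF assms(1) card_of_gens[OF assms(1) D(2,3)]] by blast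
  then show ?thesis
    by (auto simp: weighted_pseudo_colimit_def Cat_def small_cat_def)
qed

end
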